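(* Let $b,\sigma,X_0$ satisfy (A1), (A2), (A6), (A7) and let $\mathcal T_1,\mathcal T_2$ satisfy (H1), (H2) (all conditions as listed in the context). Put $$\mathcal G=\max\Big\{6\rho,\ \frac{(2\rho+1)r_2-1}{r_1}\Big\},$$ with $\rho>0$ from (A6) and $r_1,r_2>0$ from (H2), and let $\bar p$ satisfy $p_0\ge\bar p\ge 1+\frac52\mathcal G$. Then for all $k=0,1,\dots,n$ there exist $\beta>1$ and $K>0$, independent of $n$ and $h$, such that $$\sup_{i\in\{1,\dots,N\}}\mathbb E\big[|X_k^{i,N,n}|^{2p}\big]\le K\big(1+\mathbb E[|X_0|^{2p\beta}]\big),\qquad \forall\, p\in\Big[1,\frac{2\bar p-\mathcal G}{2+4\mathcal G}\Big].$$
   Context: Notation. $|\cdot|$, $\langle\cdot,\cdot\rangle$ are the Euclidean norm and inner product on $\mathbb R^d$, $\|\cdot\|$ is the Frobenius norm. $\mathcal P_2(\mathbb R^d)$ is the set of probability measures on $\mathbb R^d$ with finite second moment, with the $2$-Wasserstein metric $\mathcal W_2$; $\delta_x$ is the Dirac measure at $x$. Setting. $T>0$ is fixed; $b:[0,T]\times\mathbb R^d\times\mathcal P_2(\mathbb R^d)\to\mathbb R^d$; $\sigma=(\sigma_1,\dots,\sigma_m):[0,T]\times\mathbb R^d\times\mathcal P_2(\mathbb R^d)\to\mathbb R^{d\times m}$, with $\sigma_r$ the $r$-th column. $W$ is a standard $m$-dimensional Brownian motion and $X_0$ is an $\mathbb R^d$-valued random variable independent of $W$. For $N\in\mathbb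 N$, $(W^i,X_0^i)$, $i=1,\dots,N$, are $N$ independent copies of $(W,X_0)$, $W^i=(W^i_1,\dots,W^i_m)$. Scheme. For $n\in\mathbb N$ let $h=T/n\in(0,1)$ and $t_k=kh$, $k=0,\dots,n$. Let $\mathcal T_1,\mathcal T_2:\mathbb R^d\times(0,1)\to\mathbb R^d$. The modified Euler approximation is $X_0^{i,N,n}=X_0^i$ and, for $k=0,\dots,n-1$, $i=1,\dots,N$, $$X_{k+1}^{i,N,n}=X_k^{i,N,n}+\mathcal T_1\big(b(t_k,X_k^{i,N,n},\mu_{t_k}^{X,N,n}),h\big)h+\sum_{r=1}^m\mathcal T_2\big(\sigma_r(t_k,X_k^{i,N,n},\mu_{t_k}^{X,N,n}),h\big)\big(W_r^i(t_{k+1})-W_r^i(t_k)\big),$$ where $\mu_{t_k}^{X,N,n}=\frac1N\sum_{j=1}^N\delta_{X_k^{j,N,n}}$. Conditions. (A1) $\mathbb E[|X_0|^{2p_0}]<\infty$ for a fixed constant $p_0>1$. (A2) There is $L>0$ such that $2\langle x,b(t,x,\mu)\rangle+(2p_0-1)\|\sigma(t,x,\mu)\|^2\le L(1+|x|^2+\mathcal W_2^2(\mu,\delta_0))$ for all $t\in[0,T]$, $x\in\mathbb R^d$, $\mu\in\mathcal P_2(\mathbb R^d)$. (A6) There are $L>0$, $\rho>0$ such that $|b(t,x,\mu)-b(t,y,\nu)|\le L(1+|x|^{2\rho}+|y|^{2\rho})|x-y|+L\mathcal W_2(\mu,\nu)$ for all $t\in[0,T]$, $x,y\in\mathbb R^d$,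 $\mu,\nu\in\mathcal P_2(\mathbb R^d)$. (A7) There is $L>0$ such that $|b(t,x,\mu)-b(s,x,\mu)|+\|\sigma(t,x,\mu)-\sigma(s,x,\mu)\|\le L|t-s|^{1/2}$ for all $t,s\in[0,T]$, $x\in\mathbb R^d$, $\mu\in\mathcal P_2(\mathbb R^d)$. (H1) There is $L>0$ such that $|\mathcal T_1(x,h)|\le\min\{Lh^{-2},|x|\}$ and $|\mathcal T_2(x,h)|\le\min\{Lh^{-3/2},|x|\}$ for all $x\in\mathbb R^d$, $h\in(0,1)$. (H2) There are $L,r_1,r_2>0$ such that $|\mathcal T_1(x,h)-x|\le Lh^{r_1}|x|^{r_2}$ for all $x\in\mathbb R^d$, $h\in(0,1)$. *)

theory Defs
  imports "HOL-Probability.Probability"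
begin

definition P2 :: "('a::euclidean_space) measure set" where
  "P2 = {\<mu>. prob_space \<mu> \<and> sets \<mu> = sets borel \<and> integrable \<mu> (\<lambda>x. (norm x)\<^sup>2)}"

definition couplings ::
    "('a::euclidean_space) measure \<Rightarrow> 'a measure \<Rightarrow> ('a \<times> 'a) measure set" where
  "couplings \<mu> \<nu> = {\<pi>. prob_space \<pi> \<and> sets \<pi> = sets (borel \<Otimes>\<^sub>M borel) \<and>
      distr \<pi> borel fst = \<mu> \<and> distr \<pi> borel snd = \<nu>}"

text \<open>
  Only meant for \<open>\<mu>, \<nu> \<in> P2\<close>: then every transport cost below is a convergent integral and the
  infimum is over a nonempty set of nonnegative reals.
\<close>

definition W2 :: "('a::euclidean_space) measure \<Rightarrow> 'a measure \<Rightarrow> real" where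
  "W2 \<mu> \<nu> = sqrt (INF \<pi>\<in>couplings \<mu> \<nu>. \<integral>z. (norm (fst z - snd z))\<^sup>2 \<partial>\<pi>)"

text \<open>The generators are the open sets of the metric space \<open>(P2, W2)\<close>.\<close>

definition borel_P2 :: "('a::euclidean_space) measure measure" where
  "borel_P2 = sigma P2
     {U. U \<subseteq> P2 \<and> (\<forall>\<mu>\<in>U. \<exists>e>0. \<forall>\<nu>\<in>P2. W2 \<mu> \<nu> < e \<longrightarrow> \<nu> \<in> U)}"

text \<open>
  The average of the Dirac measures at \<open>x 1, \<dots>, x N\<close>, see \<open>emeasure_empirical\<close>; written as an image
  measure because measures have no library addition.
\<close>

definition empirical :: "nat \<Rightarrow> (nat \<Rightarrow> 'a::euclidean_space) \<Rightarrow> 'a measure" where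
  "empirical N x = distr (uniform_count_measure {1..N}) borel x"

lemma emeasure_empirical:
  assumes "N \<ge> 1" and A: "A \<in> sets borel"
  shows "emeasure (empirical N x) A
    = (\<Sum>j=1..N. emeasure (return borel (x j)) A) / of_nat N"
proof -
  have "emeasure (empirical N x) A
      = emeasure (uniform_count_measure {1..N}) {j\<in>{1..N}. x j \<in> A}"
    unfolding empirical_def using A
    by (subst emeasure_distr)
       (auto simp: uniform_count_measure_def space_point_measure measurable_def
          sets_point_measure intro!: arg_cong[where f="emeasure _"])
  also have "\<dots> = ennreal (card {j\<in>{1..N}. x j \<in> A} / card {1..N})"
    by (rule emeasure_uniform_count_measure) auto
  also have "\<dots> = of_nat (card {j\<in>{1..N}. x j \<in> A}) / of_nat N"
    using assms(1) by (simp add: divide_ennreal[symmetric] ennreal_of_nat_eq_real_of_nat)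
  also have "of_nat (card {j\<in>{1..N}. x j \<in> A})
      = (\<Sum>j=1..N. emeasure (return borel (x j)) A)"
    using A by (simp add: indicator_def sum.If_cases Int_def of_bool_def)
  finally show ?thesis .
qed

abbreviation path_space :: "real \<Rightarrow> (real \<Rightarrow> 'b::topological_space) measure" where
  "path_space T \<equiv> PiM {0..T} (\<lambda>_. borel)"

abbreviation path :: "real \<Rightarrow> (real \<Rightarrow> 'w \<Rightarrow> 'b) \<Rightarrow> 'w \<Rightarrow> (real \<Rightarrow> 'b)" where
  "path T W \<equiv> (\<lambda>\<omega>. \<lambda>t\<in>{0..T}. W t \<omega>)"

definition brownian_motion ::
    "'w measure \<Rightarrow> real \<Rightarrow> (real \<Rightarrow> 'w \<Rightarrow> real ^ 'm::finite) \<Rightarrow> bool" where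
  "brownian_motion M T W \<longleftrightarrow>
     (\<forall>t\<in>{0..T}. W t \<in> borel_measurable M) \<and>
     (AE \<omega> in M. W 0 \<omega> = 0) \<and>
     (AE \<omega> in M. continuous_on {0..T} (\<lambda>t. W t \<omega>)) \<and>
     (\<forall>(l::nat) (t::nat \<Rightarrow> real). mono_on {..l} t \<and> t ` {..l} \<subseteq> {0..T} \<longrightarrow>
        prob_space.indep_vars M (\<lambda>_. borel) (\<lambda>j \<omega>. W (t (Suc j)) \<omega> - W (t j) \<omega>) {..<l}) \<and>
     (\<forall>s t. 0 \<le> s \<and> s < t \<and> t \<le> T \<longrightarrow>
        prob_space.indep_vars M (\<lambda>_. borel) (\<lambda>r \<omega>. W t \<omega> $ r - W s \<omega> $ r) UNIV \<and>
        (\<forall>r. distributed M lborel (\<lambda>\<omega>. W t \<omega> $ r - W s \<omega> $ r)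
               (normal_density 0 (sqrt (t - s)))))"

text \<open>
  Independence of the process \<open>W\<close> and the random variable \<open>X\<close>. The library's \<open>indep_var\<close> is not
  applicable because the two take values in different types.
\<close>

definition indep_of_process ::
    "'w measure \<Rightarrow> real \<Rightarrow> (real \<Rightarrow> 'w \<Rightarrow> 'b::topological_space) \<Rightarrow>
     ('w \<Rightarrow> 'c::topological_space) \<Rightarrow> bool" where
  "indep_of_process M T W X \<longleftrightarrow>
     prob_space.indep_set M
       {path T W -` A \<inter> space M | A. A \<in> sets (path_space T)}
       {X -` B \<inter> space M | B. B \<in> sets borel}"

text \<open>
  The law on the product space does not see path continuity, so it is required separately that
  each \<open>W' i\<close> is a Brownian motion.
\<close>

definition indep_copies ::
    "'w measure \<Rightarrow> real \<Rightarrow> nat \<Rightarrow> (real \<Rightarrow> 'w \<Rightarrow> real ^ 'm::finite) \<Rightarrow>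
     ('w \<Rightarrow> 'c::topological_space) \<Rightarrow> (nat \<Rightarrow> real \<Rightarrow> 'w \<Rightarrow> real ^ 'm) \<Rightarrow>
     (nat \<Rightarrow> 'w \<Rightarrow> 'c) \<Rightarrow> bool" where
  "indep_copies M T N W X W' X' \<longleftrightarrow>
     prob_space.indep_vars M (\<lambda>_. path_space T \<Otimes>\<^sub>M borel)
       (\<lambda>i \<omega>. (path T (W' i) \<omega>, X' i \<omega>)) {1..N} \<and>
     (\<forall>i\<in>{1..N}. brownian_motion M T (W' i) \<and>
        distr M (path_space T \<Otimes>\<^sub>M borel) (\<lambda>\<omega>. (path T (W' i) \<omega>, X' i \<omega>)) =
        distr M (path_space T \<Otimes>\<^sub>M borel) (\<lambda>\<omega>. (path T W \<omega>, X \<omega>)))"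

text \<open>
  A \<open>d \<times> m\<close> matrix has type \<open>real ^ 'm ^ 'd\<close>; its \<open>norm\<close> is the Frobenius norm.
\<close>

lemma norm_matrix_frobenius:
  fixes A :: "real ^ 'm ^ 'd"
  shows "norm A = sqrt (\<Sum>i\<in>UNIV. \<Sum>r\<in>UNIV. (A $ i $ r)\<^sup>2)"
  by (simp add: norm_vec_def L2_set_def sum_nonneg)

text \<open>
  \<open>mod_euler N h b \<sigma> T1 T2 W X k i \<omega>\<close> is the \<open>i\<close>-th of \<open>N\<close> particles after \<open>k\<close> steps of size \<open>h\<close>,
  driven by \<open>W i\<close> and started in \<open>X i\<close>.
\<close>

primrec mod_euler ::
    "nat \<Rightarrow> real \<Rightarrow>
     (real \<Rightarrow> real ^ 'd \<Rightarrow> (real ^ 'd) measure \<Rightarrow> real ^ 'd) \<Rightarrow>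
     (real \<Rightarrow> real ^ 'd \<Rightarrow> (real ^ 'd) measure \<Rightarrow> real ^ 'm ^ 'd) \<Rightarrow>
     (real ^ 'd \<Rightarrow> real \<Rightarrow> real ^ 'd) \<Rightarrow> (real ^ 'd \<Rightarrow> real \<Rightarrow> real ^ 'd) \<Rightarrow>
     (nat \<Rightarrow> real \<Rightarrow> 'w \<Rightarrow> real ^ 'm) \<Rightarrow> (nat \<Rightarrow> 'w \<Rightarrow> real ^ 'd) \<Rightarrow>
     nat \<Rightarrow> nat \<Rightarrow> 'w \<Rightarrow> real ^ 'd" where
  "mod_euler N h b \<sigma> T1 T2 W X 0 = X"
| "mod_euler N h b \<sigma> T1 T2 W X (Suc k) = (\<lambda>i \<omega>.
     let Y = (\<lambda>j. mod_euler N h b \<sigma> T1 T2 W X k j \<omega>);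
         \<mu> = empirical N Y;
         s = real k * h;
         t = real (Suc k) * h
     in Y i + h *\<^sub>R T1 (b s (Y i) \<mu>) h
        + (\<Sum>r\<in>UNIV. (W i t \<omega> $ r - W i s \<omega> $ r) *\<^sub>R T2 (column r (\<sigma> s (Y i) \<mu>)) h))"

definition coercivity ::
    "real \<Rightarrow> real \<Rightarrow>
     (real \<Rightarrow> real ^ 'd \<Rightarrow> (real ^ 'd) measure \<Rightarrow> real ^ 'd) \<Rightarrow>
     (real \<Rightarrow> real ^ 'd \<Rightarrow> (real ^ 'd) measure \<Rightarrow> real ^ 'm ^ 'd) \<Rightarrow> bool" where
  "coercivity T p0 b \<sigma> \<longleftrightarrow> (\<exists>L>0. \<forall>t\<in>{0..T}. \<forall>x. \<forall>\<mu>\<in>P2.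
     2 * (x \<bullet> b t x \<mu>) + (2 * p0 - 1) * (norm (\<sigma> t x \<mu>))\<^sup>2
       \<le> L * (1 + (norm x)\<^sup>2 + (W2 \<mu> (return borel 0))\<^sup>2))"

definition drift_poly_lipschitz ::
    "real \<Rightarrow> real \<Rightarrow>
     (real \<Rightarrow> real ^ 'd \<Rightarrow> (real ^ 'd) measure \<Rightarrow> real ^ 'd) \<Rightarrow> bool" where
  "drift_poly_lipschitz T \<rho> b \<longleftrightarrow> (\<exists>L>0. \<forall>t\<in>{0..T}. \<forall>x y. \<forall>\<mu>\<in>P2. \<forall>\<nu>\<in>P2.
     norm (b t x \<mu> - b t y \<nu>)
       \<le> L * (1 + norm x powr (2 * \<rho>) + norm y powr (2 * \<rho>)) * norm (x - y) + L * W2 \<mu> \<nu>)"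

definition time_hoelder ::
    "real \<Rightarrow>
     (real \<Rightarrow> real ^ 'd \<Rightarrow> (real ^ 'd) measure \<Rightarrow> real ^ 'd) \<Rightarrow>
     (real \<Rightarrow> real ^ 'd \<Rightarrow> (real ^ 'd) measure \<Rightarrow> real ^ 'm ^ 'd) \<Rightarrow> bool" where
  "time_hoelder T b \<sigma> \<longleftrightarrow> (\<exists>L>0. \<forall>t\<in>{0..T}. \<forall>s\<in>{0..T}. \<forall>x. \<forall>\<mu>\<in>P2.
     norm (b t x \<mu> - b s x \<mu>) + norm (\<sigma> t x \<mu> - \<sigma> s x \<mu>) \<le> L * \<bar>t - s\<bar> powr (1 / 2))"

definition taming_bounds ::
    "(real ^ 'd \<Rightarrow> real \<Rightarrow> real ^ 'd) \<Rightarrow> (real ^ 'd \<Rightarrow> real \<Rightarrow> real ^ 'd) \<Rightarrow> bool" where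
  "taming_bounds T1 T2 \<longleftrightarrow> (\<exists>L>0. \<forall>x. \<forall>h\<in>{0<..<1}.
     norm (T1 x h) \<le> min (L * h powr (- 2)) (norm x) \<and>
     norm (T2 x h) \<le> min (L * h powr (- 3 / 2)) (norm x))"

definition taming_consistent ::
    "real \<Rightarrow> real \<Rightarrow> (real ^ 'd \<Rightarrow> real \<Rightarrow> real ^ 'd) \<Rightarrow> bool" where
  "taming_consistent r1 r2 T1 \<longleftrightarrow> (\<exists>L>0. \<forall>x. \<forall>h\<in>{0<..<1}.
     norm (T1 x h - x) \<le> L * h powr r1 * norm x powr r2)"

text \<open>
  Measurability needed for the scheme to consist of random variables. The drift is absent
  because its continuity in \<open>(x, \<mu>)\<close> already follows from \<open>drift_poly_lipschitz\<close>.
\<close>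

definition measurable_data ::
    "real \<Rightarrow> (real \<Rightarrow> real ^ 'd \<Rightarrow> (real ^ 'd) measure \<Rightarrow> real ^ 'm ^ 'd) \<Rightarrow>
     (real ^ 'd \<Rightarrow> real \<Rightarrow> real ^ 'd) \<Rightarrow> (real ^ 'd \<Rightarrow> real \<Rightarrow> real ^ 'd) \<Rightarrow> bool" where
  "measurable_data T \<sigma> T1 T2 \<longleftrightarrow>
     (\<forall>t\<in>{0..T}. (\<lambda>(x, \<mu>). \<sigma> t x \<mu>) \<in> borel_measurable (borel \<Otimes>\<^sub>M borel_P2)) \<and>
     (\<forall>h\<in>{0<..<1}. (\<lambda>x. T1 x h) \<in> borel_measurable borel \<and>
                   (\<lambda>x. T2 x h) \<in> borel_measurable borel)"

end

theory Submission
  imports Defs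
begin

text \<open>
  Since \<open>N\<close> and the law of \<open>X0\<close> are fixed, it suffices to bound the moments uniformly in \<open>n\<close> and
  \<open>k\<close>; any \<open>\<beta>\<close> will do. All particles are estimated at once through the energy
  \<open>A k = 1 + (\<Sum>i. (norm (X k i))\<^sup>2)\<close>, because the drift of one particle grows with the Wasserstein
  distance and thus with the size of the whole system.

  Let \<open>h\<close> be the step size. While the path stays in the good set, \<open>A l \<le> h powr (- 2 / G)\<close> for all
  earlier \<open>l\<close>, the condition \<open>G \<ge> 6 * \<rho>\<close> makes the relative size of a drift step \<open>O(\<kappa>\<^sup>2)\<close> and of a noise
  step \<open>O(\<kappa>)\<close> with \<open>\<kappa> = h powr (1 / 3)\<close>, so that third-order terms of the Taylor expansion of
  \<open>A powr pbar\<close> are \<open>O(h)\<close>; the first two orders are controlled by coercivity, and the taming error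
  by the other condition on \<open>G\<close>. Hence the \<open>pbar\<close>-th moment of \<open>A\<close> on the good set grows by a factor
  of at most \<open>1 + C * h\<close> per step.

  Off the good set, \<open>A k\<close> is at most of order \<open>h powr (- 4)\<close> by the global bounds on the taming
  functions. Chebyshev's inequality at the first exit time compensates this factor, and balancing
  the exponents gives the order \<open>(2 * pbar - G) / (2 + 4 * G)\<close>.
\<close>

section \<open>Powers with real exponents\<close>

text \<open>The obstacle is that the taming bounds alone permit a drift step of order
  \<open>h powr (- 1)\<close>: a tamed step need not be small, and the tamed coefficients need not
  inherit coercivity. Both hold only where the state is moderate, which is why the path is cut at a
  threshold depending on \<open>h\<close>. The threshold gives
  \<open>A powr \<rho> \<le> h powr (- 1 / 3)\<close>; this is the origin of the 6 in
  \<open>6 * \<rho>\<close>. Drift and diffusion grow like \<open>A powr (\<rho> + 1 / 2)\<close>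
  and \<open>A powr ((\<rho> + 1) / 2)\<close>, so compared with \<open>sqrt A\<close> a drift step
  has size \<open>h * A powr \<rho> \<le> \<kappa>\<^sup>2\<close> and a noise step
  \<open>sqrt (h * A powr \<rho>) \<le> \<kappa>\<close>. The good set that enters the estimate of
  step \<open>k\<close> is decided by the path up to time \<open>k\<close>, hence independent of the
  next increment. Expectations of products then factor, and no conditional expectation is formed.
  Energies are integrated as nonnegative functions, so their integrability is a result and not a
  prerequisite.\<close>

lemma powr_le_two_powr_abs:
  fixes t a :: real
  assumes "1 / 2 \<le> t" "t \<le> 2"
  shows "t powr a \<le> 2 powr \<bar>a\<bar>"
proof -
  have "ln (1 / 2) \<le> ln t" "ln t \<le> ln 2"
    using assms by (auto simp del: ln_div)
  then have "\<bar>ln t\<bar> \<le> ln 2"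
    by (simp add: ln_div)
  then have "\<bar>a * ln t\<bar> \<le> \<bar>a\<bar> * ln 2"
    by (simp add: abs_mult mult_left_mono)
  then show ?thesis
    using assms by (simp add: powr_def)
qed

lemma powr_nonneg_exponent_le:
  fixes A B :: real
  assumes "1 \<le> A" "A \<le> B" "a \<le> c" "0 \<le> c"
  shows "A powr a \<le> B powr c"
proof -
  have "A powr a \<le> A powr c" using assms by (intro powr_mono) auto
  also have "\<dots> \<le> B powr c" using assms by (intro powr_mono2) auto
  finally show ?thesis .
qed

text \<open>Every summand, the constant 1 included, is at most the largest one \<open>a\<close>, so
  the whole sum is at most \<open>(1 + card J) * a\<close>; and \<open>a powr p\<close> is itself
  one of the terms on the right.\<close>

lemma one_plus_sum_powr_le:
  fixes y :: "'j \<Rightarrow> real"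
  assumes "finite J" "p \<ge> 0" and y: "\<And>j. j \<in> J \<Longrightarrow> 0 \<le> y j"
  shows "(1 + (\<Sum>j\<in>J. y j)) powr p \<le> real (1 + card J) powr p * (1 + (\<Sum>j\<in>J. y j powr p))"
proof -
  define a where "a = Max (insert 1 (y ` J))"
  have a_in: "a \<in> insert 1 (y ` J)"
    unfolding a_def using assms(1) by (intro Max_in) auto
  have a: "1 \<le> a" "\<And>j. j \<in> J \<Longrightarrow> y j \<le> a"
    unfolding a_def using assms(1) by (auto intro!: Max_ge simp del: Max_insert)
  have pow_nonneg: "0 \<le> (\<Sum>j\<in>J. y j powr p)" by (intro sum_nonneg) simp
  have "1 + (\<Sum>j\<in>J. y j) \<le> a + (\<Sum>j\<in>J. a)"
    using a by (intro add_mono sum_mono) auto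
  also have "\<dots> = real (1 + card J) * a" by (simp add: algebra_simps)
  finally have "(1 + (\<Sum>j\<in>J. y j)) powr p \<le> (real (1 + card J) * a) powr p"
    using y assms(2) by (intro powr_mono2 add_nonneg_nonneg sum_nonneg) auto
  also have "\<dots> = real (1 + card J) powr p * a powr p"
    using a(1) by (simp add: powr_mult)
  also have "a powr p \<le> 1 + (\<Sum>j\<in>J. y j powr p)"
  proof (cases "a = 1")
    case True
    then show ?thesis using pow_nonneg by simp
  next
    case False
    then obtain j where j: "j \<in> J" "a = y j" using a_in by auto
    then have "a powr p \<le> (\<Sum>j\<in>J. y j powr p)"
      using member_le_sum[OF j(1), of "\<lambda>j. y j powr p"] assms(1) by simp
    then show ?thesis by simp
  qed
  finally show ?thesis by (simp add: mult_left_mono)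
qed

text \<open>Derivatives of \<open>t powr p\<close> may blow up at 0, so Lagrange's remainder is used
  only for \<open>\<bar>z\<bar> \<le> 1 / 2\<close>. Elsewhere
  \<open>8 * \<bar>z\<bar> ^ 3 \<ge> 1\<close>, and the cubic term dominates the power at the price
  of the factor \<open>(1 + \<bar>z\<bar>) ^ m\<close>. That factor is harmless later, when
  \<open>z\<close> is bounded by polynomials in Gaussian variables.\<close>

lemma powr_taylor_bound:
  fixes p :: real
  assumes "p \<ge> 1"
  obtains C :: real and m :: nat where "C \<ge> 0"
    "\<And>z. z \<ge> -1 \<Longrightarrow>
      (1 + z) powr p \<le> 1 + p * z + p * (p - 1) / 2 * z\<^sup>2 + C * \<bar>z\<bar> ^ 3 * (1 + \<bar>z\<bar>) ^ m"
proof -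
  define c where "c j = (\<Prod>i<j. p - real i)" for j :: nat
  define f where "f j t = c j * t powr (p - real j)" for j and t :: real
  \<comment> \<open>The three summands pay for Lagrange's remainder, for the power itself when
    \<open>\<bar>z\<bar> > 1 / 2\<close>, and there also for a negative linear term
    \<open>p * z\<close>.\<close>
  define C where "C = \<bar>c 3\<bar> * 2 powr \<bar>p - 3\<bar> + 8 + 4 * p"
  define m where "m = nat \<lceil>p\<rceil>"
  have "C \<ge> 0"
    unfolding C_def using assms by simp
  have c_simps: "c 0 = 1" "c (Suc 0) = p" "c (Suc (Suc 0)) = p * (p - 1)"
    unfolding c_def by simp_all
  have bound: "(1 + z) powr p \<le> 1 + p * z + p * (p - 1) / 2 * z\<^sup>2 + C * \<bar>z\<bar> ^ 3 * (1 + \<bar>z\<bar>) ^ m"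
    if "z \<ge> -1" for z :: real
  proof (cases "\<bar>z\<bar> \<le> 1 / 2")
    case small: True
    have one: "1 \<le> (1 + \<bar>z\<bar>) ^ m"
      by (simp add: one_le_power)
    have rem: "(1 + z) powr p \<le> 1 + p * z + p * (p - 1) / 2 * z\<^sup>2 + C * \<bar>z\<bar> ^ 3"
    proof (cases "z = 0")
      case True
      then show ?thesis by simp
    next
      case False
      have "\<exists>t. (if 1 + z < 1 then 1 + z < t \<and> t < 1 else 1 < t \<and> t < 1 + z) \<and>
        f 0 (1 + z) = (\<Sum>j<3. f j 1 / fact j * (1 + z - 1) ^ j) + f 3 t / fact 3 * (1 + z - 1) ^ 3"
      proof (rule Taylor[where a = "1 / 2" and b = "3 / 2"])
        show "\<forall>j t. j < 3 \<and> 1 / 2 \<le> t \<and> t \<le> 3 / 2 \<longrightarrow> (f j has_real_derivative f (Suc j) t) (at t)"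
        proof safe
          fix j and t :: real
          assume "1 / 2 \<le> t"
          then show "(f j has_real_derivative f (Suc j) t) (at t)"
            unfolding f_def[abs_def] c_def
            by (auto intro!: derivative_eq_intros simp: diff_diff_eq add.commute)
        qed
      qed (use small False in auto)
      then obtain t where between: "if 1 + z < 1 then 1 + z < t \<and> t < 1 else 1 < t \<and> t < 1 + z"
        and expand: "f 0 (1 + z)
          = (\<Sum>j<3. f j 1 / fact j * (1 + z - 1) ^ j) + f 3 t / fact 3 * (1 + z - 1) ^ 3"
        by blast
      have t: "1 / 2 \<le> t" "t \<le> 2"
        using between small by (auto split: if_splits)
      have eq: "(1 + z) powr p = 1 + p * z + p * (p - 1) / 2 * z\<^sup>2 + f 3 t / 6 * z ^ 3"
        using expand by (simp add: f_def c_simps numeral_3_eq_3 numeral_2_eq_2 fact_numeral)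
      have "f 3 t / 6 * z ^ 3 \<le> \<bar>f 3 t\<bar> * \<bar>z\<bar> ^ 3"
      proof -
        have "f 3 t / 6 * z ^ 3 \<le> \<bar>f 3 t / 6 * z ^ 3\<bar>" by simp
        also have "\<dots> \<le> \<bar>f 3 t\<bar> * \<bar>z\<bar> ^ 3"
          by (auto simp: abs_mult power_abs intro!: mult_right_mono)
        finally show ?thesis .
      qed
      also have "\<bar>f 3 t\<bar> \<le> \<bar>c 3\<bar> * 2 powr \<bar>p - 3\<bar>"
        unfolding f_def using powr_le_two_powr_abs[OF t, of "p - 3"]
        by (simp add: abs_mult mult_left_mono)
      also have "\<dots> \<le> C"
        unfolding C_def using assms by simp
      finally show ?thesis
        using eq by (simp add: mult_right_mono)
    qed
    have "C * \<bar>z\<bar> ^ 3 * 1 \<le> C * \<bar>z\<bar> ^ 3 * (1 + \<bar>z\<bar>) ^ m"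
      using one \<open>C \<ge> 0\<close> by (intro mult_left_mono) auto
    then show ?thesis using rem by simp
  next
    case False
    define w where "w = \<bar>z\<bar>"
    have w: "w > 1 / 2" using False by (simp add: w_def)
    have w3: "1 \<le> 8 * w ^ 3"
      using power_mono[of "1 / 2" w 3] w by (simp add: power3_eq_cube field_simps)
    have ww: "w \<le> 4 * w ^ 3"
      using power_mono[of "1 / 2" w 2] w by (simp add: power3_eq_cube power2_eq_square field_simps)
    have one: "1 \<le> (1 + w) ^ m"
      using w by (simp add: one_le_power)
    have "(1 + z) powr p \<le> (1 + w) powr p"
      using that assms by (intro powr_mono2) (auto simp: w_def)
    also have "\<dots> \<le> (1 + w) powr real m"
      using w assms by (intro powr_mono) (auto simp: m_def)
    also have "\<dots> = (1 + w) ^ m"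
      using w by (simp add: powr_realpow)
    also have "\<dots> \<le> 8 * w ^ 3 * (1 + w) ^ m"
      using w3 w mult_right_mono[of 1 "8 * w ^ 3" "(1 + w) ^ m"] by simp
    finally have 1: "(1 + z) powr p \<le> 8 * w ^ 3 * (1 + w) ^ m" .
    have "- (p * z) \<le> p * w"
      using assms by (simp add: w_def abs_if)
    also have "\<dots> \<le> p * (4 * w ^ 3)"
      using ww assms by (intro mult_left_mono) auto
    also have "\<dots> \<le> 4 * p * w ^ 3 * (1 + w) ^ m"
      using one w assms mult_left_mono[of 1 "(1 + w) ^ m" "4 * p * w ^ 3"] by simp
    finally have 2: "- (p * z) \<le> 4 * p * w ^ 3 * (1 + w) ^ m" .
    have 3: "0 \<le> \<bar>c 3\<bar> * 2 powr \<bar>p - 3\<bar> * w ^ 3 * (1 + w) ^ m"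
      using w by simp
    have 4: "0 \<le> p * (p - 1) / 2 * z\<^sup>2"
      using assms by simp
    have "C * w ^ 3 * (1 + w) ^ m = \<bar>c 3\<bar> * 2 powr \<bar>p - 3\<bar> * w ^ 3 * (1 + w) ^ m
        + 8 * w ^ 3 * (1 + w) ^ m + 4 * p * w ^ 3 * (1 + w) ^ m"
      unfolding C_def by (simp add: algebra_simps)
    then show ?thesis
      using 1 2 3 4 unfolding w_def[symmetric] by linarith
  qed
  show ?thesis
    using that[OF \<open>C \<ge> 0\<close> bound] by blast
qed


text \<open>The letters are the terms of the squared norm of state plus drift plus noise, divided by
  the energy: \<open>P\<close> and \<open>Q\<close> pair the state with drift and noise;
  \<open>U\<close>, \<open>V\<close>, \<open>Y\<close> are drift squared, drift times noise, noise
  squared. With drift of order \<open>\<kappa>\<^sup>2\<close> and noise of order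
  \<open>\<kappa>\<close>, only \<open>2 * P + 2 * Q + Y\<close> from the linear Taylor term and
  \<open>4 * Q\<^sup>2\<close> from the quadratic one are below order three.\<close>

lemma powr_expansion_normalized:
  fixes p c :: real
  assumes "p \<ge> 1" "c \<ge> 0"
  obtains C :: real and m :: nat where "C \<ge> 0"
    "\<And>\<kappa> \<zeta> P Q U V Y. \<lbrakk>0 < \<kappa>; \<kappa> \<le> 1; \<zeta> \<ge> 0; \<bar>P\<bar> \<le> c * \<kappa>\<^sup>2; \<bar>Q\<bar> \<le> c * \<kappa> * \<zeta>;
        0 \<le> U; U \<le> c\<^sup>2 * \<kappa> ^ 4; \<bar>V\<bar> \<le> c\<^sup>2 * \<kappa> ^ 3 * \<zeta>; 0 \<le> Y; Y \<le> c\<^sup>2 * \<kappa>\<^sup>2 * \<zeta>\<^sup>2;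
        0 \<le> 1 + 2 * P + 2 * Q + U + 2 * V + Y\<rbrakk> \<Longrightarrow>
      (1 + 2 * P + 2 * Q + U + 2 * V + Y) powr p
        \<le> 1 + p * (2 * P + 2 * Q + Y) + 2 * p * (p - 1) * Q\<^sup>2 + C * \<kappa> ^ 3 * (1 + \<zeta>) ^ m"
proof -
  obtain C0 :: real and m0 :: nat where "C0 \<ge> 0" and taylor: "\<And>z. z \<ge> -1 \<Longrightarrow>
      (1 + z) powr p \<le> 1 + p * z + p * (p - 1) / 2 * z\<^sup>2 + C0 * \<bar>z\<bar> ^ 3 * (1 + \<bar>z\<bar>) ^ m0"
    using powr_taylor_bound[OF assms(1)] by blast
  \<comment> \<open>With \<open>e \<ge> 1\<close> in place of \<open>c\<close>, exponents of
    \<open>e\<close> and of \<open>1 + \<zeta>\<close> may be raised and those of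
    \<open>\<kappa>\<close> lowered, so that all error monomials become comparable.\<close>
  define e where "e = 1 + c"
  define C where "C = p * (3 * e\<^sup>2) + p * (p - 1) * (36 * e ^ 4) + C0 * (8 * e\<^sup>2) ^ 3 * (1 + 8 * e\<^sup>2) ^ m0"
  \<comment> \<open>\<open>z\<close> is at most quadratic in \<open>1 + \<zeta>\<close>, so
    \<open>\<bar>z\<bar> ^ 3 * (1 + \<bar>z\<bar>) ^ m0\<close> has degree at most
    \<open>6 + 2 * m0\<close>.\<close>
  define m where "m = 6 + 2 * m0"
  have e: "e \<ge> 1" "c \<le> e" using assms by (auto simp: e_def)
  have e_pow: "c ^ i \<le> e ^ j" if "i \<le> j" for i j :: nat
  proof -
    have "c ^ i \<le> e ^ i" using e assms by (intro power_mono) auto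
    also have "\<dots> \<le> e ^ j" using e that by (intro power_increasing) auto
    finally show ?thesis .
  qed
  have "C \<ge> 0"
    unfolding C_def using assms \<open>C0 \<ge> 0\<close> e by (auto intro!: add_nonneg_nonneg mult_nonneg_nonneg)
  show ?thesis
  proof (rule that[OF \<open>C \<ge> 0\<close>, of m])
    fix \<kappa> \<zeta> P Q U V Y :: real
    assume \<kappa>: "0 < \<kappa>" "\<kappa> \<le> 1" and \<zeta>: "\<zeta> \<ge> 0" and P: "\<bar>P\<bar> \<le> c * \<kappa>\<^sup>2" and Q: "\<bar>Q\<bar> \<le> c * \<kappa> * \<zeta>"
      and U: "0 \<le> U" "U \<le> c\<^sup>2 * \<kappa> ^ 4" and V: "\<bar>V\<bar> \<le> c\<^sup>2 * \<kappa> ^ 3 * \<zeta>"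
      and Y: "0 \<le> Y" "Y \<le> c\<^sup>2 * \<kappa>\<^sup>2 * \<zeta>\<^sup>2"
      and nonneg: "0 \<le> 1 + 2 * P + 2 * Q + U + 2 * V + Y"
    define x where "x = 1 + \<zeta>"
    have x: "x \<ge> 1" "\<zeta> \<le> x" "\<zeta> \<ge> 0" using \<zeta> by (auto simp: x_def)
    have bd: "c ^ i * \<kappa> ^ j * \<zeta> ^ k \<le> e ^ i' * \<kappa> ^ j' * x ^ k'"
      if "i \<le> i'" "j' \<le> j" "k \<le> k'" for i i' j j' k k' :: nat
    proof -
      have "\<zeta> ^ k \<le> x ^ k" using x by (intro power_mono) auto
      also have "\<dots> \<le> x ^ k'" using x that by (intro power_increasing) auto
      finally have 1: "\<zeta> ^ k \<le> x ^ k'" .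
      have 2: "\<kappa> ^ j \<le> \<kappa> ^ j'" using \<kappa> that by (intro power_decreasing) auto
      show ?thesis
        using 1 2 e_pow[OF that(1)] \<kappa> x e assms
        by (intro mult_mono) auto
    qed
    \<comment> \<open>Collects what is of order at least two in \<open>\<kappa>\<close>, so that in
      \<open>z\<^sup>2 = 4 * Q\<^sup>2 + 4 * (Q * \<beta>) + \<beta>\<^sup>2\<close> only the first
      term is below order three.\<close>
    define \<beta> where "\<beta> = 2 * P + U + 2 * V + Y"
    define z where "z = 2 * Q + \<beta>"
    have P': "\<bar>P\<bar> \<le> e\<^sup>2 * \<kappa>\<^sup>2 * x\<^sup>2" using P bd[of 1 2 2 2 0 2] by simp
    have U': "U \<le> e\<^sup>2 * \<kappa>\<^sup>2 * x\<^sup>2" using U bd[of 2 2 2 4 0 2] by simp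
    have V': "\<bar>V\<bar> \<le> e\<^sup>2 * \<kappa>\<^sup>2 * x\<^sup>2" using V bd[of 2 2 2 3 1 2] by simp
    have Y': "Y \<le> e\<^sup>2 * \<kappa>\<^sup>2 * x\<^sup>2" using Y bd[of 2 2 2 2 2 2] by simp
    have Q': "\<bar>Q\<bar> \<le> e * \<kappa> * x" using Q bd[of 1 1 1 1 1 1] by simp
    have \<beta>: "\<bar>\<beta>\<bar> \<le> 6 * (e\<^sup>2 * \<kappa>\<^sup>2 * x\<^sup>2)"
      using P' U' V' Y' U Y unfolding \<beta>_def by linarith
    have UV: "U + 2 * V \<le> 3 * e\<^sup>2 * \<kappa> ^ 3 * x ^ m"
      using U V bd[of 2 2 3 4 0 m] bd[of 2 2 3 3 1 m] by (simp add: m_def)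
    have ex: "e * \<kappa> * x \<ge> 0" using e \<kappa> x by simp
    have Q\<beta>: "4 * (Q * \<beta>) \<le> 24 * (e ^ 4 * \<kappa> ^ 3 * x ^ m)"
    proof -
      have "Q * \<beta> \<le> \<bar>Q\<bar> * \<bar>\<beta>\<bar>" by (metis abs_ge_self abs_mult)
      also have "\<dots> \<le> (e * \<kappa> * x) * (6 * (e\<^sup>2 * \<kappa>\<^sup>2 * x\<^sup>2))"
        using Q' \<beta> ex by (intro mult_mono) auto
      also have "\<dots> = 6 * (e ^ 3 * \<kappa> ^ 3 * x ^ 3)"
        by (simp add: power2_eq_square power3_eq_cube algebra_simps)
      also have "\<dots> \<le> 6 * (e ^ 4 * \<kappa> ^ 3 * x ^ m)"
        using e x \<kappa> power_increasing[of 3 4 e] power_increasing[of 3 m x]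
        by (intro mult_left_mono mult_mono) (auto simp: m_def)
      finally show ?thesis by linarith
    qed
    have \<beta>\<beta>: "\<beta>\<^sup>2 \<le> 36 * (e ^ 4 * \<kappa> ^ 3 * x ^ m)"
    proof -
      have "\<beta>\<^sup>2 = \<bar>\<beta>\<bar>\<^sup>2" by simp
      also have "\<dots> \<le> (6 * (e\<^sup>2 * \<kappa>\<^sup>2 * x\<^sup>2))\<^sup>2"
        using \<beta> by (intro power_mono) auto
      also have "\<dots> = 36 * (e ^ 4 * \<kappa> ^ 4 * x ^ 4)"
        by (simp add: power_mult_distrib flip: power_mult)
      also have "\<dots> \<le> 36 * (e ^ 4 * \<kappa> ^ 3 * x ^ m)"
        using e x \<kappa> power_decreasing[of 3 4 \<kappa>] power_increasing[of 4 m x]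
        by (intro mult_left_mono mult_mono) (auto simp: m_def)
      finally show ?thesis .
    qed
    have z: "\<bar>z\<bar> \<le> 8 * e\<^sup>2 * (\<kappa> * x\<^sup>2)"
    proof -
      have "2 * \<bar>Q\<bar> \<le> 2 * (e\<^sup>2 * \<kappa> * x\<^sup>2)" using Q bd[of 1 2 1 1 1 2] by simp
      moreover have "e\<^sup>2 * \<kappa>\<^sup>2 * x\<^sup>2 \<le> e\<^sup>2 * \<kappa> * x\<^sup>2"
        using \<kappa> power_decreasing[of 1 2 \<kappa>] by (intro mult_mono) auto
      ultimately show ?thesis using \<beta> unfolding z_def by (simp add: algebra_simps)
    qed
    have z3: "\<bar>z\<bar> ^ 3 * (1 + \<bar>z\<bar>) ^ m0 \<le> (8 * e\<^sup>2) ^ 3 * (1 + 8 * e\<^sup>2) ^ m0 * (\<kappa> ^ 3 * x ^ m)"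
    proof -
      have "\<kappa> * x\<^sup>2 \<le> 1 * x\<^sup>2" using \<kappa> by (intro mult_right_mono) auto
      then have "8 * e\<^sup>2 * (\<kappa> * x\<^sup>2) \<le> 8 * e\<^sup>2 * x\<^sup>2" using e by simp
      then have "1 + \<bar>z\<bar> \<le> x\<^sup>2 + 8 * e\<^sup>2 * x\<^sup>2"
        using z one_le_power[OF x(1), of 2] by linarith
      then have "1 + \<bar>z\<bar> \<le> (1 + 8 * e\<^sup>2) * x\<^sup>2"
        by (simp add: algebra_simps)
      then have "\<bar>z\<bar> ^ 3 * (1 + \<bar>z\<bar>) ^ m0 \<le> (8 * e\<^sup>2 * (\<kappa> * x\<^sup>2)) ^ 3 * ((1 + 8 * e\<^sup>2) * x\<^sup>2) ^ m0"
        using z \<kappa> by (intro mult_mono power_mono) auto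
      also have "\<dots> = (8 * e\<^sup>2) ^ 3 * (1 + 8 * e\<^sup>2) ^ m0 * (\<kappa> ^ 3 * x ^ m)"
        unfolding m_def by (simp add: power_mult_distrib power_add mult_ac flip: power_mult)
      finally show ?thesis .
    qed
    have z2: "z\<^sup>2 \<le> 4 * Q\<^sup>2 + 2 * (36 * (e ^ 4 * \<kappa> ^ 3 * x ^ m))"
    proof -
      have "z\<^sup>2 = 4 * Q\<^sup>2 + 4 * (Q * \<beta>) + \<beta>\<^sup>2"
        unfolding z_def by (simp add: power2_eq_square algebra_simps)
      moreover have "0 \<le> e ^ 4 * \<kappa> ^ 3 * x ^ m" using e \<kappa> x by simp
      ultimately show ?thesis using Q\<beta> \<beta>\<beta> by linarith
    qed
    have "(1 + z) powr p \<le> 1 + p * z + p * (p - 1) / 2 * z\<^sup>2 + C0 * (\<bar>z\<bar> ^ 3 * (1 + \<bar>z\<bar>) ^ m0)"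
      using taylor[of z] nonneg by (simp add: z_def \<beta>_def mult.assoc)
    also have "\<dots> \<le> 1 + p * (2 * P + 2 * Q + Y + 3 * e\<^sup>2 * \<kappa> ^ 3 * x ^ m)
        + p * (p - 1) / 2 * (4 * Q\<^sup>2 + 2 * (36 * (e ^ 4 * \<kappa> ^ 3 * x ^ m)))
        + C0 * ((8 * e\<^sup>2) ^ 3 * (1 + 8 * e\<^sup>2) ^ m0 * (\<kappa> ^ 3 * x ^ m))"
      using assms \<open>C0 \<ge> 0\<close> UV z2 z3
      by (intro add_mono mult_left_mono order.refl) (auto simp: z_def \<beta>_def)
    also have "\<dots> = 1 + p * (2 * P + 2 * Q + Y) + 2 * p * (p - 1) * Q\<^sup>2 + C * \<kappa> ^ 3 * x ^ m"
      unfolding C_def by (simp add: field_simps)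
    finally show "(1 + 2 * P + 2 * Q + U + 2 * V + Y) powr p
        \<le> 1 + p * (2 * P + 2 * Q + Y) + 2 * p * (p - 1) * Q\<^sup>2 + C * \<kappa> ^ 3 * (1 + \<zeta>) ^ m"
      unfolding z_def \<beta>_def x_def by (simp add: add_ac)
  qed
qed

section \<open>Empirical measures and the Wasserstein distance\<close>

lemma W2_le:
  assumes "\<pi> \<in> couplings \<mu> \<nu>"
  shows "W2 \<mu> \<nu> \<le> sqrt (\<integral>z. (norm (fst z - snd z))\<^sup>2 \<partial>\<pi>)"
  unfolding W2_def using assms
  by (intro real_sqrt_le_mono cINF_lower bdd_belowI2[where m = 0]) auto

lemma measurable_uniform_count_measure:
  "f \<in> A \<rightarrow> space M \<Longrightarrow> f \<in> measurable (uniform_count_measure A) M"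
  by (simp add: uniform_count_measure_def)

lemma integral_uniform_count_measure:
  fixes f :: "'a \<Rightarrow> real"
  assumes "finite A"
  shows "integral\<^sup>L (uniform_count_measure A) f = (\<Sum>a\<in>A. f a) / card A"
  using assms by (simp add: uniform_count_measure_def lebesgue_integral_point_measure_finite
      sum_divide_distrib)

lemma integrable_uniform_count_measure:
  fixes f :: "'a \<Rightarrow> real"
  assumes "finite A"
  shows "integrable (uniform_count_measure A) f"
  using assms by (simp add: uniform_count_measure_def integrable_point_measure_finite)

lemma empirical_in_P2: "N \<ge> 1 \<Longrightarrow> empirical N x \<in> P2"
  unfolding P2_def empirical_def
  by (auto intro!: prob_space.prob_space_distr prob_space_uniform_count_measure
      simp: integrable_distr_eq integrable_uniform_count_measure)

lemma empirical_zero: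
  assumes "N \<ge> 1"
  shows "empirical N (\<lambda>_. 0) = return borel 0"
proof (rule measure_eqI)
  fix A assume "A \<in> sets (empirical N (\<lambda>_. 0 :: 'a))"
  then have "A \<in> sets borel" by (simp add: empirical_def)
  then show "emeasure (empirical N (\<lambda>_. 0)) A = emeasure (return borel 0) A"
    using assms by (simp add: emeasure_empirical indicator_def ennreal_of_nat_eq_real_of_nat
      divide_ennreal)
qed (simp add: empirical_def)

lemma return_zero_in_P2: "return borel 0 \<in> P2"
  using empirical_in_P2[of 1 "\<lambda>_. 0"] by (simp add: empirical_zero)

text \<open>Pairing \<open>x j\<close> with \<open>y j\<close> index by index, that is, pushing the
  uniform measure on the indices forward along \<open>j \<mapsto> (x j, y j)\<close>, is a coupling,
  in general not an optimal one. The estimate serves twice: for the continuity of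
  \<open>empirical\<close> and, with \<open>y = 0\<close>, for the distance to the Dirac measure at
  0.\<close>

lemma W2_empirical_le:
  assumes "N \<ge> 1"
  shows "W2 (empirical N x) (empirical N y) \<le> sqrt ((\<Sum>j=1..N. (norm (x j - y j))\<^sup>2) / N)"
proof -
  let ?U = "uniform_count_measure {1..N}"
  let ?\<pi> = "distr ?U (borel \<Otimes>\<^sub>M borel) (\<lambda>j. (x j, y j))"
  have meas: "(\<lambda>j. (x j, y j)) \<in> measurable ?U (borel \<Otimes>\<^sub>M borel)"
    by (intro measurable_uniform_count_measure) (auto simp: space_pair_measure)
  have "?\<pi> \<in> couplings (empirical N x) (empirical N y)"
    unfolding couplings_def empirical_def using assms meas
    by (auto intro!: prob_space.prob_space_distr prob_space_uniform_count_measure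
        simp: distr_distr comp_def)
  then have "W2 (empirical N x) (empirical N y) \<le> sqrt (\<integral>z. (norm (fst z - snd z))\<^sup>2 \<partial>?\<pi>)"
    by (rule W2_le)
  also have "(\<integral>z. (norm (fst z - snd z))\<^sup>2 \<partial>?\<pi>) = (\<Sum>j=1..N. (norm (x j - y j))\<^sup>2) / N"
    using meas by (subst integral_distr) (simp_all add: integral_uniform_count_measure)
  finally show ?thesis .
qed

lemma empirical_cong: "(\<And>j. j \<in> {1..N} \<Longrightarrow> x j = y j) \<Longrightarrow> empirical N x = empirical N y"
  unfolding empirical_def by (intro distr_cong) (auto simp: uniform_count_measure_def space_point_measure)

text \<open>Only the coordinates in \<open>J\<close> are known to be measurable. Replacing the
  others by 0 gives a measurable map into the space of all sequences, where continuity arguments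
  apply.\<close>

lemma measurable_restricted_family:
  fixes Y :: "'w \<Rightarrow> nat \<Rightarrow> 'a::euclidean_space"
  assumes "\<And>j. j \<in> J \<Longrightarrow> (\<lambda>\<omega>. Y \<omega> j) \<in> borel_measurable M"
  shows "(\<lambda>\<omega> j. if j \<in> J then Y \<omega> j else 0) \<in> borel_measurable M"
proof (rule measurable_coordinatewise_then_product)
  show "(\<lambda>\<omega>. if j \<in> J then Y \<omega> j else 0) \<in> borel_measurable M" for j
    using assms by (cases "j \<in> J") auto
qed

lemma continuous_on_empirical_distance:
  fixes y0 :: "nat \<Rightarrow> 'a::euclidean_space"
  shows "continuous_on UNIV (\<lambda>y. sqrt ((\<Sum>j=1..N. (norm (y0 j - y j))\<^sup>2) / real N))"
  by (cases "N = 0") (auto intro!: continuous_intros continuous_on_product_coordinates)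

text \<open>By \<open>W2_empirical_le\<close> the map \<open>empirical N\<close> is continuous from
  the product topology to the Wasserstein distance, so preimages of the generators of
  \<open>borel_P2\<close> are open.\<close>

lemma measurable_empirical:
  fixes Y :: "'w \<Rightarrow> nat \<Rightarrow> 'a::euclidean_space"
  assumes "N \<ge> 1" "\<And>j. j \<in> {1..N} \<Longrightarrow> (\<lambda>\<omega>. Y \<omega> j) \<in> borel_measurable M"
  shows "(\<lambda>\<omega>. empirical N (Y \<omega>)) \<in> measurable M borel_P2"
proof -
  have E: "(empirical N :: (nat \<Rightarrow> 'a) \<Rightarrow> _) \<in> measurable borel borel_P2"
    unfolding borel_P2_def
  proof (rule measurable_measure_of)
    fix U :: "'a measure set"
    assume "U \<in> {U. U \<subseteq> P2 \<and> (\<forall>\<mu>\<in>U. \<exists>e>0. \<forall>\<nu>\<in>P2. W2 \<mu> \<nu> < e \<longrightarrow> \<nu> \<in> U)}"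
    then have U: "\<And>\<mu>. \<mu> \<in> U \<Longrightarrow> \<exists>e>0. \<forall>\<nu>\<in>P2. W2 \<mu> \<nu> < e \<longrightarrow> \<nu> \<in> U"
      by blast
    have "open (empirical N -` U)"
      unfolding open_subopen[of "empirical N -` U"]
    proof safe
      fix y0 assume "empirical N y0 \<in> U"
      then obtain e where e: "e > 0" "\<forall>\<nu>\<in>P2. W2 (empirical N y0) \<nu> < e \<longrightarrow> \<nu> \<in> U"
        using U by blast
      let ?d = "\<lambda>y. sqrt ((\<Sum>j=1..N. (norm (y0 j - y j))\<^sup>2) / real N)"
      have "open {y. ?d y < e}"
        by (rule open_Collect_less[OF continuous_on_empirical_distance continuous_on_const])
      moreover have "{y. ?d y < e} \<subseteq> empirical N -` U"
      proof
        fix y assume "y \<in> {y. ?d y < e}"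
        then have "?d y < e" by simp
        then have "W2 (empirical N y0) (empirical N y) < e"
          using W2_empirical_le[OF assms(1), of y0 y] by linarith
        then show "y \<in> empirical N -` U"
          using e(2) empirical_in_P2[OF assms(1)] by blast
      qed
      ultimately show "\<exists>V. open V \<and> y0 \<in> V \<and> V \<subseteq> empirical N -` U"
        using e(1) by (intro exI[of _ "{y. ?d y < e}"]) auto
    qed
    then show "empirical N -` U \<inter> space borel \<in> sets borel"
      by simp
  qed (use assms(1) in \<open>auto simp: empirical_in_P2\<close>)
  have "(\<lambda>\<omega>. empirical N (\<lambda>j. if j \<in> {1..N} then Y \<omega> j else 0)) \<in> measurable M borel_P2"
    by (rule measurable_compose[OF measurable_restricted_family[OF assms(2)] E])
  also have "(\<lambda>\<omega>. empirical N (\<lambda>j. if j \<in> {1..N} then Y \<omega> j else 0)) = (\<lambda>\<omega>. empirical N (Y \<omega>))"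
    by (intro ext empirical_cong) simp
  finally show ?thesis .
qed

text \<open>The polynomial Lipschitz bound, with \<open>W2_empirical_le\<close> in place of the
  Wasserstein term, dominates the change of the drift by a continuous function \<open>H\<close> that
  vanishes at the base point. Hence the drift is continuous in the vector of all particles.\<close>

lemma drift_measurable:
  fixes b :: "real \<Rightarrow> real ^ 'd::finite \<Rightarrow> (real ^ 'd) measure \<Rightarrow> real ^ 'd"
  assumes "drift_poly_lipschitz T \<rho> b" "\<rho> > 0" "N \<ge> 1" "t \<in> {0..T}" "i \<in> {1..N}"
    and Y: "\<And>j. j \<in> {1..N} \<Longrightarrow> (\<lambda>\<omega>. Y \<omega> j) \<in> borel_measurable M"
  shows "(\<lambda>\<omega>. b t (Y \<omega> i) (empirical N (Y \<omega>))) \<in> borel_measurable M"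
proof -
  define F where "F y = b t (y i) (empirical N y)" for y
  obtain L where L: "L > 0" "\<And>x y \<mu> \<nu>. \<mu> \<in> P2 \<Longrightarrow> \<nu> \<in> P2 \<Longrightarrow> norm (b t x \<mu> - b t y \<nu>)
       \<le> L * (1 + norm x powr (2 * \<rho>) + norm y powr (2 * \<rho>)) * norm (x - y) + L * W2 \<mu> \<nu>"
    using assms(1,4) unfolding drift_poly_lipschitz_def by blast
  have "isCont F y0" for y0
  proof -
    define H where "H y = L * (1 + norm (y0 i) powr (2 * \<rho>) + norm (y i) powr (2 * \<rho>)) * norm (y0 i - y i)
      + L * sqrt ((\<Sum>j=1..N. (norm (y0 j - y j))\<^sup>2) / real N)" for y
    have "continuous_on UNIV H"
      unfolding H_def using assms(2,3)
      by (intro continuous_intros continuous_on_product_coordinates continuous_on_powr') auto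
    then have "isCont H y0"
      by (simp add: continuous_on_eq_continuous_at)
    then have H: "(H \<longlongrightarrow> 0) (at y0)"
      by (simp add: isCont_def H_def)
    have "norm (F y - F y0) \<le> H y" for y
    proof -
      have "norm (F y0 - F y) \<le> L * (1 + norm (y0 i) powr (2 * \<rho>) + norm (y i) powr (2 * \<rho>)) * norm (y0 i - y i)
        + L * W2 (empirical N y0) (empirical N y)"
        unfolding F_def using assms(3) by (intro L(2) empirical_in_P2)
      also have "\<dots> \<le> H y"
        unfolding H_def using L(1) W2_empirical_le[OF assms(3), of y0 y] by simp
      finally show ?thesis by (simp add: norm_minus_commute)
    qed
    then have "((\<lambda>y. F y - F y0) \<longlongrightarrow> 0) (at y0)"
      by (intro Lim_null_comparison[OF _ H]) simp
    then show ?thesis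
      unfolding isCont_def by (rule LIM_zero_cancel)
  qed
  then have "continuous_on UNIV F"
    by (simp add: continuous_at_imp_continuous_on)
  then have F: "F \<in> borel_measurable borel"
    by (rule borel_measurable_continuous_onI)
  have "(\<lambda>\<omega>. F (\<lambda>j. if j \<in> {1..N} then Y \<omega> j else 0)) \<in> borel_measurable M"
    by (rule measurable_compose[OF measurable_restricted_family[OF Y] F])
  also have "(\<lambda>\<omega>. F (\<lambda>j. if j \<in> {1..N} then Y \<omega> j else 0)) = (\<lambda>\<omega>. F (Y \<omega>))"
    unfolding F_def using assms(5) by (intro ext arg_cong2[of _ _ _ _ "b t"] empirical_cong) auto
  finally show ?thesis unfolding F_def .
qed

lemma diffusion_measurable:
  fixes \<sigma> :: "real \<Rightarrow> real ^ 'd::finite \<Rightarrow> (real ^ 'd) measure \<Rightarrow> real ^ 'm::finite ^ 'd"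
  assumes "measurable_data T \<sigma> T1 T2" "N \<ge> 1" "t \<in> {0..T}" "i \<in> {1..N}"
    and Y: "\<And>j. j \<in> {1..N} \<Longrightarrow> (\<lambda>\<omega>. Y \<omega> j) \<in> borel_measurable M"
  shows "(\<lambda>\<omega>. \<sigma> t (Y \<omega> i) (empirical N (Y \<omega>))) \<in> borel_measurable M"
proof -
  have "(\<lambda>(x, \<mu>). \<sigma> t x \<mu>) \<in> borel_measurable (borel \<Otimes>\<^sub>M borel_P2)"
    using assms(1,3) by (simp add: measurable_data_def)
  moreover have "(\<lambda>\<omega>. (Y \<omega> i, empirical N (Y \<omega>))) \<in> measurable M (borel \<Otimes>\<^sub>M borel_P2)"
    using assms(4) by (intro measurable_Pair Y measurable_empirical assms(2))
  ultimately show ?thesis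
    by (auto dest: measurable_compose)
qed

section \<open>Independence and Gaussian moments\<close>

text \<open>The sigma-algebra generated by the variables \<open>Z i\<close> with
  \<open>i \<in> K\<close>. It is realised as a preimage algebra of the product because independence
  of blocks of a family is available for exactly these restricted families.\<close>

definition generated_algebra ::
    "'w measure \<Rightarrow> ('i \<Rightarrow> 'a measure) \<Rightarrow> ('i \<Rightarrow> 'w \<Rightarrow> 'a) \<Rightarrow> 'i set \<Rightarrow> 'w measure" where
  "generated_algebra M S Z K = vimage_algebra (space M) (\<lambda>\<omega>. \<lambda>i\<in>K. Z i \<omega>) (PiM K S)"

lemma space_generated_algebra [simp]: "space (generated_algebra M S Z K) = space M"
  by (simp add: generated_algebra_def)

lemma generated_algebra_sets:
  assumes "\<And>i. i \<in> K \<Longrightarrow> Z i \<in> measurable M (S i)"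
  shows "sets (generated_algebra M S Z K) = {(\<lambda>\<omega>. \<lambda>i\<in>K. Z i \<omega>) -` A \<inter> space M | A. A \<in> sets (PiM K S)}"
proof -
  have "(\<lambda>\<omega>. \<lambda>i\<in>K. Z i \<omega>) \<in> space M \<rightarrow> space (PiM K S)"
    using measurable_space[OF assms] by (auto simp: space_PiM PiE_iff)
  then show ?thesis
    unfolding generated_algebra_def by (rule sets_vimage_algebra2)
qed

lemma measurable_generated_algebra_component:
  assumes "\<And>i. i \<in> K \<Longrightarrow> Z i \<in> measurable M (S i)" "i \<in> K"
  shows "Z i \<in> measurable (generated_algebra M S Z K) (S i)"
proof -
  have "(\<lambda>\<omega>. \<lambda>i\<in>K. Z i \<omega>) \<in> measurable (generated_algebra M S Z K) (PiM K S)"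
    unfolding generated_algebra_def using measurable_space[OF assms(1)]
    by (intro measurable_vimage_algebra1) (auto simp: space_PiM PiE_iff)
  from measurable_compose[OF this measurable_component_singleton[OF assms(2)]]
  show ?thesis using assms(2) by simp
qed

lemma measurable_from_generated_algebra:
  assumes "\<And>i. i \<in> K \<Longrightarrow> Z i \<in> measurable M (S i)" "g \<in> measurable (generated_algebra M S Z K) R"
  shows "g \<in> measurable M R"
proof -
  have "(\<lambda>\<omega>. \<lambda>i\<in>K. Z i \<omega>) \<in> measurable M (PiM K S)"
    using assms(1) by (rule measurable_restrict)
  then have "sets (generated_algebra M S Z K) \<subseteq> sets M"
    unfolding generated_algebra_sets[of K Z M S, OF assms(1), simplified] by auto
  then show ?thesis
    using assms(2) by (auto simp: measurable_def)
qed

text \<open>Disjoint blocks of an independent family generate independent sigma-algebras, and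
  independence passes down to the smaller sigma-algebras of \<open>g\<close> and \<open>f\<close>.
  This takes the place of conditioning on the past.\<close>

lemma (in prob_space) indep_var_generated_algebras:
  assumes Z: "indep_vars S Z I" and KL: "K \<inter> L = {}" "K \<subseteq> I" "L \<subseteq> I"
    and g: "g \<in> measurable (generated_algebra M S Z K) R"
    and f: "f \<in> measurable (generated_algebra M S Z L) R'"
  shows "indep_var R g R' f"
proof -
  have rv: "\<And>i. i \<in> I \<Longrightarrow> random_variable (S i) (Z i)"
    using Z by (simp add: indep_vars_def2)
  have rvK: "\<And>i. i \<in> K \<Longrightarrow> random_variable (S i) (Z i)"
    and rvL: "\<And>i. i \<in> L \<Longrightarrow> random_variable (S i) (Z i)"
    using rv KL by auto
  have ind: "indep_set (sets (generated_algebra M S Z K)) (sets (generated_algebra M S Z L))"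
    using indep_var_restrict[OF Z KL] unfolding indep_var_eq
    by (simp add: generated_algebra_def sets_vimage_algebra)
  have sub: "sigma_sets (space M) {g -` A \<inter> space M | A. A \<in> sets R} \<subseteq> sets (generated_algebra M S Z K)"
    "sigma_sets (space M) {f -` A \<inter> space M | A. A \<in> sets R'} \<subseteq> sets (generated_algebra M S Z L)"
    using sets.sigma_sets_subset[of "{g -` A \<inter> space M | A. A \<in> sets R}" "generated_algebra M S Z K"]
      sets.sigma_sets_subset[of "{f -` A \<inter> space M | A. A \<in> sets R'}" "generated_algebra M S Z L"]
      measurable_sets[OF g] measurable_sets[OF f] by auto
  have "indep_set (sigma_sets (space M) {g -` A \<inter> space M | A. A \<in> sets R})
      (sigma_sets (space M) {f -` A \<inter> space M | A. A \<in> sets R'})"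
    using ind sub unfolding indep_sets2_eq by blast
  moreover have "random_variable R g" "random_variable R' f"
    using measurable_from_generated_algebra[of K Z M S, OF rvK g]
      measurable_from_generated_algebra[of L Z M S, OF rvL f] by auto
  ultimately show ?thesis
    unfolding indep_var_eq by blast
qed

lemma (in prob_space) indep_vars_pair:
  assumes "indep_vars S Z I" "i \<in> I" "j \<in> I" "i \<noteq> j"
  shows "indep_var (S i) (Z i) (S j) (Z j)"
proof -
  have rv: "\<And>i. i \<in> I \<Longrightarrow> random_variable (S i) (Z i)"
    using assms(1) by (simp add: indep_vars_def2)
  show ?thesis
    by (rule indep_var_generated_algebras[OF assms(1), of "{i}" "{j}"])
      (use assms rv in \<open>auto intro!: measurable_generated_algebra_component\<close>)
qed

text \<open>Division by \<open>sqrt h\<close> makes the variable standard normal, so the moment does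
  not depend on the step size. Uniformity in \<open>n\<close> of all remainder bounds rests on
  this.\<close>

lemma (in prob_space) normal_absolute_moment:
  fixes D :: "'a \<Rightarrow> real"
  assumes "h > 0" "distributed M lborel D (normal_density 0 (sqrt h))"
  shows "integrable M (\<lambda>\<omega>. \<bar>D \<omega> / sqrt h\<bar> ^ q)"
    and "expectation (\<lambda>\<omega>. \<bar>D \<omega> / sqrt h\<bar> ^ q) = (\<integral>x. std_normal_density x * \<bar>x\<bar> ^ q \<partial>lborel)"
proof -
  have std: "distributed M lborel (\<lambda>\<omega>. D \<omega> / sqrt h) std_normal_density"
    using assms normal_standard_normal_convert[of "sqrt h" D 0] by simp
  show "integrable M (\<lambda>\<omega>. \<bar>D \<omega> / sqrt h\<bar> ^ q)"
    using distributed_integrable[OF std, of "\<lambda>x. \<bar>x\<bar> ^ q"] integrable_std_normal_moment_abs by simp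
  show "expectation (\<lambda>\<omega>. \<bar>D \<omega> / sqrt h\<bar> ^ q) = (\<integral>x. std_normal_density x * \<bar>x\<bar> ^ q \<partial>lborel)"
    using distributed_integral[OF std, of "\<lambda>x. \<bar>x\<bar> ^ q"] by simp
qed

lemma (in prob_space) normal_centered_moments:
  fixes D :: "'a \<Rightarrow> real"
  assumes "h > 0" and D: "distributed M lborel D (normal_density 0 (sqrt h))"
  shows "integrable M D" "expectation D = 0"
    and "integrable M (\<lambda>\<omega>. D \<omega> * D \<omega>)" "expectation (\<lambda>\<omega>. D \<omega> * D \<omega>) = h"
proof -
  show "integrable M D"
    using distributed_integrable[OF D, of "\<lambda>x. x"] assms integrable_normal_moment_nz_1[of "sqrt h" 0] by simp
  show "expectation D = 0"
    using normal_distributed_expectation[OF _ D] assms by simp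
  have "integrable M (\<lambda>\<omega>. (D \<omega>)\<^sup>2)"
    using distributed_integrable[OF D, of "\<lambda>x. x\<^sup>2"] assms integrable_normal_moment[of "sqrt h" 0 2] by simp
  then show "integrable M (\<lambda>\<omega>. D \<omega> * D \<omega>)"
    by (simp add: power2_eq_square)
  show "expectation (\<lambda>\<omega>. D \<omega> * D \<omega>) = h"
    using normal_distributed_variance[OF _ D] normal_distributed_expectation[OF _ D] assms
    by (simp add: power2_eq_square)
qed

text \<open>Independence is assumed for the original pair only. Equality of the joint laws transfers
  the probabilities of rectangles \<open>C \<times> B\<close>, and those of the marginals by taking
  \<open>B = UNIV\<close> or \<open>C\<close> the whole space, so the factorization carries over to
  the copy.\<close>

lemma (in prob_space) particle_indep:
  fixes W V :: "real \<Rightarrow> 'a \<Rightarrow> real ^ 'm::finite" and X Y :: "'a \<Rightarrow> 'c::euclidean_space"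
  assumes W: "path T W \<in> measurable M (path_space T)" and X: "X \<in> borel_measurable M"
    and V: "path T V \<in> measurable M (path_space T)" and Y: "Y \<in> borel_measurable M"
    and indep: "indep_of_process M T W X"
    and law: "distr M (path_space T \<Otimes>\<^sub>M borel) (\<lambda>\<omega>. (path T V \<omega>, Y \<omega>))
      = distr M (path_space T \<Otimes>\<^sub>M borel) (\<lambda>\<omega>. (path T W \<omega>, X \<omega>))"
    and C: "C \<in> sets (path_space T)" and B: "B \<in> sets borel"
  shows "prob {\<omega>\<in>space M. path T V \<omega> \<in> C \<and> Y \<omega> \<in> B}
    = prob {\<omega>\<in>space M. path T V \<omega> \<in> C} * prob {\<omega>\<in>space M. Y \<omega> \<in> B}"
proof -
  have eq: "prob {\<omega>\<in>space M. path T V \<omega> \<in> C \<and> Y \<omega> \<in> B} = prob {\<omega>\<in>space M. path T W \<omega> \<in> C \<and> X \<omega> \<in> B}"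
    if C: "C \<in> sets (path_space T)" and B: "B \<in> sets borel" for C B
  proof -
    have "C \<times> B \<in> sets (path_space T \<Otimes>\<^sub>M (borel :: 'c measure))"
      using C B by simp
    then have "prob ((\<lambda>\<omega>. (path T V \<omega>, Y \<omega>)) -` (C \<times> B) \<inter> space M)
      = prob ((\<lambda>\<omega>. (path T W \<omega>, X \<omega>)) -` (C \<times> B) \<inter> space M)"
      using arg_cong[OF law, of "\<lambda>\<mu>. measure \<mu> (C \<times> B)"] W X V Y
      by (simp add: measure_distr)
    then show ?thesis
      by (simp add: vimage_def Int_def conj_commute conj_left_commute)
  qed
  have prod: "prob {\<omega>\<in>space M. path T W \<omega> \<in> C \<and> X \<omega> \<in> B}
      = prob {\<omega>\<in>space M. path T W \<omega> \<in> C} * prob {\<omega>\<in>space M. X \<omega> \<in> B}"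
  proof -
    have "prob ((path T W -` C \<inter> space M) \<inter> (X -` B \<inter> space M))
      = prob (path T W -` C \<inter> space M) * prob (X -` B \<inter> space M)"
      using indep C B unfolding indep_of_process_def by (intro indep_setD) auto
    then show ?thesis
      by (simp add: vimage_def Int_def conj_commute conj_left_commute cong: conj_cong)
  qed
  have "prob {\<omega>\<in>space M. path T V \<omega> \<in> C} = prob {\<omega>\<in>space M. path T W \<omega> \<in> C}"
    using eq[OF C, of UNIV] by simp
  moreover have "prob {\<omega>\<in>space M. Y \<omega> \<in> B} = prob {\<omega>\<in>space M. X \<omega> \<in> B}"
  proof -
    have "space (path_space T :: (real \<Rightarrow> real ^ 'm) measure) \<in> sets (path_space T)" by blast
    from eq[OF this B] show ?thesis
      by (simp add: space_PiM)
  qed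
  ultimately show ?thesis
    using eq[OF C B] prod by simp
qed

text \<open>
  Initial values and increments are embedded into one product type, because \<open>indep_vars\<close> requires a
  common type of values. Index \<open>(i, 0)\<close> carries the initial value of particle \<open>i\<close> and
  \<open>(i, Suc k)\<close> its increment over step \<open>k\<close>.
\<close>

definition noise ::
    "real \<Rightarrow> (nat \<Rightarrow> real \<Rightarrow> 'w \<Rightarrow> real ^ 'm::finite) \<Rightarrow> (nat \<Rightarrow> 'w \<Rightarrow> real ^ 'd::finite) \<Rightarrow>
     nat \<times> nat \<Rightarrow> 'w \<Rightarrow> (real ^ 'm) \<times> (real ^ 'd)" where
  "noise h W X = (\<lambda>(i, l) \<omega>. case l of 0 \<Rightarrow> (0, X i \<omega>)
     | Suc k \<Rightarrow> (W i (real (Suc k) * h) \<omega> - W i (real k * h) \<omega>, 0))"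

lemma noise_simps [simp]:
  "noise h W X (i, 0) \<omega> = (0, X i \<omega>)"
  "noise h W X (i, Suc k) \<omega> = (W i (real (Suc k) * h) \<omega> - W i (real k * h) \<omega>, 0)"
  by (simp_all add: noise_def)

lemma borel_Pair_section:
  fixes B :: "('a::euclidean_space \<times> 'b::euclidean_space) set"
  assumes "B \<in> sets borel"
  shows "{x. (x, 0) \<in> B} \<in> sets borel" "{y. (0, y) \<in> B} \<in> sets borel"
proof -
  have "(\<lambda>x. (x, 0 :: 'b)) -` B \<inter> space borel \<in> sets borel" "(\<lambda>y. (0 :: 'a, y)) -` B \<inter> space borel \<in> sets borel"
    by (rule measurable_sets[OF _ assms], simp)+
  then show "{x. (x, 0) \<in> B} \<in> sets borel" "{y. (0, y) \<in> B} \<in> sets borel"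
    by (simp_all add: vimage_def)
qed

text \<open>Three independences are composed: between particles, between path and initial value of
  one particle, and between the increments of one path. The probability of an intersection is
  factored in this order.\<close>

lemma (in prob_space) indep_vars_noise:
  fixes W :: "real \<Rightarrow> 'a \<Rightarrow> real ^ 'm::finite" and X :: "'a \<Rightarrow> real ^ 'd::finite"
  assumes "T > 0" "n \<ge> 1" "N \<ge> 1" and BM: "brownian_motion M T W" and X: "X \<in> borel_measurable M"
    and indep: "indep_of_process M T W X" and copies: "indep_copies M T N W X W' X'"
  shows "indep_vars (\<lambda>_. borel) (noise (T / n) W' X') ({1..N} \<times> {..n})"
proof -
  define h where "h = T / n"
  have h: "h > 0" "real n * h = T" using assms by (auto simp: h_def)
  have grid: "real k * h \<in> {0..T}" if "k \<le> n" for k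
  proof -
    have "real k * h \<le> real n * h" using that h by (intro mult_right_mono) auto
    then show ?thesis using h by simp
  qed
  have joint: "indep_vars (\<lambda>_. path_space T \<Otimes>\<^sub>M borel) (\<lambda>i \<omega>. (path T (W' i) \<omega>, X' i \<omega>)) {1..N}"
    and BM': "\<And>i. i \<in> {1..N} \<Longrightarrow> brownian_motion M T (W' i)"
    and law: "\<And>i. i \<in> {1..N} \<Longrightarrow> distr M (path_space T \<Otimes>\<^sub>M borel) (\<lambda>\<omega>. (path T (W' i) \<omega>, X' i \<omega>)) =
        distr M (path_space T \<Otimes>\<^sub>M borel) (\<lambda>\<omega>. (path T W \<omega>, X \<omega>))"
    using copies unfolding indep_copies_def by auto
  have path_meas: "path T V \<in> measurable M (path_space T)" if "brownian_motion M T V"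
    for V :: "real \<Rightarrow> 'a \<Rightarrow> real ^ 'm"
    using that unfolding brownian_motion_def by (intro measurable_restrict) auto
  have X': "X' i \<in> borel_measurable M" if "i \<in> {1..N}" for i
  proof -
    have "(\<lambda>\<omega>. (path T (W' i) \<omega>, X' i \<omega>)) \<in> measurable M (path_space T \<Otimes>\<^sub>M borel)"
      using joint that by (simp add: indep_vars_def2)
    from measurable_compose[OF this measurable_snd] show ?thesis by simp
  qed
  have incr_meas: "(\<lambda>\<omega>. W' i (real (Suc l) * h) \<omega> - W' i (real l * h) \<omega>) \<in> borel_measurable M"
    if "i \<in> {1..N}" "Suc l \<le> n" for i l
  proof -
    have "W' i (real (Suc l) * h) \<in> borel_measurable M" "W' i (real l * h) \<in> borel_measurable M"
      using BM'[OF that(1)] grid[of "Suc l"] grid[of l] that(2) unfolding brownian_motion_def by auto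
    then show ?thesis by (rule borel_measurable_diff)
  qed
  let ?I = "{1..N} \<times> {..n}"
  let ?Z = "noise h W' X'"
  have rv: "?Z p \<in> borel_measurable M" if "p \<in> ?I" for p
  proof (cases p)
    case (Pair i l)
    then show ?thesis
    proof (cases l)
      case 0
      then have "?Z p = (\<lambda>\<omega>. (0, X' i \<omega>))" using Pair by auto
      then show ?thesis using X' that Pair by simp
    next
      case (Suc k)
      then have "?Z p = (\<lambda>\<omega>. (W' i (real (Suc k) * h) \<omega> - W' i (real k * h) \<omega>, 0))"
        using Pair by auto
      then show ?thesis
        using incr_meas[of i k] that Pair Suc by (auto intro!: borel_measurable_Pair simp del: of_nat_Suc)
    qed
  qed
  have "indep_sets (\<lambda>p. {?Z p -` A \<inter> space M | A. A \<in> sets borel}) ?I"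
  \<comment> \<open>Each class contains the whole space, so the product formula for the full index
    set covers all subfamilies.\<close>
  proof (subst indep_sets_finite)
    show "?I \<noteq> {}" using \<open>N \<ge> 1\<close> by auto
    show "\<And>p. p \<in> ?I \<Longrightarrow> {?Z p -` A \<inter> space M | A. A \<in> sets borel} \<subseteq> events"
      using rv by (auto intro: measurable_sets)
    show "\<And>p. p \<in> ?I \<Longrightarrow> space M \<in> {?Z p -` A \<inter> space M | A. A \<in> sets borel}"
      by (auto intro!: exI[of _ UNIV])
    show "\<forall>A\<in>Pi ?I (\<lambda>p. {?Z p -` A \<inter> space M | A. A \<in> sets borel}).
      prob (\<Inter>p\<in>?I. A p) = (\<Prod>p\<in>?I. prob (A p))"
    proof
      fix A assume "A \<in> Pi ?I (\<lambda>p. {?Z p -` A \<inter> space M | A. A \<in> sets borel})"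
      then have "\<forall>p\<in>?I. \<exists>B. B \<in> sets borel \<and> A p = ?Z p -` B \<inter> space M" by blast
      then obtain B where B: "\<And>p. p \<in> ?I \<Longrightarrow> B p \<in> sets borel"
        and A: "\<And>p. p \<in> ?I \<Longrightarrow> A p = ?Z p -` B p \<inter> space M"
        by metis
      \<comment> \<open>One component of every noise value is constantly 0, so only the sections of
        \<open>B\<close> at 0 matter.\<close>
      define B0 where "B0 i = {x. (0, x) \<in> B (i, 0)}" for i
      define B1 where "B1 i l = {v. (v, 0) \<in> B (i, Suc l)}" for i l
      \<comment> \<open>The conditions on all increments of particle \<open>i\<close> are merged
        into one event on its path, because independence from the initial value is a property of the
        whole path.\<close>
      define C where "C i = {f \<in> space (path_space T). \<forall>l\<in>{..<n}. f (real (Suc l) * h) - f (real l * h) \<in> B1 i l}"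
        for i
      have B0: "B0 i \<in> sets borel" if "i \<in> {1..N}" for i
        unfolding B0_def using that B by (intro borel_Pair_section) auto
      have B1: "B1 i l \<in> sets borel" if "i \<in> {1..N}" "l < n" for i l
        unfolding B1_def using that B by (intro borel_Pair_section) auto
      have C: "C i \<in> sets (path_space T)" if "i \<in> {1..N}" for i
      proof -
        have "{f \<in> space (path_space T). f (real (Suc l) * h) - f (real l * h) \<in> B1 i l} \<in> sets (path_space T)"
          if l: "l \<in> {..<n}" for l
        proof -
          have "(\<lambda>f :: real \<Rightarrow> real ^ 'm. f (real (Suc l) * h) - f (real l * h))
              \<in> borel_measurable (path_space T)"
            using grid[of "Suc l"] grid[of l] l
            by (intro borel_measurable_diff measurable_component_singleton) auto
          from measurable_sets[OF this B1[OF \<open>i \<in> {1..N}\<close>, of l]] show ?thesis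
            using l by (simp add: vimage_def Int_def conj_commute)
        qed
        then show ?thesis
          unfolding C_def by (intro sets.sets_Collect_finite_All) auto
      qed
      let ?P = "\<lambda>i \<omega>. (path T (W' i) \<omega>, X' i \<omega>)"
      have path_C: "path T (W' i) \<omega> \<in> C i \<longleftrightarrow>
        (\<forall>l\<in>{..<n}. W' i (real (Suc l) * h) \<omega> - W' i (real l * h) \<omega> \<in> B1 i l)" for i \<omega>
        unfolding C_def using grid by (auto simp: space_PiM simp del: of_nat_Suc)
      have A0: "A (i, 0) = {\<omega>\<in>space M. X' i \<omega> \<in> B0 i}" if "i \<in> {1..N}" for i
        using A[of "(i, 0)"] that by (auto simp: B0_def)
      have A1: "A (i, Suc l) = {\<omega>\<in>space M. W' i (real (Suc l) * h) \<omega> - W' i (real l * h) \<omega> \<in> B1 i l}"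
        if "i \<in> {1..N}" "l < n" for i l
        using A[of "(i, Suc l)"] that by (auto simp: B1_def simp del: of_nat_Suc)
      have split: "{..n} = insert 0 (Suc ` {..<n})"
        by (simp add: lessThan_Suc_eq_insert_0 flip: lessThan_Suc_atMost)
      have inter: "(\<Inter>p\<in>?I. A p) = (\<Inter>i\<in>{1..N}. ?P i -` (C i \<times> B0 i) \<inter> space M)"
      proof -
        have "(\<Inter>p\<in>?I. A p) = (\<Inter>i\<in>{1..N}. A (i, 0) \<inter> (\<Inter>l\<in>{..<n}. A (i, Suc l)))"
          unfolding split by auto
        also have "\<dots> = (\<Inter>i\<in>{1..N}. ?P i -` (C i \<times> B0 i) \<inter> space M)"
        proof (intro INF_cong refl)
          fix i assume i: "i \<in> {1..N}"
          then show "A (i, 0) \<inter> (\<Inter>l\<in>{..<n}. A (i, Suc l)) = ?P i -` (C i \<times> B0 i) \<inter> space M"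
            using path_C[of i] by (auto simp: A0 A1 simp del: of_nat_Suc)
        qed
        finally show ?thesis .
      qed
      have single: "prob (?P i -` (C i \<times> B0 i) \<inter> space M) = (\<Prod>l\<in>{..n}. prob (A (i, l)))"
        if i: "i \<in> {1..N}" for i
      proof -
        have "?P i -` (C i \<times> B0 i) \<inter> space M = {\<omega>\<in>space M. path T (W' i) \<omega> \<in> C i \<and> X' i \<omega> \<in> B0 i}"
          by auto
        then have "prob (?P i -` (C i \<times> B0 i) \<inter> space M)
          = prob {\<omega>\<in>space M. path T (W' i) \<omega> \<in> C i} * prob {\<omega>\<in>space M. X' i \<omega> \<in> B0 i}"
          using particle_indep[OF path_meas[OF BM] X path_meas[OF BM'[OF i]] X'[OF i] indep law[OF i] C[OF i] B0[OF i]]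
          by simp
        also have "prob {\<omega>\<in>space M. path T (W' i) \<omega> \<in> C i} = (\<Prod>l<n. prob (A (i, Suc l)))"
        proof -
          have mono: "mono_on {..n} (\<lambda>l. real l * h)"
            using h by (intro mono_onI mult_right_mono) auto
          have "(\<lambda>l. real l * h) ` {..n} \<subseteq> {0..T}" using grid by auto
          then have "indep_vars (\<lambda>_. borel) (\<lambda>l \<omega>. W' i (real (Suc l) * h) \<omega> - W' i (real l * h) \<omega>) {..<n}"
            using BM'[OF i] mono unfolding brownian_motion_def by blast
          from indep_varsD_finite[OF this, of "B1 i"]
          have "prob (\<Inter>l<n. (\<lambda>\<omega>. W' i (real (Suc l) * h) \<omega> - W' i (real l * h) \<omega>) -` B1 i l \<inter> space M)
            = (\<Prod>l<n. prob ((\<lambda>\<omega>. W' i (real (Suc l) * h) \<omega> - W' i (real l * h) \<omega>) -` B1 i l \<inter> space M))"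
            using \<open>n \<ge> 1\<close> B1[OF i] by (auto simp: lessThan_empty_iff)
          also have "(\<Inter>l<n. (\<lambda>\<omega>. W' i (real (Suc l) * h) \<omega> - W' i (real l * h) \<omega>) -` B1 i l \<inter> space M)
            = {\<omega>\<in>space M. path T (W' i) \<omega> \<in> C i}"
            unfolding path_C using \<open>n \<ge> 1\<close> by (auto simp: lessThan_empty_iff)
          also have "(\<Prod>l<n. prob ((\<lambda>\<omega>. W' i (real (Suc l) * h) \<omega> - W' i (real l * h) \<omega>) -` B1 i l \<inter> space M))
            = (\<Prod>l<n. prob (A (i, Suc l)))"
            using A1[OF i] by (intro prod.cong refl arg_cong[where f = prob]) auto
          finally show ?thesis .
        qed
        also have "prob {\<omega>\<in>space M. X' i \<omega> \<in> B0 i} = prob (A (i, 0))"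
          using A0[OF i] by simp
        also have "(\<Prod>l<n. prob (A (i, Suc l))) * prob (A (i, 0)) = (\<Prod>l\<in>{..n}. prob (A (i, l)))"
          unfolding split by (simp add: prod.reindex mult.commute)
        finally show ?thesis .
      qed
      have "prob (\<Inter>p\<in>?I. A p) = (\<Prod>i\<in>{1..N}. prob (?P i -` (C i \<times> B0 i) \<inter> space M))"
        unfolding inter using \<open>N \<ge> 1\<close> C B0 by (intro indep_varsD_finite[OF joint]) auto
      also have "\<dots> = (\<Prod>i\<in>{1..N}. \<Prod>l\<in>{..n}. prob (A (i, l)))"
        by (intro prod.cong refl single)
      also have "\<dots> = (\<Prod>p\<in>?I. prob (A p))"
        by (simp add: prod.cartesian_product)
      finally show "prob (\<Inter>p\<in>?I. A p) = (\<Prod>p\<in>?I. prob (A p))" .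
    qed
  qed simp
  then show ?thesis
    using rv unfolding indep_vars_def2 h_def by auto
qed

section \<open>One step of the whole system\<close>

lemma sum_inner_Cauchy_Schwarz:
  fixes x y :: "'i \<Rightarrow> 'a::real_inner"
  shows "\<bar>\<Sum>i\<in>I. x i \<bullet> y i\<bar> \<le> sqrt (\<Sum>i\<in>I. (norm (x i))\<^sup>2) * sqrt (\<Sum>i\<in>I. (norm (y i))\<^sup>2)"
proof -
  have "\<bar>\<Sum>i\<in>I. x i \<bullet> y i\<bar> \<le> (\<Sum>i\<in>I. \<bar>norm (x i)\<bar> * \<bar>norm (y i)\<bar>)"
    by (intro order.trans[OF sum_abs] sum_mono) (simp add: Cauchy_Schwarz_ineq2)
  also have "\<dots> \<le> L2_set (\<lambda>i. norm (x i)) I * L2_set (\<lambda>i. norm (y i)) I"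
    by (rule L2_set_mult_ineq)
  finally show ?thesis by (simp add: L2_set_def)
qed

lemma weighted_sum_norm_le:
  fixes s :: "'r \<Rightarrow> 'a::real_inner"
  assumes "finite R"
  shows "(norm (\<Sum>r\<in>R. D r *\<^sub>R s r))\<^sup>2 \<le> (\<Sum>r\<in>R. (norm (s r))\<^sup>2) * (\<Sum>r\<in>R. \<bar>D r\<bar>)\<^sup>2"
proof -
  have "norm (s r) \<le> L2_set (\<lambda>r. norm (s r)) R" if "r \<in> R" for r
    using assms that by (rule member_le_L2_set)
  then have "norm (\<Sum>r\<in>R. D r *\<^sub>R s r) \<le> (\<Sum>r\<in>R. \<bar>D r\<bar> * L2_set (\<lambda>r. norm (s r)) R)"
    by (intro order.trans[OF norm_sum] sum_mono) (auto intro!: mult_left_mono)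
  also have "\<dots> = (\<Sum>r\<in>R. \<bar>D r\<bar>) * L2_set (\<lambda>r. norm (s r)) R"
    by (simp add: sum_distrib_right)
  finally have "(norm (\<Sum>r\<in>R. D r *\<^sub>R s r))\<^sup>2 \<le> ((\<Sum>r\<in>R. \<bar>D r\<bar>) * L2_set (\<lambda>r. norm (s r)) R)\<^sup>2"
    by (intro power_mono) auto
  also have "\<dots> = (\<Sum>r\<in>R. (norm (s r))\<^sup>2) * (\<Sum>r\<in>R. \<bar>D r\<bar>)\<^sup>2"
    by (simp add: L2_set_def power_mult_distrib sum_nonneg)
  finally show ?thesis .
qed

text \<open>Division by \<open>A\<close> reduces the claim to
  \<open>powr_expansion_normalized\<close>, with \<open>\<kappa> = h powr (1 / 3)\<close> so that
  the remainder \<open>\<kappa> ^ 3\<close> equals \<open>h\<close>. Cauchy-Schwarz is applied to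
  sums over all particles, with \<open>sqrt A\<close> bounding the norm of the whole state; hence
  only the summed squares of the coefficients have to be small.\<close>

lemma powr_step_bound:
  fixes p c :: real
  assumes "p \<ge> 1" "c \<ge> 0"
  obtains C :: real and m :: nat where "C \<ge> 0"
    "\<And>I (x :: 'i \<Rightarrow> 'a::real_inner) B (s :: 'i \<times> 'r::finite \<Rightarrow> 'a) D h A P Q Y.
      \<lbrakk>finite I; 0 < h; h < 1; A = 1 + (\<Sum>i\<in>I. (norm (x i))\<^sup>2);
        h\<^sup>2 * (\<Sum>i\<in>I. (norm (B i))\<^sup>2) \<le> c\<^sup>2 * (h powr (1 / 3)) ^ 4 * A;
        h * (\<Sum>j\<in>I \<times> UNIV. (norm (s j))\<^sup>2) \<le> c\<^sup>2 * (h powr (1 / 3))\<^sup>2 * A;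
        P = (\<Sum>i\<in>I. x i \<bullet> (h *\<^sub>R B i));
        Q = (\<Sum>i\<in>I. x i \<bullet> (\<Sum>r\<in>UNIV. D (i, r) *\<^sub>R s (i, r)));
        Y = (\<Sum>i\<in>I. (norm (\<Sum>r\<in>UNIV. D (i, r) *\<^sub>R s (i, r)))\<^sup>2)\<rbrakk> \<Longrightarrow>
      (1 + (\<Sum>i\<in>I. (norm (x i + h *\<^sub>R B i + (\<Sum>r\<in>UNIV. D (i, r) *\<^sub>R s (i, r))))\<^sup>2)) powr p
        \<le> A powr p * (1 + p * (2 * P + 2 * Q + Y) / A + 2 * p * (p - 1) * Q\<^sup>2 / A\<^sup>2
            + C * h * (1 + (\<Sum>j\<in>I \<times> UNIV. \<bar>D j\<bar> / sqrt h)) ^ m)"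
proof -
  obtain C :: real and m :: nat where "C \<ge> 0" and expand:
    "\<And>\<kappa> \<zeta> P Q U V Y. \<lbrakk>0 < \<kappa>; \<kappa> \<le> 1; \<zeta> \<ge> 0; \<bar>P\<bar> \<le> c * \<kappa>\<^sup>2; \<bar>Q\<bar> \<le> c * \<kappa> * \<zeta>;
        0 \<le> U; U \<le> c\<^sup>2 * \<kappa> ^ 4; \<bar>V\<bar> \<le> c\<^sup>2 * \<kappa> ^ 3 * \<zeta>; 0 \<le> Y; Y \<le> c\<^sup>2 * \<kappa>\<^sup>2 * \<zeta>\<^sup>2;
        0 \<le> 1 + 2 * P + 2 * Q + U + 2 * V + Y\<rbrakk> \<Longrightarrow>
      (1 + 2 * P + 2 * Q + U + 2 * V + Y) powr p
        \<le> 1 + p * (2 * P + 2 * Q + Y) + 2 * p * (p - 1) * Q\<^sup>2 + C * \<kappa> ^ 3 * (1 + \<zeta>) ^ m"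
    using powr_expansion_normalized[OF assms] by blast
  show ?thesis
  proof (rule that[OF \<open>C \<ge> 0\<close>, of m])
    fix I and x B :: "'i \<Rightarrow> 'a" and s :: "'i \<times> 'r \<Rightarrow> 'a" and D h A P Q Y
    assume I: "finite I" and h: "0 < h" "h < 1" and A: "A = 1 + (\<Sum>i\<in>I. (norm (x i))\<^sup>2)"
      and B: "h\<^sup>2 * (\<Sum>i\<in>I. (norm (B i))\<^sup>2) \<le> c\<^sup>2 * (h powr (1 / 3)) ^ 4 * A"
      and s: "h * (\<Sum>j\<in>I \<times> UNIV. (norm (s j))\<^sup>2) \<le> c\<^sup>2 * (h powr (1 / 3))\<^sup>2 * A"
      and P: "P = (\<Sum>i\<in>I. x i \<bullet> (h *\<^sub>R B i))"
      and Q: "Q = (\<Sum>i\<in>I. x i \<bullet> (\<Sum>r\<in>UNIV. D (i, r) *\<^sub>R s (i, r)))"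
      and Y: "Y = (\<Sum>i\<in>I. (norm (\<Sum>r\<in>UNIV. D (i, r) *\<^sub>R s (i, r)))\<^sup>2)"
    define \<kappa> where "\<kappa> = h powr (1 / 3)"
    define \<zeta> where "\<zeta> = (\<Sum>j\<in>I \<times> UNIV. \<bar>D j\<bar> / sqrt h)"
    define \<xi> where "\<xi> i = (\<Sum>r\<in>UNIV. D (i, r) *\<^sub>R s (i, r))" for i
    define U where "U = (\<Sum>i\<in>I. (norm (h *\<^sub>R B i))\<^sup>2)"
    define V where "V = (\<Sum>i\<in>I. (h *\<^sub>R B i) \<bullet> \<xi> i)"
    have "A \<ge> 1" using A by (simp add: sum_nonneg)
    have \<kappa>: "0 < \<kappa>" "\<kappa> \<le> 1" "\<kappa> ^ 3 = h"
    proof -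
      show "0 < \<kappa>" "\<kappa> \<le> 1" using h powr_mono2[of "1 / 3" h 1] by (auto simp: \<kappa>_def)
      have "\<kappa> ^ 3 = \<kappa> powr 3" using \<open>0 < \<kappa>\<close> by (simp add: powr_numeral)
      then show "\<kappa> ^ 3 = h" using h by (simp add: \<kappa>_def powr_powr)
    qed
    have "\<zeta> \<ge> 0" unfolding \<zeta>_def using h by (intro sum_nonneg) auto
    have "U = h\<^sup>2 * (\<Sum>i\<in>I. (norm (B i))\<^sup>2)"
      unfolding U_def using h by (simp add: power_mult_distrib sum_distrib_left)
    then have U: "0 \<le> U" "U \<le> c\<^sup>2 * \<kappa> ^ 4 * A"
      using B by (auto simp: \<kappa>_def sum_nonneg)
    have Y0: "0 \<le> Y" unfolding Y by (simp add: sum_nonneg)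
    have "Y \<le> (\<Sum>i\<in>I. (\<Sum>r\<in>UNIV. (norm (s (i, r)))\<^sup>2) * (\<Sum>j\<in>I \<times> UNIV. \<bar>D j\<bar>)\<^sup>2)"
      unfolding Y
    proof (intro sum_mono)
      fix i assume i: "i \<in> I"
      have "(\<Sum>r\<in>UNIV. \<bar>D (i, r)\<bar>) = (\<Sum>j\<in>{i} \<times> UNIV. \<bar>D j\<bar>)"
        by (rule sum.reindex_bij_witness[of _ snd "Pair i"]) auto
      also have "\<dots> \<le> (\<Sum>j\<in>I \<times> UNIV. \<bar>D j\<bar>)"
        using i I by (intro sum_mono2) auto
      finally have "(\<Sum>r\<in>UNIV. \<bar>D (i, r)\<bar>)\<^sup>2 \<le> (\<Sum>j\<in>I \<times> UNIV. \<bar>D j\<bar>)\<^sup>2"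
        by (intro power_mono) (auto intro: sum_nonneg)
      then have "(\<Sum>r\<in>UNIV. (norm (s (i, r)))\<^sup>2) * (\<Sum>r\<in>UNIV. \<bar>D (i, r)\<bar>)\<^sup>2
        \<le> (\<Sum>r\<in>UNIV. (norm (s (i, r)))\<^sup>2) * (\<Sum>j\<in>I \<times> UNIV. \<bar>D j\<bar>)\<^sup>2"
        by (intro mult_left_mono) (auto intro: sum_nonneg)
      then show "(norm (\<Sum>r\<in>UNIV. D (i, r) *\<^sub>R s (i, r)))\<^sup>2
        \<le> (\<Sum>r\<in>UNIV. (norm (s (i, r)))\<^sup>2) * (\<Sum>j\<in>I \<times> UNIV. \<bar>D j\<bar>)\<^sup>2"
        using weighted_sum_norm_le[of UNIV "\<lambda>r. D (i, r)" "\<lambda>r. s (i, r)"] by simp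
    qed
    also have "\<dots> = h * (\<Sum>j\<in>I \<times> UNIV. (norm (s j))\<^sup>2) * \<zeta>\<^sup>2"
      using h unfolding \<zeta>_def
      by (simp add: sum.cartesian_product sum_distrib_right[symmetric] sum_divide_distrib[symmetric] power_divide)
    also have "\<dots> \<le> c\<^sup>2 * \<kappa>\<^sup>2 * A * \<zeta>\<^sup>2"
      using s by (intro mult_right_mono) (auto simp: \<kappa>_def)
    finally have Y1: "Y \<le> c\<^sup>2 * \<kappa>\<^sup>2 * \<zeta>\<^sup>2 * A" by (simp add: mult_ac)
    have xA: "sqrt (\<Sum>i\<in>I. (norm (x i))\<^sup>2) \<le> sqrt A" using A by simp
    have "sqrt (\<kappa> ^ 4) = \<kappa>\<^sup>2"
      by (intro real_sqrt_unique) (simp_all flip: power_mult)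
    then have sqU: "sqrt U \<le> c * \<kappa>\<^sup>2 * sqrt A"
      using real_sqrt_le_mono[OF U(2)] \<kappa> assms by (simp add: real_sqrt_mult)
    have sqY: "sqrt Y \<le> c * \<kappa> * \<zeta> * sqrt A"
      using real_sqrt_le_mono[OF Y1] \<kappa> assms \<open>\<zeta> \<ge> 0\<close>
      by (simp add: real_sqrt_mult)
    have AA: "sqrt A * sqrt A = A" using \<open>A \<ge> 1\<close> by simp
    have "\<bar>P\<bar> \<le> sqrt A * (c * \<kappa>\<^sup>2 * sqrt A)"
      unfolding P
      by (intro order.trans[OF sum_inner_Cauchy_Schwarz] mult_mono xA sqU[unfolded U_def])
        (auto intro: sum_nonneg simp: \<open>A \<ge> 1\<close>[THEN order.trans[OF zero_le_one]])
    then have "\<bar>P\<bar> \<le> c * \<kappa>\<^sup>2 * (sqrt A * sqrt A)" by (simp only: mult_ac)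
    then have P1: "\<bar>P\<bar> \<le> c * \<kappa>\<^sup>2 * A" unfolding AA .
    have "\<bar>Q\<bar> \<le> sqrt A * (c * \<kappa> * \<zeta> * sqrt A)"
      unfolding Q
      by (intro order.trans[OF sum_inner_Cauchy_Schwarz] mult_mono xA sqY[unfolded Y])
        (auto intro: sum_nonneg simp: \<open>A \<ge> 1\<close>[THEN order.trans[OF zero_le_one]])
    then have "\<bar>Q\<bar> \<le> c * \<kappa> * \<zeta> * (sqrt A * sqrt A)" by (simp only: mult_ac)
    then have Q1: "\<bar>Q\<bar> \<le> c * \<kappa> * \<zeta> * A" unfolding AA .
    have "\<bar>V\<bar> \<le> (c * \<kappa>\<^sup>2 * sqrt A) * (c * \<kappa> * \<zeta> * sqrt A)"
      unfolding V_def \<xi>_def using assms \<kappa> \<open>A \<ge> 1\<close>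
      by (intro order.trans[OF sum_inner_Cauchy_Schwarz] mult_mono sqU[unfolded U_def] sqY[unfolded Y])
        (auto intro: sum_nonneg)
    also have "\<dots> = c\<^sup>2 * \<kappa> ^ 3 * \<zeta> * (sqrt A * sqrt A)"
      by (simp add: power2_eq_square power3_eq_cube mult_ac)
    finally have V1: "\<bar>V\<bar> \<le> c\<^sup>2 * \<kappa> ^ 3 * \<zeta> * A" unfolding AA .
    have total: "1 + (\<Sum>i\<in>I. (norm (x i + h *\<^sub>R B i + \<xi> i))\<^sup>2) = A + 2 * P + 2 * Q + U + 2 * V + Y"
    proof -
      have "(norm (x i + h *\<^sub>R B i + \<xi> i))\<^sup>2 = (norm (x i))\<^sup>2 + 2 * (x i \<bullet> (h *\<^sub>R B i)) + 2 * (x i \<bullet> \<xi> i)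
          + (norm (h *\<^sub>R B i))\<^sup>2 + 2 * ((h *\<^sub>R B i) \<bullet> \<xi> i) + (norm (\<xi> i))\<^sup>2" for i
        by (simp add: dot_square_norm[symmetric] inner_add_left inner_add_right inner_commute
              power2_eq_square[of h] algebra_simps)
      then show ?thesis
        unfolding A P Q U_def V_def Y \<xi>_def[symmetric]
        by (simp add: sum.distrib sum_distrib_left)
    qed
    have pos: "0 \<le> A + 2 * P + 2 * Q + U + 2 * V + Y"
      unfolding total[symmetric] by (intro add_nonneg_nonneg sum_nonneg) auto
    have scale: "1 + 2 * (P / A) + 2 * (Q / A) + U / A + 2 * (V / A) + Y / A
        = (A + 2 * P + 2 * Q + U + 2 * V + Y) / A"
      using \<open>A \<ge> 1\<close> by (simp add: field_simps)
    have "(1 + 2 * (P / A) + 2 * (Q / A) + U / A + 2 * (V / A) + Y / A) powr p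
        \<le> 1 + p * (2 * (P / A) + 2 * (Q / A) + Y / A) + 2 * p * (p - 1) * (Q / A)\<^sup>2 + C * \<kappa> ^ 3 * (1 + \<zeta>) ^ m"
    proof (rule expand)
      show "0 \<le> 1 + 2 * (P / A) + 2 * (Q / A) + U / A + 2 * (V / A) + Y / A"
        unfolding scale using pos \<open>A \<ge> 1\<close> by simp
    qed (use \<kappa> \<open>\<zeta> \<ge> 0\<close> P1 Q1 V1 U Y0 Y1 \<open>A \<ge> 1\<close> in \<open>auto simp: divide_le_eq\<close>)
    also have "1 + p * (2 * (P / A) + 2 * (Q / A) + Y / A) + 2 * p * (p - 1) * (Q / A)\<^sup>2 + C * \<kappa> ^ 3 * (1 + \<zeta>) ^ m
      = 1 + p * (2 * P + 2 * Q + Y) / A + 2 * p * (p - 1) * Q\<^sup>2 / A\<^sup>2 + C * h * (1 + \<zeta>) ^ m"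
      using \<kappa>(3) by (simp add: power_divide add_divide_distrib ring_distribs)
    finally have main: "((A + 2 * P + 2 * Q + U + 2 * V + Y) / A) powr p
      \<le> 1 + p * (2 * P + 2 * Q + Y) / A + 2 * p * (p - 1) * Q\<^sup>2 / A\<^sup>2 + C * h * (1 + \<zeta>) ^ m"
      unfolding scale .
    have "(A + 2 * P + 2 * Q + U + 2 * V + Y) powr p
      = A powr p * ((A + 2 * P + 2 * Q + U + 2 * V + Y) / A) powr p"
      using pos \<open>A \<ge> 1\<close> by (simp add: powr_divide)
    also have "\<dots> \<le> A powr p * (1 + p * (2 * P + 2 * Q + Y) / A + 2 * p * (p - 1) * Q\<^sup>2 / A\<^sup>2
            + C * h * (1 + \<zeta>) ^ m)"
      by (intro mult_left_mono main) simp
    finally show "(1 + (\<Sum>i\<in>I. (norm (x i + h *\<^sub>R B i + (\<Sum>r\<in>UNIV. D (i, r) *\<^sub>R s (i, r))))\<^sup>2)) powr p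
        \<le> A powr p * (1 + p * (2 * P + 2 * Q + Y) / A + 2 * p * (p - 1) * Q\<^sup>2 / A\<^sup>2
            + C * h * (1 + (\<Sum>j\<in>I \<times> UNIV. \<bar>D j\<bar> / sqrt h)) ^ m)"
      using total unfolding \<xi>_def \<zeta>_def by simp
  qed
qed

section \<open>Growth of the coefficients\<close>

text \<open>The drift is compared with its value at the origin and the Dirac measure there, and that
  value is bounded in time by Hoelder continuity. The growth of \<open>\<sigma>\<close> is recovered
  from coercivity by moving the inner product with \<open>b\<close> to the other side:
  \<open>A powr (1 / 2)\<close> times the growth of \<open>b\<close> gives the exponent
  \<open>\<rho> + 1\<close>.\<close>

lemma coefficient_growth:
  fixes b :: "real \<Rightarrow> real ^ 'd::finite \<Rightarrow> (real ^ 'd) measure \<Rightarrow> real ^ 'd"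
    and \<sigma> :: "real \<Rightarrow> real ^ 'd \<Rightarrow> (real ^ 'd) measure \<Rightarrow> real ^ 'm::finite ^ 'd"
  assumes "T > 0" "p0 > 1" "\<rho> > 0" "N \<ge> 1"
    and A2: "coercivity T p0 b \<sigma>" and A6: "drift_poly_lipschitz T \<rho> b" and A7: "time_hoelder T b \<sigma>"
  obtains K :: real where "K \<ge> 1"
    "\<And>t x i A. \<lbrakk>t \<in> {0..T}; i \<in> {1..N}; A = 1 + (\<Sum>j=1..N. (norm (x j))\<^sup>2)\<rbrakk> \<Longrightarrow>
      norm (b t (x i) (empirical N x)) \<le> K * A powr (\<rho> + 1 / 2) \<and>
      (norm (\<sigma> t (x i) (empirical N x)))\<^sup>2 \<le> K * A powr (\<rho> + 1) \<and>
      2 * (x i \<bullet> b t (x i) (empirical N x)) + (2 * p0 - 1) * (norm (\<sigma> t (x i) (empirical N x)))\<^sup>2 \<le> K * A"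
proof -
  define \<delta> where "\<delta> = (return borel 0 :: (real ^ 'd) measure)"
  obtain L2 where L2: "L2 > 0" "\<And>t x \<mu>. t \<in> {0..T} \<Longrightarrow> \<mu> \<in> P2 \<Longrightarrow>
     2 * (x \<bullet> b t x \<mu>) + (2 * p0 - 1) * (norm (\<sigma> t x \<mu>))\<^sup>2 \<le> L2 * (1 + (norm x)\<^sup>2 + (W2 \<mu> \<delta>)\<^sup>2)"
    using A2 unfolding coercivity_def \<delta>_def by blast
  obtain L6 where L6: "L6 > 0" "\<And>t x y \<mu> \<nu>. t \<in> {0..T} \<Longrightarrow> \<mu> \<in> P2 \<Longrightarrow> \<nu> \<in> P2 \<Longrightarrow>
     norm (b t x \<mu> - b t y \<nu>) \<le> L6 * (1 + norm x powr (2 * \<rho>) + norm y powr (2 * \<rho>)) * norm (x - y) + L6 * W2 \<mu> \<nu>"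
    using A6 unfolding drift_poly_lipschitz_def by blast
  obtain L7 where L7: "L7 > 0" "\<And>t s x \<mu>. t \<in> {0..T} \<Longrightarrow> s \<in> {0..T} \<Longrightarrow> \<mu> \<in> P2 \<Longrightarrow>
     norm (b t x \<mu> - b s x \<mu>) + norm (\<sigma> t x \<mu> - \<sigma> s x \<mu>) \<le> L7 * \<bar>t - s\<bar> powr (1 / 2)"
    using A7 unfolding time_hoelder_def by blast
  have \<delta>: "\<delta> \<in> P2" unfolding \<delta>_def by (rule return_zero_in_P2)
  define K0 where "K0 = norm (b 0 0 \<delta>) + L7 * T powr (1 / 2)"
  define Kb where "Kb = 3 * L6 + K0"
  define K where "K = 1 + Kb + (2 * L2 + 2 * Kb) + 2 * L2"
  have "K0 \<ge> 0" "Kb \<ge> 0" using L6(1) L7(1) by (auto simp: K0_def Kb_def)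
  then have "K \<ge> 1" using L2(1) by (simp add: K_def)
  show ?thesis
  proof (rule that[OF \<open>K \<ge> 1\<close>])
    fix t :: real and x :: "nat \<Rightarrow> real ^ 'd" and i A
    assume t: "t \<in> {0..T}" and i: "i \<in> {1..N}" and A: "A = 1 + (\<Sum>j=1..N. (norm (x j))\<^sup>2)"
    define \<mu> where "\<mu> = empirical N x"
    have \<mu>: "\<mu> \<in> P2" unfolding \<mu>_def using assms(4) by (rule empirical_in_P2)
    have A1: "A \<ge> 1" unfolding A by (simp add: sum_nonneg)
    have xi: "(norm (x i))\<^sup>2 \<le> A"
      using member_le_sum[of i "{1..N}" "\<lambda>j. (norm (x j))\<^sup>2"] i unfolding A by auto
    have sqA: "sqrt A = A powr (1 / 2)" using A1 by (simp add: powr_half_sqrt)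
    have xi': "norm (x i) \<le> A powr (1 / 2)"
      using real_sqrt_le_mono[OF xi] sqA by simp
    have W: "W2 \<mu> \<delta> \<le> sqrt A"
    proof -
      have "W2 \<mu> \<delta> \<le> sqrt ((\<Sum>j=1..N. (norm (x j))\<^sup>2) / N)"
        using W2_empirical_le[OF assms(4), of x "\<lambda>_. 0"] empirical_zero[OF assms(4), where 'a = "real ^ 'd"]
        by (simp add: \<mu>_def \<delta>_def)
      also have "(\<Sum>j=1..N. (norm (x j))\<^sup>2) / N \<le> (\<Sum>j=1..N. (norm (x j))\<^sup>2) / 1"
        using assms(4) by (intro divide_left_mono) (auto intro: sum_nonneg)
      also have "\<dots> \<le> A" unfolding A by simp
      finally show ?thesis by simp
    qed
    \<comment> \<open>The sign is needed for squaring the bound \<open>W\<close>. An infimum over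
      the empty set would be uninformative, so a coupling is exhibited: the image of
      \<open>\<mu>\<close> under \<open>x \<mapsto> (x, 0)\<close>.\<close>
    have W0: "0 \<le> W2 \<mu> \<delta>"
      unfolding W2_def
    proof (intro real_sqrt_ge_zero cINF_greatest)
      let ?\<pi> = "distr \<mu> (borel \<Otimes>\<^sub>M borel) (\<lambda>x. (x, 0 :: real ^ 'd))"
      have sets: "sets \<mu> = sets borel" and prob: "prob_space \<mu>" using \<mu> by (auto simp: P2_def)
      then have m [measurable]: "(\<lambda>x. (x, 0 :: real ^ 'd)) \<in> measurable \<mu> (borel \<Otimes>\<^sub>M borel)"
        by (simp add: measurable_cong_sets[OF sets refl])
      have "distr \<mu> borel (\<lambda>_. 0 :: real ^ 'd) = \<delta>"
        unfolding \<delta>_def by (rule prob_space.distr_const[OF prob]) simp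
      then have "?\<pi> \<in> couplings \<mu> \<delta>"
        unfolding couplings_def using prob sets m
        by (auto intro!: prob_space.prob_space_distr distr_id2 simp: distr_distr comp_def)
      then show "couplings \<mu> \<delta> \<noteq> {}" by blast
    qed simp
    have W': "(W2 \<mu> \<delta>)\<^sup>2 \<le> A"
      using power_mono[OF W W0, of 2] A1 by simp
    have one_xi: "1 + (norm (x i))\<^sup>2 \<le> A"
      using member_le_sum[of i "{1..N}" "\<lambda>j. (norm (x j))\<^sup>2"] i unfolding A by auto
    have coerc: "2 * (x i \<bullet> b t (x i) \<mu>) + (2 * p0 - 1) * (norm (\<sigma> t (x i) \<mu>))\<^sup>2 \<le> 2 * L2 * A"
    proof -
      have "L2 * (1 + (norm (x i))\<^sup>2 + (W2 \<mu> \<delta>)\<^sup>2) \<le> L2 * (A + A)"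
        using L2(1) one_xi W' by (intro mult_left_mono add_mono) auto
      then show ?thesis using L2(2)[OF t \<mu>, of "x i"] by simp
    qed
    have b: "norm (b t (x i) \<mu>) \<le> Kb * A powr (\<rho> + 1 / 2)"
    proof -
      have "norm (b t (x i) \<mu>) \<le> norm (b t (x i) \<mu> - b t 0 \<delta>) + norm (b t 0 \<delta> - b 0 0 \<delta>) + norm (b 0 0 \<delta>)"
        using norm_triangle_ineq[of "b t (x i) \<mu> - b t 0 \<delta>" "b t 0 \<delta>"]
          norm_triangle_ineq[of "b t 0 \<delta> - b 0 0 \<delta>" "b 0 0 \<delta>"] by simp
      also have "norm (b t (x i) \<mu> - b t 0 \<delta>) \<le> L6 * (1 + norm (x i) powr (2 * \<rho>)) * norm (x i) + L6 * W2 \<mu> \<delta>"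
        using L6(2)[OF t \<mu> \<delta>, of "x i" 0] by simp
      also have "\<dots> \<le> L6 * (A powr \<rho> + A powr \<rho>) * A powr (1 / 2) + L6 * A powr (\<rho> + 1 / 2)"
      proof (intro add_mono mult_mono mult_left_mono)
        show "norm (x i) powr (2 * \<rho>) \<le> A powr \<rho>"
          using powr_mono2[OF _ _ xi', of "2 * \<rho>"] assms(3) A1 by (simp add: powr_powr)
        show "1 \<le> A powr \<rho>" using A1 assms(3) by (simp add: ge_one_powr_ge_zero)
        show "W2 \<mu> \<delta> \<le> A powr (\<rho> + 1 / 2)"
          using W sqA A1 assms(3) powr_mono[of "1 / 2" "\<rho> + 1 / 2" A] by simp
      qed (use L6(1) xi' W0 in auto)
      also have "\<dots> = 3 * L6 * A powr (\<rho> + 1 / 2)"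
        by (simp add: powr_add algebra_simps)
      also have "norm (b t 0 \<delta> - b 0 0 \<delta>) \<le> L7 * T powr (1 / 2)"
      proof -
        have "norm (b t 0 \<delta> - b 0 0 \<delta>) \<le> L7 * \<bar>t - 0\<bar> powr (1 / 2)"
          using L7(2)[OF t _ \<delta>, of 0 0] t by (simp add: add_increasing2 order.trans[rotated])
        also have "\<dots> \<le> L7 * T powr (1 / 2)"
          using t L7(1) by (intro mult_left_mono powr_mono2) auto
        finally show ?thesis .
      qed
      finally have "norm (b t (x i) \<mu>) \<le> 3 * L6 * A powr (\<rho> + 1 / 2) + K0 * 1"
        unfolding K0_def by simp
      also have "\<dots> \<le> 3 * L6 * A powr (\<rho> + 1 / 2) + K0 * A powr (\<rho> + 1 / 2)"
        using \<open>K0 \<ge> 0\<close> A1 assms(3) by (intro add_left_mono mult_left_mono ge_one_powr_ge_zero) auto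
      finally show ?thesis by (simp add: Kb_def algebra_simps)
    qed
    have A_le: "A \<le> A powr (\<rho> + 1)"
      using powr_mono[of 1 "\<rho> + 1" A] A1 assms(3) by simp
    have s: "(norm (\<sigma> t (x i) \<mu>))\<^sup>2 \<le> (2 * L2 + 2 * Kb) * A powr (\<rho> + 1)"
    proof -
      have "1 * (norm (\<sigma> t (x i) \<mu>))\<^sup>2 \<le> (2 * p0 - 1) * (norm (\<sigma> t (x i) \<mu>))\<^sup>2"
        using assms(2) by (intro mult_right_mono) auto
      also have "\<dots> \<le> 2 * L2 * A - 2 * (x i \<bullet> b t (x i) \<mu>)"
        using coerc by simp
      also have "2 * L2 * A - 2 * (x i \<bullet> b t (x i) \<mu>) \<le> 2 * L2 * A + 2 * (norm (x i) * norm (b t (x i) \<mu>))"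
        using Cauchy_Schwarz_ineq2[of "x i" "b t (x i) \<mu>"] by linarith
      also have "\<dots> \<le> 2 * L2 * A powr (\<rho> + 1) + 2 * (A powr (1 / 2) * (Kb * A powr (\<rho> + 1 / 2)))"
        using L2(1) A_le xi' b by (intro add_mono mult_mono mult_left_mono) auto
      also have "A powr (1 / 2) * (Kb * A powr (\<rho> + 1 / 2)) = Kb * A powr (1 / 2 + (\<rho> + 1 / 2))"
        by (simp only: powr_add mult_ac)
      also have "1 / 2 + (\<rho> + 1 / 2) = \<rho> + 1"
        by simp
      finally show ?thesis by (simp add: algebra_simps)
    qed
    show "norm (b t (x i) (empirical N x)) \<le> K * A powr (\<rho> + 1 / 2) \<and>
      (norm (\<sigma> t (x i) (empirical N x)))\<^sup>2 \<le> K * A powr (\<rho> + 1) \<and>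
      2 * (x i \<bullet> b t (x i) (empirical N x)) + (2 * p0 - 1) * (norm (\<sigma> t (x i) (empirical N x)))\<^sup>2 \<le> K * A"
    proof (intro conjI)
      have "Kb * A powr (\<rho> + 1 / 2) \<le> K * A powr (\<rho> + 1 / 2)"
        using L2(1) \<open>Kb \<ge> 0\<close> by (intro mult_right_mono) (auto simp: K_def)
      then show "norm (b t (x i) (empirical N x)) \<le> K * A powr (\<rho> + 1 / 2)"
        using b by (simp add: \<mu>_def)
      have "(2 * L2 + 2 * Kb) * A powr (\<rho> + 1) \<le> K * A powr (\<rho> + 1)"
        using L2(1) \<open>Kb \<ge> 0\<close> by (intro mult_right_mono) (auto simp: K_def)
      then show "(norm (\<sigma> t (x i) (empirical N x)))\<^sup>2 \<le> K * A powr (\<rho> + 1)"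
        using s by (simp add: \<mu>_def)
      have "2 * L2 * A \<le> K * A"
        using L2(1) \<open>Kb \<ge> 0\<close> A1 by (intro mult_right_mono) (auto simp: K_def)
      then show "2 * (x i \<bullet> b t (x i) (empirical N x)) + (2 * p0 - 1) * (norm (\<sigma> t (x i) (empirical N x)))\<^sup>2 \<le> K * A"
        using coerc by (simp add: \<mu>_def)
    qed
  qed
qed

lemma sum_norm_column_squared:
  fixes A :: "real ^ 'm::finite ^ 'd::finite"
  shows "(\<Sum>r\<in>UNIV. (norm (column r A))\<^sup>2) = (norm A)\<^sup>2"
proof -
  have "(\<Sum>r\<in>UNIV. (norm (column r A))\<^sup>2) = (\<Sum>r\<in>UNIV. \<Sum>i\<in>UNIV. (A $ i $ r)\<^sup>2)"
    by (simp add: column_def norm_vec_def L2_set_def sum_nonneg)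
  also have "\<dots> = (\<Sum>i\<in>UNIV. \<Sum>r\<in>UNIV. (A $ i $ r)\<^sup>2)"
    by (rule sum.swap)
  also have "\<dots> = (norm A)\<^sup>2"
    by (simp add: norm_matrix_frobenius sum_nonneg)
  finally show ?thesis .
qed

text \<open>The bound on \<open>A\<close> makes \<open>A powr \<rho>\<close> at most
  \<open>h powr (- 1 / 3)\<close>, which gives both size estimates. Coercivity survives because
  \<open>T2\<close> does not enlarge the columns of \<open>\<sigma>\<close>, while the drift changes
  only by the consistency error, and the bound on \<open>A\<close> keeps the inner product of that
  error with the state below a multiple of \<open>A\<close>.\<close>

lemma tamed_coefficient_bounds:
  fixes b :: "real \<Rightarrow> real ^ 'd::finite \<Rightarrow> (real ^ 'd) measure \<Rightarrow> real ^ 'd"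
    and \<sigma> :: "real \<Rightarrow> real ^ 'd \<Rightarrow> (real ^ 'd) measure \<Rightarrow> real ^ 'm::finite ^ 'd"
  assumes "T > 0" "p0 > 1" "\<rho> > 0" "N \<ge> 1" "r1 > 0" "r2 > 0" "1 \<le> p" "p \<le> p0"
    and A2: "coercivity T p0 b \<sigma>" and A6: "drift_poly_lipschitz T \<rho> b" and A7: "time_hoelder T b \<sigma>"
    and H1: "taming_bounds T1 T2" and H2: "taming_consistent r1 r2 T1"
    and G: "6 * \<rho> \<le> G" "((2 * \<rho> + 1) * r2 - 1) / r1 \<le> G"
  obtains c K :: real where "c \<ge> 0" "K \<ge> 0"
    "\<And>h t x A B s. \<lbrakk>0 < h; h < 1; t \<in> {0..T}; A = 1 + (\<Sum>i=1..N. (norm (x i))\<^sup>2); A \<le> h powr (- 2 / G);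
       B = (\<lambda>i. T1 (b t (x i) (empirical N x)) h);
       s = (\<lambda>(i, r). T2 (column r (\<sigma> t (x i) (empirical N x))) h)\<rbrakk> \<Longrightarrow>
      h\<^sup>2 * (\<Sum>i=1..N. (norm (B i))\<^sup>2) \<le> c\<^sup>2 * (h powr (1 / 3)) ^ 4 * A \<and>
      h * (\<Sum>j\<in>{1..N} \<times> UNIV. (norm (s j))\<^sup>2) \<le> c\<^sup>2 * (h powr (1 / 3))\<^sup>2 * A \<and>
      2 * (\<Sum>i=1..N. x i \<bullet> B i) + (2 * p - 1) * (\<Sum>j\<in>{1..N} \<times> UNIV. (norm (s j))\<^sup>2) \<le> K * A"
proof -
  obtain K0 where K0: "K0 \<ge> 1" and growth:
    "\<And>t x i A. \<lbrakk>t \<in> {0..T}; i \<in> {1..N}; A = 1 + (\<Sum>j=1..N. (norm (x j))\<^sup>2)\<rbrakk> \<Longrightarrow>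
      norm (b t (x i) (empirical N x)) \<le> K0 * A powr (\<rho> + 1 / 2) \<and>
      (norm (\<sigma> t (x i) (empirical N x)))\<^sup>2 \<le> K0 * A powr (\<rho> + 1) \<and>
      2 * (x i \<bullet> b t (x i) (empirical N x)) + (2 * p0 - 1) * (norm (\<sigma> t (x i) (empirical N x)))\<^sup>2 \<le> K0 * A"
    using coefficient_growth[OF assms(1-4) A2 A6 A7] by blast
  have H1': "norm (T1 v h) \<le> norm v" "norm (T2 v h) \<le> norm v" if "0 < h" "h < 1" for v h
    using H1 that unfolding taming_bounds_def by (fastforce simp: min_le_iff_disj)+
  obtain L where L: "L > 0" "\<And>v h. 0 < h \<Longrightarrow> h < 1 \<Longrightarrow> norm (T1 v h - v) \<le> L * h powr r1 * norm v powr r2"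
    using H2 unfolding taming_consistent_def by (metis greaterThanLessThan_iff)
  define c where "c = sqrt N * K0"
  define K where "K = N * K0 + 2 * N * (L * K0 powr r2)"
  have "c \<ge> 0" "K \<ge> 0" using K0 L(1) by (auto simp: c_def K_def)
  have c2: "c\<^sup>2 = N * K0\<^sup>2" by (simp add: c_def power_mult_distrib)
  have Gpos: "G > 0" using G(1) assms(3) by linarith
  show ?thesis
  proof (rule that[OF \<open>c \<ge> 0\<close> \<open>K \<ge> 0\<close>])
    fix h t :: real and x :: "nat \<Rightarrow> real ^ 'd" and A B and s :: "nat \<times> 'm \<Rightarrow> real ^ 'd"
    assume h: "0 < h" "h < 1" and t: "t \<in> {0..T}" and A: "A = 1 + (\<Sum>i=1..N. (norm (x i))\<^sup>2)"
      and AR: "A \<le> h powr (- 2 / G)"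
      and B: "B = (\<lambda>i. T1 (b t (x i) (empirical N x)) h)"
      and s: "s = (\<lambda>(i, r). T2 (column r (\<sigma> t (x i) (empirical N x))) h)"
    define \<beta> where "\<beta> i = b t (x i) (empirical N x)" for i
    define \<Sigma> where "\<Sigma> i = \<sigma> t (x i) (empirical N x)" for i
    have A1: "A \<ge> 1" unfolding A by (simp add: sum_nonneg)
    have b1: "norm (\<beta> i) \<le> K0 * A powr (\<rho> + 1 / 2)"
      and s1: "(norm (\<Sigma> i))\<^sup>2 \<le> K0 * A powr (\<rho> + 1)"
      and bs1: "2 * (x i \<bullet> \<beta> i) + (2 * p0 - 1) * (norm (\<Sigma> i))\<^sup>2 \<le> K0 * A"
      if "i \<in> {1..N}" for i
      using growth[OF t that A] by (auto simp: \<beta>_def \<Sigma>_def)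
    have Ar: "A powr \<rho> \<le> h powr (- 1 / 3)"
    proof -
      have "A powr \<rho> \<le> (h powr (- 2 / G)) powr \<rho>"
        using A1 AR assms(3) by (intro powr_mono2) auto
      also have "\<dots> = h powr (- (2 * \<rho> / G))" by (simp add: powr_powr)
      also have "\<dots> \<le> h powr (- 1 / 3)"
        using G(1) Gpos h by (intro powr_mono') (auto simp: field_simps)
      finally show ?thesis .
    qed
    have A_pows: "A powr (\<rho> + 1) = A powr \<rho> * A" "(A powr (\<rho> + 1 / 2))\<^sup>2 = (A powr \<rho>)\<^sup>2 * A"
    proof -
      show "A powr (\<rho> + 1) = A powr \<rho> * A" using A1 by (simp add: powr_add)
      have "(A powr (1 / 2))\<^sup>2 = A" using A1 by (simp add: powr_half_sqrt)
      then show "(A powr (\<rho> + 1 / 2))\<^sup>2 = (A powr \<rho>)\<^sup>2 * A"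
        by (simp add: powr_add power_mult_distrib)
    qed
    have hk: "h * h powr (- 1 / 3) = (h powr (1 / 3))\<^sup>2" "h\<^sup>2 * (h powr (- 1 / 3))\<^sup>2 = (h powr (1 / 3)) ^ 4"
    proof -
      have "h * h powr (- 1 / 3) = h powr (1 + (- 1 / 3))" using h by (simp only: powr_add) simp
      also have "\<dots> = (h powr (1 / 3))\<^sup>2"
        using h by (simp add: power2_eq_square flip: powr_add)
      finally show 1: "h * h powr (- 1 / 3) = (h powr (1 / 3))\<^sup>2" .
      have "h\<^sup>2 * (h powr (- 1 / 3))\<^sup>2 = (h * h powr (- 1 / 3))\<^sup>2" by (simp add: power_mult_distrib)
      also have "\<dots> = (h powr (1 / 3)) ^ 4" unfolding 1 by (simp flip: power_mult)
      finally show "h\<^sup>2 * (h powr (- 1 / 3))\<^sup>2 = (h powr (1 / 3)) ^ 4" .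
    qed
    have Bb: "norm (B i) \<le> norm (\<beta> i)" for i
      unfolding B \<beta>_def using H1' h by simp
    have B_bound: "h\<^sup>2 * (\<Sum>i=1..N. (norm (B i))\<^sup>2) \<le> c\<^sup>2 * (h powr (1 / 3)) ^ 4 * A"
    proof -
      have "(\<Sum>i=1..N. (norm (B i))\<^sup>2) \<le> (\<Sum>i=1..N. K0\<^sup>2 * (h powr (- 1 / 3))\<^sup>2 * A)"
      proof (intro sum_mono)
        fix i assume i: "i \<in> {1..N}"
        have "(norm (B i))\<^sup>2 \<le> (K0 * A powr (\<rho> + 1 / 2))\<^sup>2"
          using order.trans[OF Bb b1[OF i]] by (intro power_mono) auto
        also have "\<dots> = K0\<^sup>2 * (A powr \<rho>)\<^sup>2 * A" by (simp add: power_mult_distrib A_pows)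
        also have "\<dots> \<le> K0\<^sup>2 * (h powr (- 1 / 3))\<^sup>2 * A"
          using Ar A1 by (intro mult_right_mono mult_left_mono power_mono) auto
        finally show "(norm (B i))\<^sup>2 \<le> K0\<^sup>2 * (h powr (- 1 / 3))\<^sup>2 * A" .
      qed
      then have "h\<^sup>2 * (\<Sum>i=1..N. (norm (B i))\<^sup>2) \<le> h\<^sup>2 * (\<Sum>i=1..N. K0\<^sup>2 * (h powr (- 1 / 3))\<^sup>2 * A)"
        by (intro mult_left_mono) auto
      also have "\<dots> = N * K0\<^sup>2 * (h\<^sup>2 * (h powr (- 1 / 3))\<^sup>2) * A" by simp
      finally show ?thesis unfolding hk c2 .
    qed
    have s_sum: "(\<Sum>j\<in>{1..N} \<times> UNIV. (norm (s j))\<^sup>2) \<le> (\<Sum>i=1..N. (norm (\<Sigma> i))\<^sup>2)"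
    proof -
      have "(\<Sum>j\<in>{1..N} \<times> UNIV. (norm (s j))\<^sup>2) = (\<Sum>i=1..N. \<Sum>r\<in>UNIV. (norm (s (i, r)))\<^sup>2)"
        by (simp add: sum.cartesian_product)
      also have "\<dots> \<le> (\<Sum>i=1..N. \<Sum>r\<in>UNIV. (norm (column r (\<Sigma> i)))\<^sup>2)"
        unfolding s \<Sigma>_def using H1' h by (intro sum_mono power_mono) auto
      finally show ?thesis by (simp add: sum_norm_column_squared)
    qed
    have s_bound: "h * (\<Sum>j\<in>{1..N} \<times> UNIV. (norm (s j))\<^sup>2) \<le> c\<^sup>2 * (h powr (1 / 3))\<^sup>2 * A"
    proof -
      have "(\<Sum>i=1..N. (norm (\<Sigma> i))\<^sup>2) \<le> (\<Sum>i=1..N. K0\<^sup>2 * h powr (- 1 / 3) * A)"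
      proof (intro sum_mono)
        fix i assume i: "i \<in> {1..N}"
        have "(norm (\<Sigma> i))\<^sup>2 \<le> K0 * A powr \<rho> * A" using s1[OF i] by (simp add: A_pows)
        also have "\<dots> \<le> K0\<^sup>2 * h powr (- 1 / 3) * A"
          using Ar A1 K0 self_le_power[of K0 2] by (intro mult_right_mono mult_mono) auto
        finally show "(norm (\<Sigma> i))\<^sup>2 \<le> K0\<^sup>2 * h powr (- 1 / 3) * A" .
      qed
      with s_sum have "h * (\<Sum>j\<in>{1..N} \<times> UNIV. (norm (s j))\<^sup>2) \<le> h * (\<Sum>i=1..N. K0\<^sup>2 * h powr (- 1 / 3) * A)"
        using h by (intro mult_left_mono) auto
      also have "\<dots> = N * K0\<^sup>2 * (h * h powr (- 1 / 3)) * A" by simp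
      finally show ?thesis unfolding hk c2 .
    qed
    \<comment> \<open>Paired with the state, the taming error is of order
      \<open>h powr r1 * A powr (1 / 2 + (\<rho> + 1 / 2) * r2)\<close>. That exponent of
      \<open>A\<close> is \<open>e / 2 + 1\<close>, so \<open>e / 2\<close> is the excess over
      linear growth in \<open>A\<close>. It may be negative, hence \<open>max e 0\<close>
      below.\<close>
    define e where "e = (2 * \<rho> + 1) * r2 - 1"
    have hA: "h powr r1 * A powr (e / 2) \<le> 1"
    proof -
      have "A powr (e / 2) \<le> (h powr (- 2 / G)) powr (max e 0 / 2)"
        using A1 AR by (intro powr_nonneg_exponent_le) auto
      also have "\<dots> = h powr (- (max e 0 / G))" by (simp add: powr_powr)
      finally have "h powr r1 * A powr (e / 2) \<le> h powr r1 * h powr (- (max e 0 / G))"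
        by (intro mult_left_mono) auto
      also have "\<dots> = h powr (r1 - max e 0 / G)" by (simp flip: powr_add)
      also have "\<dots> \<le> 1"
      proof -
        have "e \<le> G * r1" using G(2) assms(5) by (simp add: e_def divide_le_eq)
        then have "max e 0 / G \<le> r1" using Gpos assms(5) by (simp add: divide_le_eq mult.commute)
        then show ?thesis using h by (intro powr_le1) auto
      qed
      finally show ?thesis .
    qed
    have tame: "x i \<bullet> (B i - \<beta> i) \<le> L * K0 powr r2 * A" if i: "i \<in> {1..N}" for i
    proof -
      have "(norm (x i))\<^sup>2 \<le> A"
        using member_le_sum[of i "{1..N}" "\<lambda>j. (norm (x j))\<^sup>2"] i unfolding A by auto
      then have xi: "norm (x i) \<le> A powr (1 / 2)"
        using real_sqrt_le_mono[of "(norm (x i))\<^sup>2" A] A1 by (simp add: powr_half_sqrt)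
      have "x i \<bullet> (B i - \<beta> i) \<le> norm (x i) * norm (B i - \<beta> i)"
        by (rule norm_cauchy_schwarz)
      also have "norm (B i - \<beta> i) \<le> L * h powr r1 * norm (\<beta> i) powr r2"
        unfolding B \<beta>_def using L(2) h by simp
      also have "norm (\<beta> i) powr r2 \<le> (K0 * A powr (\<rho> + 1 / 2)) powr r2"
        using b1[OF i] assms(6) by (intro powr_mono2) auto
      also have "norm (x i) * (L * h powr r1 * (K0 * A powr (\<rho> + 1 / 2)) powr r2)
        \<le> A powr (1 / 2) * (L * h powr r1 * (K0 * A powr (\<rho> + 1 / 2)) powr r2)"
        using xi L(1) by (intro mult_right_mono) auto
      also have "\<dots> = L * K0 powr r2 * (h powr r1 * (A powr (1 / 2) * A powr ((\<rho> + 1 / 2) * r2)))"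
        using K0 by (simp add: powr_mult powr_powr mult_ac)
      also have "A powr (1 / 2) * A powr ((\<rho> + 1 / 2) * r2) = A powr (e / 2 + 1)"
        unfolding powr_add[symmetric] by (rule arg_cong[where f = "(powr) A"]) (simp add: e_def field_simps)
      also have "\<dots> = A powr (e / 2) * A" using A1 by (simp add: powr_add)
      also have "L * K0 powr r2 * (h powr r1 * (A powr (e / 2) * A)) = L * K0 powr r2 * ((h powr r1 * A powr (e / 2)) * A)"
        by (simp only: mult_ac)
      also have "\<dots> \<le> L * K0 powr r2 * (1 * A)"
        using L(1) A1 hA by (intro mult_left_mono mult_right_mono) auto
      finally show ?thesis
        using L(1) by (simp add: mult_left_mono mult_right_mono)
    qed
    have "2 * (\<Sum>i=1..N. x i \<bullet> B i) + (2 * p - 1) * (\<Sum>j\<in>{1..N} \<times> UNIV. (norm (s j))\<^sup>2)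
      \<le> 2 * (\<Sum>i=1..N. x i \<bullet> B i) + (2 * p0 - 1) * (\<Sum>i=1..N. (norm (\<Sigma> i))\<^sup>2)"
      using assms(7,8) s_sum by (intro add_left_mono mult_mono) (auto intro: sum_nonneg)
    also have "\<dots> = (\<Sum>i=1..N. (2 * (x i \<bullet> \<beta> i) + (2 * p0 - 1) * (norm (\<Sigma> i))\<^sup>2) + 2 * (x i \<bullet> (B i - \<beta> i)))"
      by (simp add: inner_diff_right sum.distrib sum_distrib_left sum_subtractf)
    also have "\<dots> \<le> (\<Sum>i=1..N. K0 * A + 2 * (L * K0 powr r2 * A))"
      using bs1 tame by (intro sum_mono add_mono mult_left_mono) auto
    also have "\<dots> = K * A" by (simp add: K_def algebra_simps)
    finally show "h\<^sup>2 * (\<Sum>i=1..N. (norm (B i))\<^sup>2) \<le> c\<^sup>2 * (h powr (1 / 3)) ^ 4 * A \<and>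
      h * (\<Sum>j\<in>{1..N} \<times> UNIV. (norm (s j))\<^sup>2) \<le> c\<^sup>2 * (h powr (1 / 3))\<^sup>2 * A \<and>
      2 * (\<Sum>i=1..N. x i \<bullet> B i) + (2 * p - 1) * (\<Sum>j\<in>{1..N} \<times> UNIV. (norm (s j))\<^sup>2) \<le> K * A"
      using B_bound s_bound by blast
  qed
qed

section \<open>Expectation of the one-step expansion\<close>

text \<open>\<open>\<G>\<close> stands for functions of the past, \<open>D\<close> for the
  increments, \<open>R\<close> for the weight of the Taylor remainder. Every coefficient is
  independent of its noise factor, so expectations factor; the linear terms and the mixed products
  vanish. \<open>H'\<close> is what conditioning \<open>H\<close> on the past would give, but only
  the means are compared.\<close>

lemma (in prob_space) expectation_quadratic_form:
  fixes D :: "'j \<Rightarrow> 'a \<Rightarrow> real" and R g0 gr :: "'a \<Rightarrow> real" and gl :: "'j \<Rightarrow> 'a \<Rightarrow> real"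
    and gq :: "'j \<Rightarrow> 'j \<Rightarrow> 'a \<Rightarrow> real" and \<G> :: "('a \<Rightarrow> real) set"
  assumes J: "finite J"
    and g_int: "\<And>g. g \<in> \<G> \<Longrightarrow> integrable M g"
    and g_D: "\<And>g j. g \<in> \<G> \<Longrightarrow> j \<in> J \<Longrightarrow> indep_var borel g borel (D j)"
    and g_DD: "\<And>g j k. g \<in> \<G> \<Longrightarrow> j \<in> J \<Longrightarrow> k \<in> J \<Longrightarrow> indep_var borel g borel (\<lambda>\<omega>. D j \<omega> * D k \<omega>)"
    and g_R: "\<And>g. g \<in> \<G> \<Longrightarrow> indep_var borel g borel R"
    and D: "\<And>j. j \<in> J \<Longrightarrow> integrable M (D j)" "\<And>j. j \<in> J \<Longrightarrow> expectation (D j) = 0"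
    and DD: "\<And>j k. j \<in> J \<Longrightarrow> k \<in> J \<Longrightarrow> integrable M (\<lambda>\<omega>. D j \<omega> * D k \<omega>)"
      "\<And>j k. j \<in> J \<Longrightarrow> k \<in> J \<Longrightarrow> expectation (\<lambda>\<omega>. D j \<omega> * D k \<omega>) = (if j = k then h else 0)"
    and R: "integrable M R"
    and g: "g0 \<in> \<G>" "\<And>j. j \<in> J \<Longrightarrow> gl j \<in> \<G>" "\<And>j k. j \<in> J \<Longrightarrow> k \<in> J \<Longrightarrow> gq j k \<in> \<G>" "gr \<in> \<G>"
  defines "H \<equiv> \<lambda>\<omega>. g0 \<omega> + (\<Sum>j\<in>J. gl j \<omega> * D j \<omega>) + (\<Sum>j\<in>J. \<Sum>k\<in>J. gq j k \<omega> * (D j \<omega> * D k \<omega>)) + gr \<omega> * R \<omega>"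
    and "H' \<equiv> \<lambda>\<omega>. g0 \<omega> + h * (\<Sum>j\<in>J. gq j j \<omega>) + expectation R * gr \<omega>"
  shows "integrable M H" "integrable M H'" "expectation H = expectation H'"
proof -
  have prod: "has_bochner_integral M (\<lambda>\<omega>. g \<omega> * f \<omega>) (expectation g * expectation f)"
    if "g \<in> \<G>" "indep_var borel g borel f" "integrable M f" for g f
    using that g_int by (simp add: has_bochner_integral_iff indep_var_integrable indep_var_lebesgue_integral)
  have "has_bochner_integral M H (expectation g0 + (\<Sum>j\<in>J. expectation (gl j) * expectation (D j))
      + (\<Sum>j\<in>J. \<Sum>k\<in>J. expectation (gq j k) * expectation (\<lambda>\<omega>. D j \<omega> * D k \<omega>))
      + expectation gr * expectation R)"
    unfolding H_def
    by (intro has_bochner_integral_add has_bochner_integral_sum prod g g_D g_DD g_R D DD R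
        has_bochner_integral_integrable g_int) auto
  moreover have "(\<Sum>k\<in>J. expectation (gq j k) * expectation (\<lambda>\<omega>. D j \<omega> * D k \<omega>)) = h * expectation (gq j j)"
    if "j \<in> J" for j
  proof -
    have "(\<Sum>k\<in>J. expectation (gq j k) * expectation (\<lambda>\<omega>. D j \<omega> * D k \<omega>))
      = (\<Sum>k\<in>J. if j = k then h * expectation (gq j k) else 0)"
      using DD(2)[OF that] by (intro sum.cong) auto
    then show ?thesis using J that by simp
  qed
  ultimately have H: "has_bochner_integral M H (expectation g0 + h * (\<Sum>j\<in>J. expectation (gq j j))
      + expectation gr * expectation R)"
    using D(2) by (simp add: sum_distrib_left)
  have H': "has_bochner_integral M H' (expectation g0 + h * (\<Sum>j\<in>J. expectation (gq j j))
      + expectation R * expectation gr)"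
    unfolding H'_def
    by (intro has_bochner_integral_add has_bochner_integral_mult_right has_bochner_integral_sum
        has_bochner_integral_integrable g_int g) auto
  show "integrable M H" "integrable M H'" "expectation H = expectation H'"
    using H H' by (simp_all add: has_bochner_integral_iff mult.commute)
qed

lemma bounded_mult_comp:
  fixes f g :: "'a \<Rightarrow> real"
  assumes "bounded (f ` S)" "bounded (g ` S)"
  shows "bounded ((\<lambda>x. f x * g x) ` S)"
proof -
  obtain a b where "\<forall>x\<in>S. \<bar>f x\<bar> \<le> a" "\<forall>x\<in>S. \<bar>g x\<bar> \<le> b"
    using assms by (auto simp: bounded_iff)
  then have "\<forall>x\<in>S. \<bar>f x * g x\<bar> \<le> a * b"
    by (auto simp: abs_mult intro!: mult_mono order.trans[OF abs_ge_zero])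
  then show ?thesis by (auto simp: bounded_iff)
qed

lemma bounded_inner_comp:
  fixes f g :: "'a \<Rightarrow> 'b::real_inner"
  assumes "bounded (f ` S)" "bounded (g ` S)"
  shows "bounded ((\<lambda>x. f x \<bullet> g x) ` S)"
proof -
  obtain a b where ab: "\<forall>x\<in>S. norm (f x) \<le> a" "\<forall>x\<in>S. norm (g x) \<le> b"
    using assms by (auto simp: bounded_iff)
  then have "\<forall>x\<in>S. norm (f x) * norm (g x) \<le> a * b"
    by (auto intro!: mult_mono order.trans[OF norm_ge_zero])
  then have "\<forall>x\<in>S. \<bar>f x \<bullet> g x\<bar> \<le> a * b"
    using order.trans[OF Cauchy_Schwarz_ineq2] by blast
  then show ?thesis by (auto simp: bounded_iff)
qed

lemma bounded_sum_comp:
  fixes f :: "'i \<Rightarrow> 'a \<Rightarrow> 'b::real_normed_vector"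
  assumes "\<And>i. i \<in> I \<Longrightarrow> bounded (f i ` S)"
  shows "bounded ((\<lambda>x. \<Sum>i\<in>I. f i x) ` S)"
  using assms
proof (induction I rule: infinite_finite_induct)
  case (insert i I)
  then show ?case by (auto intro!: bounded_plus_comp)
qed (auto simp: bounded_iff)

text \<open>Brings the noise energy into the shape required by
  \<open>expectation_quadratic_form\<close>. Increments of different particles never meet in one
  norm, hence the test on first components.\<close>

lemma norm_sum_squared_eq_quadratic:
  fixes s :: "'i \<times> 'r::finite \<Rightarrow> 'a::real_inner"
  assumes "finite I"
  shows "(\<Sum>i\<in>I. (norm (\<Sum>r\<in>UNIV. D (i, r) *\<^sub>R s (i, r)))\<^sup>2)
    = (\<Sum>j\<in>I \<times> UNIV. \<Sum>k\<in>I \<times> UNIV. (if fst j = fst k then s j \<bullet> s k else 0) * (D j * D k))"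
proof -
  have "(norm (\<Sum>r\<in>UNIV. D (i, r) *\<^sub>R s (i, r)))\<^sup>2
    = (\<Sum>r\<in>UNIV. \<Sum>k\<in>I \<times> UNIV. (if i = fst k then s (i, r) \<bullet> s k else 0) * (D (i, r) * D k))"
    if "i \<in> I" for i
  proof -
    have "(\<Sum>k\<in>I \<times> UNIV. (if i = fst k then s (i, r) \<bullet> s k else 0) * (D (i, r) * D k))
      = (\<Sum>q\<in>UNIV. (s (i, r) \<bullet> s (i, q)) * (D (i, r) * D (i, q)))" for r
    proof -
      have "(\<Sum>k\<in>I \<times> UNIV. (if i = fst k then s (i, r) \<bullet> s k else 0) * (D (i, r) * D k))
        = (\<Sum>i'\<in>I. if i = i' then (\<Sum>q\<in>UNIV. (s (i, r) \<bullet> s (i', q)) * (D (i, r) * D (i', q))) else 0)"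
        unfolding sum.cartesian_product' by (intro sum.cong) auto
      then show ?thesis using assms that by simp
    qed
    then show ?thesis
      by (simp add: dot_square_norm[symmetric] inner_sum_left inner_sum_right sum_distrib_left
          inner_commute mult_ac)
  qed
  then show ?thesis by (simp add: sum.cartesian_product')
qed

lemma sum_inner_eq_linear:
  fixes s :: "'i \<times> 'r::finite \<Rightarrow> 'a::real_inner"
  shows "(\<Sum>i\<in>I. x i \<bullet> (\<Sum>r\<in>UNIV. D (i, r) *\<^sub>R s (i, r))) = (\<Sum>j\<in>I \<times> UNIV. (x (fst j) \<bullet> s j) * D j)"
  by (simp add: sum.cartesian_product' inner_sum_right mult.commute)

section \<open>The particle system\<close>

lemma borel_measurable_column [measurable]:
  "(\<lambda>A :: real ^ 'm::finite ^ 'd::finite. column r A) \<in> borel_measurable borel"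
  unfolding column_def
  by (intro borel_measurable_continuous_onI continuous_intros)

lemma brownian_motion_increment:
  assumes "brownian_motion M T W" "0 \<le> s" "s < t" "t \<le> T"
  shows "prob_space.indep_vars M (\<lambda>_. borel) (\<lambda>r \<omega>. W t \<omega> $ r - W s \<omega> $ r) UNIV"
    and "distributed M lborel (\<lambda>\<omega>. W t \<omega> $ r - W s \<omega> $ r) (normal_density 0 (sqrt (t - s)))"
  using assms unfolding brownian_motion_def by blast+

locale tamed_particle_system = prob_space M
  for M :: "'w measure" +
  fixes T p0 pbar \<rho> r1 r2 G :: real
    and b :: "real \<Rightarrow> real ^ 'd::finite \<Rightarrow> (real ^ 'd) measure \<Rightarrow> real ^ 'd"
    and \<sigma> :: "real \<Rightarrow> real ^ 'd \<Rightarrow> (real ^ 'd) measure \<Rightarrow> real ^ 'm::finite ^ 'd"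
    and T1 T2 :: "real ^ 'd \<Rightarrow> real \<Rightarrow> real ^ 'd"
    and W :: "real \<Rightarrow> 'w \<Rightarrow> real ^ 'm" and X0 :: "'w \<Rightarrow> real ^ 'd"
    and N :: nat
    and W' :: "nat \<Rightarrow> real \<Rightarrow> 'w \<Rightarrow> real ^ 'm" and X0' :: "nat \<Rightarrow> 'w \<Rightarrow> real ^ 'd"
  assumes T: "T > 0" and p0: "p0 > 1" and \<rho>: "\<rho> > 0" and r1: "r1 > 0" and r2: "r2 > 0" and N: "N \<ge> 1"
    and BM: "brownian_motion M T W" and X0: "X0 \<in> borel_measurable M"
    and indep: "indep_of_process M T W X0" and copies: "indep_copies M T N W X0 W' X0'"
    and data: "measurable_data T \<sigma> T1 T2"
    and A1: "integrable M (\<lambda>\<omega>. norm (X0 \<omega>) powr (2 * p0))"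
    and A2: "coercivity T p0 b \<sigma>" and A6: "drift_poly_lipschitz T \<rho> b" and A7: "time_hoelder T b \<sigma>"
    and H1: "taming_bounds T1 T2" and H2: "taming_consistent r1 r2 T1"
    and G: "6 * \<rho> \<le> G" "((2 * \<rho> + 1) * r2 - 1) / r1 \<le> G"
    and pbar: "pbar \<le> p0" "1 + 5 / 2 * G \<le> pbar"
begin

abbreviation "step_size n \<equiv> T / real n"

definition "X n k i \<omega> = mod_euler N (step_size n) b \<sigma> T1 T2 W' X0' k i \<omega>"

definition "energy n k \<omega> = 1 + (\<Sum>i=1..N. (norm (X n k i \<omega>))\<^sup>2)"

definition "drift n k i \<omega> =
  T1 (b (real k * step_size n) (X n k i \<omega>) (empirical N (\<lambda>j. X n k j \<omega>))) (step_size n)"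

definition "diffusion n k = (\<lambda>(i, r) \<omega>.
  T2 (column r (\<sigma> (real k * step_size n) (X n k i \<omega>) (empirical N (\<lambda>j. X n k j \<omega>)))) (step_size n))"

definition "increment n k = (\<lambda>(i, r) \<omega>.
  W' i (real (Suc k) * step_size n) \<omega> $ r - W' i (real k * step_size n) \<omega> $ r)"

text \<open>The bound is imposed strictly before time \<open>k\<close>. Membership in
  \<open>good n (Suc k)\<close> is therefore decided by \<open>past n k\<close>, and
  \<open>good n k\<close> itself says nothing about \<open>energy n k\<close>; both facts are used,
  in \<open>one_step\<close> and at the first exit time.\<close>

definition "good n k = {\<omega> \<in> space M. \<forall>l<k. energy n l \<omega> \<le> step_size n powr (- 2 / G)}"

text \<open>Index 0 is the initial value and index \<open>Suc l\<close> the increment over step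
  \<open>l\<close>. Indices up to \<open>k\<close> thus contain the increments over the steps before
  \<open>k\<close>, which determine the state at time \<open>k\<close>; the increment over step
  \<open>k\<close> has index \<open>Suc k\<close> and belongs to \<open>future n k\<close>.\<close>

definition "past n k = generated_algebra M (\<lambda>_. borel) (noise (step_size n) W' X0') ({1..N} \<times> {..k})"

definition "future n k = generated_algebra M (\<lambda>_. borel) (noise (step_size n) W' X0') ({1..N} \<times> {Suc k})"

lemma X_0: "X n 0 i \<omega> = X0' i \<omega>"
  by (simp add: X_def)

lemma X_Suc:
  "X n (Suc k) i \<omega> = X n k i \<omega> + step_size n *\<^sub>R drift n k i \<omega>
    + (\<Sum>r\<in>UNIV. increment n k (i, r) \<omega> *\<^sub>R diffusion n k (i, r) \<omega>)"
  by (simp add: X_def drift_def diffusion_def increment_def Let_def)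

lemma energy_ge_1: "1 \<le> energy n k \<omega>"
  by (simp add: energy_def sum_nonneg)

lemma norm_X_squared_le: "i \<in> {1..N} \<Longrightarrow> (norm (X n k i \<omega>))\<^sup>2 \<le> energy n k \<omega>"
  using member_le_sum[of i "{1..N}" "\<lambda>i. (norm (X n k i \<omega>))\<^sup>2"] by (auto simp: energy_def)

lemma G_pos: "G > 0"
  using G(1) \<rho> by linarith

lemma pbar_ge_1: "1 \<le> pbar"
  using pbar(2) G_pos by linarith

lemma grid: "n \<ge> 1 \<Longrightarrow> k \<le> n \<Longrightarrow> real k * step_size n \<in> {0..T}"
  using T by (auto simp: field_simps)

section \<open>Measurability with respect to the past\<close>

lemma indep_noise:
  "n \<ge> 1 \<Longrightarrow> indep_vars (\<lambda>_. borel) (noise (step_size n) W' X0') ({1..N} \<times> {..n})"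
  using indep_vars_noise[OF T _ N BM X0 indep copies] .

lemma noise_measurable:
  "n \<ge> 1 \<Longrightarrow> p \<in> {1..N} \<times> {..n} \<Longrightarrow> noise (step_size n) W' X0' p \<in> borel_measurable M"
  using indep_noise[of n] unfolding indep_vars_def2 by blast

lemma noise_past_measurable:
  assumes "n \<ge> 1" "k \<le> n" "p \<in> {1..N} \<times> {..k}"
  shows "noise (step_size n) W' X0' p \<in> borel_measurable (past n k)"
  unfolding past_def using assms
  by (intro measurable_generated_algebra_component[where S = "\<lambda>_. borel"] noise_measurable) auto

lemma past_measurable_imp:
  assumes "n \<ge> 1" "k \<le> n" "f \<in> measurable (past n k) R"
  shows "f \<in> measurable M R"
  using assms(3) unfolding past_def
  by (rule measurable_from_generated_algebra[rotated]) (use assms in \<open>auto intro!: noise_measurable\<close>)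

lemma space_past [simp]: "space (past n k) = space M"
  by (simp add: past_def)

lemma initial_past_measurable:
  assumes "n \<ge> 1" "k \<le> n" "i \<in> {1..N}"
  shows "X0' i \<in> borel_measurable (past n k)"
proof -
  have "(\<lambda>\<omega>. snd (noise (step_size n) W' X0' (i, 0) \<omega>)) \<in> borel_measurable (past n k)"
    by (intro measurable_compose[OF noise_past_measurable] borel_measurable_continuous_onI continuous_intros)
      (use assms in auto)
  then show ?thesis by simp
qed

lemma increment_component_measurable:
  fixes F :: "'w measure"
  assumes "noise (step_size n) W' X0' (i, Suc l) \<in> borel_measurable F"
  shows "increment n l (i, r) \<in> borel_measurable F"
proof -
  have "(\<lambda>\<omega>. fst (noise (step_size n) W' X0' (i, Suc l) \<omega>) $ r) \<in> borel_measurable F"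
    by (intro measurable_compose[OF assms] borel_measurable_continuous_onI continuous_intros)
  then show ?thesis by (simp add: increment_def)
qed

lemma coefficients_measurable:
  fixes F :: "'w measure"
  assumes "n \<ge> 1" "step_size n < 1" "k \<le> n" "i \<in> {1..N}"
    and X: "\<And>j. j \<in> {1..N} \<Longrightarrow> X n k j \<in> borel_measurable F"
  shows "drift n k i \<in> borel_measurable F" "diffusion n k (i, r) \<in> borel_measurable F"
proof -
  have taming: "(\<lambda>x. T1 x (step_size n)) \<in> borel_measurable borel"
    "(\<lambda>x. T2 x (step_size n)) \<in> borel_measurable borel"
    using data assms T by (auto simp: measurable_data_def)
  have "(\<lambda>\<omega>. b (real k * step_size n) (X n k i \<omega>) (empirical N (\<lambda>j. X n k j \<omega>))) \<in> borel_measurable F"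
    using drift_measurable[OF A6 \<rho> N grid[OF assms(1,3)] assms(4), of "\<lambda>\<omega> j. X n k j \<omega>"] X by simp
  from measurable_compose[OF this taming(1)] show "drift n k i \<in> borel_measurable F"
    by (simp add: drift_def[abs_def])
  have "(\<lambda>\<omega>. column r (\<sigma> (real k * step_size n) (X n k i \<omega>) (empirical N (\<lambda>j. X n k j \<omega>)))) \<in> borel_measurable F"
    using measurable_compose[OF diffusion_measurable[OF data N grid[OF assms(1,3)] assms(4), of "\<lambda>\<omega> j. X n k j \<omega>"]
        borel_measurable_column] X by simp
  from measurable_compose[OF this taming(2)] show "diffusion n k (i, r) \<in> borel_measurable F"
    by (simp add: diffusion_def)
qed

lemma X_past_measurable:
  assumes "n \<ge> 1" "step_size n < 1" "k \<le> n" "l \<le> k" "i \<in> {1..N}"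
  shows "X n l i \<in> borel_measurable (past n k)"
  using assms(4,5)
proof (induction l arbitrary: i)
  case 0
  then show ?case
    using initial_past_measurable[OF assms(1,3)] by (simp add: X_0[abs_def])
next
  case (Suc l)
  have X: "X n l j \<in> borel_measurable (past n k)" if "j \<in> {1..N}" for j
    using Suc that by simp
  have "increment n l (i, r) \<in> borel_measurable (past n k)" for r
    by (intro increment_component_measurable noise_past_measurable) (use Suc assms in auto)
  moreover have "drift n l i \<in> borel_measurable (past n k)"
    "diffusion n l (i, r) \<in> borel_measurable (past n k)" for r
    using coefficients_measurable[OF assms(1,2) _ Suc.prems(2) X] Suc assms by auto
  ultimately show ?case
    using X[OF Suc.prems(2)] unfolding X_Suc[abs_def]
    by (intro borel_measurable_add borel_measurable_sum borel_measurable_scaleR borel_measurable_const)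
qed

lemma energy_past_measurable:
  assumes "n \<ge> 1" "step_size n < 1" "k \<le> n" "l \<le> k"
  shows "energy n l \<in> borel_measurable (past n k)"
proof -
  have [measurable]: "X n l i \<in> borel_measurable (past n k)" if "i \<in> {1..N}" for i
    by (rule X_past_measurable[OF assms that])
  show ?thesis
    unfolding energy_def[abs_def] by measurable
qed

lemma good_past_measurable:
  assumes "n \<ge> 1" "step_size n < 1" "k \<le> n"
  shows "good n (Suc k) \<in> sets (past n k)"
proof -
  have "{\<omega> \<in> space (past n k). energy n l \<omega> \<le> step_size n powr (- 2 / G)} \<in> sets (past n k)"
    if "l \<in> {..<Suc k}" for l
    using that by (intro borel_measurable_le energy_past_measurable assms borel_measurable_const) simp
  then have "{\<omega> \<in> space (past n k). \<forall>l\<in>{..<Suc k}. energy n l \<omega> \<le> step_size n powr (- 2 / G)} \<in> sets (past n k)"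
    by (rule sets.sets_Collect_finite_All[OF _ finite_lessThan])
  then show ?thesis
    unfolding good_def space_past by (simp only: Ball_def lessThan_iff)
qed

section \<open>Law and independence of the increments\<close>

lemma increment_future_measurable:
  assumes "n \<ge> 1" "k < n" "i \<in> {1..N}"
  shows "increment n k (i, r) \<in> borel_measurable (future n k)"
  unfolding future_def using assms
  by (intro increment_component_measurable measurable_generated_algebra_component[where S = "\<lambda>_. borel"] noise_measurable) auto

lemma indep_past_future:
  fixes f g :: "'w \<Rightarrow> real"
  assumes "n \<ge> 1" "k < n" "g \<in> borel_measurable (past n k)" "f \<in> borel_measurable (future n k)"
  shows "indep_var borel g borel f"
  by (rule indep_var_generated_algebras[OF indep_noise[OF assms(1)] _ _ _ assms(3,4)[unfolded past_def future_def]])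
    (use assms(2) in auto)

lemma increment_distributed:
  assumes "n \<ge> 1" "k < n" "i \<in> {1..N}"
  shows "distributed M lborel (increment n k (i, r)) (normal_density 0 (sqrt (step_size n)))"
    and "indep_vars (\<lambda>_. borel) (\<lambda>r. increment n k (i, r)) UNIV"
proof -
  have bm: "brownian_motion M T (W' i)"
    using copies assms(3) by (simp add: indep_copies_def)
  have order: "0 \<le> real k * step_size n" "real k * step_size n < real (Suc k) * step_size n"
    "real (Suc k) * step_size n \<le> T"
    using grid[of n k] grid[of n "Suc k"] assms T by (auto simp: field_simps)
  have diff: "real (Suc k) * step_size n - real k * step_size n = step_size n"
    by (simp add: algebra_simps add_divide_distrib)
  show "distributed M lborel (increment n k (i, r)) (normal_density 0 (sqrt (step_size n)))"
    using brownian_motion_increment(2)[OF bm order, of r] unfolding diff by (simp add: increment_def)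
  show "indep_vars (\<lambda>_. borel) (\<lambda>r. increment n k (i, r)) UNIV"
    using brownian_motion_increment(1)[OF bm order] by (simp add: increment_def)
qed

text \<open>Mixed products have mean 0 for two reasons: coordinates of one particle are independent
  by the definition of Brownian motion, increments of different particles because they are functions
  of disjoint blocks of the noise.\<close>

lemma increment_moments:
  assumes "n \<ge> 1" "k < n" "j \<in> {1..N} \<times> UNIV" "j' \<in> {1..N} \<times> UNIV"
  shows "integrable M (increment n k j)" "expectation (increment n k j) = 0"
    and "integrable M (\<lambda>\<omega>. increment n k j \<omega> * increment n k j' \<omega>)"
    and "expectation (\<lambda>\<omega>. increment n k j \<omega> * increment n k j' \<omega>) = (if j = j' then step_size n else 0)"
proof -
  have h: "step_size n > 0" using assms T by simp
  have single: "integrable M (increment n k q)" "expectation (increment n k q) = 0"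
    "integrable M (\<lambda>\<omega>. increment n k q \<omega> * increment n k q \<omega>)"
    "expectation (\<lambda>\<omega>. increment n k q \<omega> * increment n k q \<omega>) = step_size n"
    if "q \<in> {1..N} \<times> UNIV" for q
    using normal_centered_moments[OF h, of "increment n k q"] increment_distributed(1)[OF assms(1,2), of "fst q" "snd q"] that
    by (auto simp: mem_Times_iff)
  show "integrable M (increment n k j)" "expectation (increment n k j) = 0"
    using single[OF assms(3)] by auto
  have pair: "indep_var borel (increment n k j) borel (increment n k j')" if "j \<noteq> j'"
  proof (cases "fst j = fst j'")
    case True
    then obtain i r r' where "j = (i, r)" "j' = (i, r')"
      by (cases j; cases j') auto
    then show ?thesis
      using indep_vars_pair[OF increment_distributed(2)[OF assms(1,2), of i], of r r'] assms(3) that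
      by auto
  next
    case False
    have meas: "increment n k (i, r) \<in> borel_measurable
        (generated_algebra M (\<lambda>_. borel) (noise (step_size n) W' X0') {(i, Suc k)})"
      if "i \<in> {1..N}" for i r
      by (rule increment_component_measurable,
          rule measurable_generated_algebra_component[where S = "\<lambda>_. borel", OF noise_measurable[OF assms(1)]])
        (use that assms(2) in auto)
    have 1: "increment n k j \<in> borel_measurable
        (generated_algebra M (\<lambda>_. borel) (noise (step_size n) W' X0') {(fst j, Suc k)})"
      using meas[of "fst j" "snd j"] assms(3) by (simp add: mem_Times_iff)
    have 2: "increment n k j' \<in> borel_measurable
        (generated_algebra M (\<lambda>_. borel) (noise (step_size n) W' X0') {(fst j', Suc k)})"
      using meas[of "fst j'" "snd j'"] assms(4) by (simp add: mem_Times_iff)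
    show ?thesis
      by (rule indep_var_generated_algebras[OF indep_noise[OF assms(1)] _ _ _ 1 2]) (use False assms in auto)
  qed
  show "integrable M (\<lambda>\<omega>. increment n k j \<omega> * increment n k j' \<omega>)"
  proof (cases "j = j'")
    case True
    then show ?thesis using single(3)[OF assms(3)] by simp
  next
    case False
    then show ?thesis
      by (intro indep_var_integrable pair single(1) assms(3,4))
  qed
  show "expectation (\<lambda>\<omega>. increment n k j \<omega> * increment n k j' \<omega>) = (if j = j' then step_size n else 0)"
  proof (cases "j = j'")
    case True
    then show ?thesis using single(4)[OF assms(3)] by simp
  next
    case False
    then show ?thesis
      using indep_var_lebesgue_integral[OF pair[OF False] single(1)[OF assms(3)] single(1)[OF assms(4)]]
        single(2)[OF assms(3)] by simp
  qed
qed

text \<open>The factor of the remainder in \<open>powr_step_bound\<close>. With \<open>m = 1\<close>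
  it also measures the noise in the crude bound off the good set.\<close>

definition "noise_weight m n k \<omega> = (1 + (\<Sum>j\<in>{1..N} \<times> UNIV. \<bar>increment n k j \<omega>\<bar> / sqrt (step_size n))) ^ m"

text \<open>The scaled increments are standard normal for all \<open>n\<close> and \<open>k\<close>,
  and \<open>one_plus_sum_powr_le\<close> reduces the power of their sum to single absolute
  moments.\<close>

lemma noise_weight_moment:
  obtains K where "K \<ge> 0"
    "\<And>n k. n \<ge> 1 \<Longrightarrow> k < n \<Longrightarrow> integrable M (noise_weight m n k) \<and> expectation (noise_weight m n k) \<le> K"
proof -
  define J where "J = {1..N} \<times> (UNIV :: 'm set)"
  define c where "c = (\<integral>x. std_normal_density x * \<bar>x\<bar> ^ m \<partial>lborel)"
  define K where "K = real (1 + card J) ^ m * (1 + card J * c)"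
  have J: "finite J" by (simp add: J_def)
  have "c \<ge> 0" unfolding c_def by (intro Bochner_Integration.integral_nonneg) auto
  then have "K \<ge> 0" by (simp add: K_def)
  show ?thesis
  proof (rule that[OF \<open>K \<ge> 0\<close>])
    fix n k :: nat assume n: "n \<ge> 1" "k < n"
    have h: "step_size n > 0" using n T by simp
    define D where "D j \<omega> = \<bar>increment n k j \<omega> / sqrt (step_size n)\<bar>" for j \<omega>
    have D: "integrable M (\<lambda>\<omega>. D j \<omega> ^ m)" "expectation (\<lambda>\<omega>. D j \<omega> ^ m) = c" if "j \<in> J" for j
      using normal_absolute_moment[OF h, of "increment n k j" m] increment_distributed(1)[OF n, of "fst j" "snd j"] that
      by (auto simp: D_def c_def J_def mem_Times_iff)
    have D_meas: "D j \<in> borel_measurable M" if "j \<in> J" for j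
    proof -
      have "increment n k j \<in> borel_measurable M"
        using increment_moments(1)[OF n] that by (auto simp: J_def)
      then show ?thesis unfolding D_def[abs_def] by measurable
    qed
    have weight: "noise_weight m n k \<omega> = (1 + (\<Sum>j\<in>J. D j \<omega>)) ^ m" for \<omega>
    proof -
      have "\<bar>sqrt (step_size n)\<bar> = sqrt (step_size n)" using h by (intro abs_of_pos) simp
      then show ?thesis
        unfolding noise_weight_def D_def J_def abs_divide by (simp only:)
    qed
    have D0: "D j \<omega> \<ge> 0" for j \<omega> by (simp add: D_def)
    have le: "noise_weight m n k \<omega> \<le> real (1 + card J) ^ m * (1 + (\<Sum>j\<in>J. D j \<omega> ^ m))" for \<omega>
    proof -
      have "0 < 1 + (\<Sum>j\<in>J. D j \<omega>)"
        by (intro add_pos_nonneg sum_nonneg D0) simp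
      then have "noise_weight m n k \<omega> = (1 + (\<Sum>j\<in>J. D j \<omega>)) powr real m"
        by (simp add: weight powr_realpow)
      also have "\<dots> \<le> real (1 + card J) powr real m * (1 + (\<Sum>j\<in>J. D j \<omega> powr real m))"
        by (intro one_plus_sum_powr_le J D0) simp
      also have "\<dots> \<le> real (1 + card J) powr real m * (1 + (\<Sum>j\<in>J. D j \<omega> ^ m))"
      proof (intro mult_left_mono add_left_mono sum_mono)
        show "D j \<omega> powr real m \<le> D j \<omega> ^ m" for j
          using D0[of j \<omega>] by (cases "D j \<omega> = 0") (simp_all add: powr_realpow)
      qed simp
      finally show ?thesis
        by (simp add: powr_realpow)
    qed
    have rhs: "integrable M (\<lambda>\<omega>. real (1 + card J) ^ m * (1 + (\<Sum>j\<in>J. D j \<omega> ^ m)))"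
      by (intro integrable_mult_right Bochner_Integration.integrable_add integrable_const
          Bochner_Integration.integrable_sum D)
    have int: "integrable M (noise_weight m n k)"
    proof (rule Bochner_Integration.integrable_bound[OF rhs])
      show "noise_weight m n k \<in> borel_measurable M"
        unfolding weight[abs_def]
        by (intro borel_measurable_power borel_measurable_add borel_measurable_const borel_measurable_sum D_meas)
      have "\<bar>noise_weight m n k \<omega>\<bar> \<le> \<bar>real (1 + card J) ^ m * (1 + (\<Sum>j\<in>J. D j \<omega> ^ m))\<bar>" for \<omega>
      proof -
        have "0 \<le> noise_weight m n k \<omega>"
          unfolding weight by (intro zero_le_power add_nonneg_nonneg sum_nonneg D0 zero_le_one)
        then show ?thesis using le[of \<omega>] by linarith
      qed
      then show "AE \<omega> in M. norm (noise_weight m n k \<omega>) \<le> norm (real (1 + card J) ^ m * (1 + (\<Sum>j\<in>J. D j \<omega> ^ m)))"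
        by simp
    qed
    have "expectation (noise_weight m n k) \<le> expectation (\<lambda>\<omega>. real (1 + card J) ^ m * (1 + (\<Sum>j\<in>J. D j \<omega> ^ m)))"
      by (intro integral_mono int rhs le)
    also have "\<dots> = K"
      using D by (simp add: K_def Bochner_Integration.integral_add Bochner_Integration.integrable_sum prob_space)
    finally show "integrable M (noise_weight m n k) \<and> expectation (noise_weight m n k) \<le> K"
      using int by simp
  qed
qed

lemma past_sets_subset:
  assumes "n \<ge> 1" "k \<le> n"
  shows "sets (past n k) \<subseteq> sets M"
proof
  fix A assume A: "A \<in> sets (past n k)"
  have "(\<lambda>x. x) \<in> measurable M (past n k)"
    by (rule past_measurable_imp[OF assms]) simp
  from measurable_sets[OF this A] have "A \<inter> space M \<in> sets M" by simp
  then show "A \<in> sets M"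
    using sets.sets_into_space[OF A] by (simp add: Int_absorb2)
qed

text \<open>The indicator is itself a function of the past and extends boundedness from the good set
  to the whole space. Products of this shape form the class on which expectations factor.\<close>

lemma restricted_bounded_past:
  fixes f :: "'w \<Rightarrow> real"
  assumes "n \<ge> 1" "step_size n < 1" "k \<le> n"
    and f: "f \<in> borel_measurable (past n k)" "bounded (f ` good n (Suc k))"
  shows "(\<lambda>\<omega>. indicator (good n (Suc k)) \<omega> * f \<omega>)
    \<in> {g \<in> borel_measurable (past n k). bounded (g ` space M)}"
proof safe
  show "(\<lambda>\<omega>. indicator (good n (Suc k)) \<omega> * f \<omega>) \<in> borel_measurable (past n k)"
    by (intro borel_measurable_times borel_measurable_indicator good_past_measurable assms)
  obtain c where c: "\<And>\<omega>. \<omega> \<in> good n (Suc k) \<Longrightarrow> \<bar>f \<omega>\<bar> \<le> c"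
    using f(2) by (auto simp: bounded_iff)
  have "\<bar>indicator (good n (Suc k)) \<omega> * f \<omega>\<bar> \<le> max 0 c" for \<omega>
    using c[of \<omega>] by (auto simp: indicator_def)
  then show "bounded ((\<lambda>\<omega>. indicator (good n (Suc k)) \<omega> * f \<omega>) ` space M)"
    by (auto simp: bounded_iff)
qed

text \<open>Only finiteness matters here, for integrability; the bounds may depend on
  \<open>n\<close>. Since the energy is at least 1, negative exponents are covered too.\<close>

lemma bounded_on_good:
  assumes "n \<ge> 1" "step_size n < 1" "k < n" "i \<in> {1..N}"
  shows "bounded ((\<lambda>\<omega>. energy n k \<omega> powr q) ` good n (Suc k))"
    and "bounded (X n k i ` good n (Suc k))"
    and "bounded (drift n k i ` good n (Suc k))"
    and "bounded (diffusion n k (i, r) ` good n (Suc k))"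
proof -
  let ?R = "step_size n powr (- 2 / G)"
  have h: "0 < step_size n" using assms T by simp
  have E: "energy n k \<omega> \<le> ?R" if "\<omega> \<in> good n (Suc k)" for \<omega>
    using that by (simp add: good_def)
  have "energy n k \<omega> powr q \<le> ?R powr \<bar>q\<bar>" if "\<omega> \<in> good n (Suc k)" for \<omega>
    using E[OF that] energy_ge_1 by (intro powr_nonneg_exponent_le) auto
  then show "bounded ((\<lambda>\<omega>. energy n k \<omega> powr q) ` good n (Suc k))"
    by (auto simp: bounded_iff)
  have "norm (X n k i \<omega>) \<le> sqrt ?R" if "\<omega> \<in> good n (Suc k)" for \<omega>
    using norm_X_squared_le[OF assms(4), of n k \<omega>] E[OF that] by (intro real_le_rsqrt) linarith
  then show "bounded (X n k i ` good n (Suc k))"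
    by (auto simp: bounded_iff)
  obtain L where L: "\<forall>x. \<forall>h\<in>{0<..<1}. norm (T1 x h) \<le> min (L * h powr (- 2)) (norm x) \<and>
      norm (T2 x h) \<le> min (L * h powr (- 3 / 2)) (norm x)"
    using H1 unfolding taming_bounds_def by blast
  have "step_size n \<in> {0<..<1}" using h assms(2) by simp
  with L have "norm (T1 x (step_size n)) \<le> L * step_size n powr (- 2)"
      "norm (T2 x (step_size n)) \<le> L * step_size n powr (- 3 / 2)" for x
    by (meson min.boundedE)+
  then show "bounded (drift n k i ` good n (Suc k))" "bounded (diffusion n k (i, r) ` good n (Suc k))"
    unfolding drift_def diffusion_def bounded_iff by auto
qed

end

section \<open>Growth of the energy moment over one step\<close>

lemma bounded_const_image: "bounded ((\<lambda>_. c :: real) ` S)"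
  by (auto simp: bounded_iff intro: exI[of _ "norm c"])

context tamed_particle_system
begin

text \<open>The pathwise expansion is multiplied by the indicator of the good set. All its
  coefficients become bounded functions of the past, the noise is integrated out, and what is left
  is exactly the expression bounded by coercivity.\<close>

lemma one_step:
  obtains C where "C \<ge> 0"
    "\<And>n k. n \<ge> 1 \<Longrightarrow> step_size n < 1 \<Longrightarrow> k < n \<Longrightarrow>
      (\<integral>\<^sup>+\<omega>. ennreal (indicator (good n (Suc k)) \<omega> * energy n (Suc k) \<omega> powr pbar) \<partial>M)
      \<le> ennreal (1 + C * step_size n) *
        (\<integral>\<^sup>+\<omega>. ennreal (indicator (good n (Suc k)) \<omega> * energy n k \<omega> powr pbar) \<partial>M)"
proof -
  define p where "p = pbar"
  have p: "1 \<le> p" "p \<le> p0" using pbar_ge_1 pbar(1) by (auto simp: p_def)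
  obtain c K where c: "c \<ge> 0" and K: "K \<ge> 0" and coeff:
    "\<And>h t x A B s. \<lbrakk>0 < h; h < 1; t \<in> {0..T}; A = 1 + (\<Sum>i=1..N. (norm (x i))\<^sup>2); A \<le> h powr (- 2 / G);
       B = (\<lambda>i. T1 (b t (x i) (empirical N x)) h);
       s = (\<lambda>(i, r). T2 (column r (\<sigma> t (x i) (empirical N x))) h)\<rbrakk> \<Longrightarrow>
      h\<^sup>2 * (\<Sum>i=1..N. (norm (B i))\<^sup>2) \<le> c\<^sup>2 * (h powr (1 / 3)) ^ 4 * A \<and>
      h * (\<Sum>j\<in>{1..N} \<times> UNIV. (norm (s j))\<^sup>2) \<le> c\<^sup>2 * (h powr (1 / 3))\<^sup>2 * A \<and>
      2 * (\<Sum>i=1..N. x i \<bullet> B i) + (2 * p - 1) * (\<Sum>j\<in>{1..N} \<times> UNIV. (norm (s j))\<^sup>2) \<le> K * A"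
    using tamed_coefficient_bounds[OF T p0 \<rho> N r1 r2 p A2 A6 A7 H1 H2 G] by blast
  obtain C1 :: real and m :: nat where C1: "C1 \<ge> 0" and taylor:
    "\<And>I (x :: nat \<Rightarrow> real ^ 'd) B (s :: nat \<times> 'm \<Rightarrow> real ^ 'd) D h A P Q Y.
      \<lbrakk>finite I; 0 < h; h < 1; A = 1 + (\<Sum>i\<in>I. (norm (x i))\<^sup>2);
        h\<^sup>2 * (\<Sum>i\<in>I. (norm (B i))\<^sup>2) \<le> c\<^sup>2 * (h powr (1 / 3)) ^ 4 * A;
        h * (\<Sum>j\<in>I \<times> UNIV. (norm (s j))\<^sup>2) \<le> c\<^sup>2 * (h powr (1 / 3))\<^sup>2 * A;
        P = (\<Sum>i\<in>I. x i \<bullet> (h *\<^sub>R B i));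
        Q = (\<Sum>i\<in>I. x i \<bullet> (\<Sum>r\<in>UNIV. D (i, r) *\<^sub>R s (i, r)));
        Y = (\<Sum>i\<in>I. (norm (\<Sum>r\<in>UNIV. D (i, r) *\<^sub>R s (i, r)))\<^sup>2)\<rbrakk> \<Longrightarrow>
      (1 + (\<Sum>i\<in>I. (norm (x i + h *\<^sub>R B i + (\<Sum>r\<in>UNIV. D (i, r) *\<^sub>R s (i, r))))\<^sup>2)) powr p
        \<le> A powr p * (1 + p * (2 * P + 2 * Q + Y) / A + 2 * p * (p - 1) * Q\<^sup>2 / A\<^sup>2
            + C1 * h * (1 + (\<Sum>j\<in>I \<times> UNIV. \<bar>D j\<bar> / sqrt h)) ^ m)"
    using powr_step_bound[OF p(1) c, where 'i = nat and 'a = "real ^ 'd" and 'r = 'm] by blast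
  obtain K2 where K2: "K2 \<ge> 0" and weight: "\<And>n k. n \<ge> 1 \<Longrightarrow> k < n \<Longrightarrow>
      integrable M (noise_weight m n k) \<and> expectation (noise_weight m n k) \<le> K2"
    using noise_weight_moment[of m] by blast
  \<comment> \<open>\<open>p * K\<close> is the contribution of coercivity, \<open>C1 * K2\<close>
    that of the mean Taylor remainder.\<close>
  define C where "C = p * K + C1 * K2"
  have "C \<ge> 0" using p K C1 K2 by (simp add: C_def)
  show ?thesis
  proof (rule that[OF \<open>C \<ge> 0\<close>])
    fix n k :: nat
    assume n: "n \<ge> 1" "step_size n < 1" "k < n"
    define h where "h = step_size n"
    have h: "0 < h" "h < 1" using n T by (auto simp: h_def)
    define S where "S = good n (Suc k)"
    define J where "J = {1..N} \<times> (UNIV :: 'm set)"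
    define \<iota> :: "'w \<Rightarrow> real" where "\<iota> = indicator S"
    define A where "A = energy n k"
    define s where "s = diffusion n k"
    define D where "D = increment n k"
    define R where "R = noise_weight m n k"
    define q where "q j \<omega> = X n k (fst j) \<omega> \<bullet> s j \<omega>" for j \<omega>
    define xB where "xB \<omega> = (\<Sum>i=1..N. X n k i \<omega> \<bullet> drift n k i \<omega>)" for \<omega>
    define ss where "ss j j' \<omega> = (if fst j = fst j' then s j \<omega> \<bullet> s j' \<omega> else 0)" for j j' \<omega>
    define \<G> :: "('w \<Rightarrow> real) set" where "\<G> = {g \<in> borel_measurable (past n k). bounded (g ` space M)}"
    \<comment> \<open>The expansion multiplied out and sorted by degree in the increments:
      \<open>g0\<close>, \<open>gl\<close>, \<open>gq\<close> belong to degree 0, 1, 2 and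
      \<open>gr\<close> to the remainder weight. Divisions by \<open>A\<close> and its square are
      absorbed into the exponents \<open>p - 1\<close> and \<open>p - 2\<close>.\<close>
    define g0 where "g0 \<omega> = \<iota> \<omega> * (A \<omega> powr p + 2 * p * h * (A \<omega> powr (p - 1) * xB \<omega>))" for \<omega>
    define gl where "gl j \<omega> = \<iota> \<omega> * (2 * p * (A \<omega> powr (p - 1) * q j \<omega>))" for j \<omega>
    define gq where "gq j j' \<omega> = \<iota> \<omega> * (p * (A \<omega> powr (p - 1) * ss j j' \<omega>)
      + 2 * p * (p - 1) * (A \<omega> powr (p - 2) * (q j \<omega> * q j' \<omega>)))" for j j' \<omega>
    define gr where "gr \<omega> = \<iota> \<omega> * (C1 * h * A \<omega> powr p)" for \<omega>
    define H where "H \<omega> = g0 \<omega> + (\<Sum>j\<in>J. gl j \<omega> * D j \<omega>)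
      + (\<Sum>j\<in>J. \<Sum>j'\<in>J. gq j j' \<omega> * (D j \<omega> * D j' \<omega>)) + gr \<omega> * R \<omega>" for \<omega>
    define H' where "H' \<omega> = g0 \<omega> + h * (\<Sum>j\<in>J. gq j j \<omega>) + expectation R * gr \<omega>" for \<omega>
    have k: "k \<le> n" using n by simp
    have J: "finite J" by (simp add: J_def)
    have A1: "1 \<le> A \<omega>" for \<omega> unfolding A_def by (rule energy_ge_1)
    have bounds: "bounded ((\<lambda>\<omega>. A \<omega> powr e) ` S)" "i \<in> {1..N} \<Longrightarrow> bounded (X n k i ` S)"
      "i \<in> {1..N} \<Longrightarrow> bounded (drift n k i ` S)" "j \<in> J \<Longrightarrow> bounded (s j ` S)" for e i j
      using bounded_on_good(1)[OF n, of 1 e] bounded_on_good(2,3)[OF n, of i]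
        bounded_on_good(4)[OF n, of "fst j" "snd j"] N
      unfolding A_def S_def s_def J_def by (auto simp: mem_Times_iff)
    have meas: "A \<in> borel_measurable (past n k)"
      and X_meas: "\<And>i. i \<in> {1..N} \<Longrightarrow> X n k i \<in> borel_measurable (past n k)"
      unfolding A_def
      using energy_past_measurable[OF n(1,2) k order.refl] X_past_measurable[OF n(1,2) k order.refl] by auto
    have coeff_meas: "\<And>i. i \<in> {1..N} \<Longrightarrow> drift n k i \<in> borel_measurable (past n k)"
      "\<And>j. j \<in> J \<Longrightarrow> s j \<in> borel_measurable (past n k)"
      using coefficients_measurable(1)[OF n(1,2) k _ X_meas]
        coefficients_measurable(2)[OF n(1,2) k _ X_meas, of "fst j" "snd j" for j]
      unfolding J_def s_def by (auto simp: mem_Times_iff)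
    have powr_meas: "(\<lambda>\<omega>. A \<omega> powr e) \<in> borel_measurable (past n k)" for e
      using meas by (intro powr_real_measurable borel_measurable_const)
    have q: "q j \<in> borel_measurable (past n k)" "bounded (q j ` S)" if "j \<in> J" for j
      using that X_meas[of "fst j"] coeff_meas(2)[of j] bounds(2)[of "fst j"] bounds(4)[of j]
      unfolding q_def[abs_def] J_def by (auto intro!: borel_measurable_inner bounded_inner_comp)
    have xB: "xB \<in> borel_measurable (past n k)" "bounded (xB ` S)"
      unfolding xB_def[abs_def] using X_meas coeff_meas(1) bounds
      by (auto intro!: borel_measurable_sum borel_measurable_inner bounded_sum_comp bounded_inner_comp)
    have ss: "ss j j' \<in> borel_measurable (past n k)" "bounded (ss j j' ` S)" if "j \<in> J" "j' \<in> J" for j j'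
      unfolding ss_def[abs_def] using coeff_meas(2)[OF that(1)] coeff_meas(2)[OF that(2)] bounds(4) that
      by (cases "fst j = fst j'";
          auto intro!: borel_measurable_inner bounded_inner_comp bounded_const_image)+
    have \<G>I: "(\<lambda>\<omega>. \<iota> \<omega> * f \<omega>) \<in> \<G>" if "f \<in> borel_measurable (past n k)" "bounded (f ` S)" for f
      using restricted_bounded_past[OF n(1,2) k, of f] that unfolding \<G>_def \<iota>_def S_def by blast
    note Bd = bounded_plus_comp bounded_mult_comp bounded_const_image
    note Ms = borel_measurable_add borel_measurable_times borel_measurable_const
    have g: "g0 \<in> \<G>" "\<And>j. j \<in> J \<Longrightarrow> gl j \<in> \<G>" "\<And>j j'. j \<in> J \<Longrightarrow> j' \<in> J \<Longrightarrow> gq j j' \<in> \<G>" "gr \<in> \<G>"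
      unfolding g0_def[abs_def] gl_def[abs_def] gq_def[abs_def] gr_def[abs_def]
      by (rule \<G>I; (rule Ms Bd q xB ss powr_meas bounds(1) | assumption)+)+
    have \<G>_int: "integrable M f" if f: "f \<in> \<G>" for f
    proof -
      obtain a where "\<forall>\<omega>\<in>space M. \<bar>f \<omega>\<bar> \<le> a"
        using f by (auto simp: \<G>_def bounded_iff)
      moreover have "f \<in> borel_measurable M"
        using that past_measurable_imp[OF n(1) k] by (auto simp: \<G>_def)
      ultimately show ?thesis
        by (intro integrable_const_bound[of f a]) auto
    qed
    have D_future: "D j \<in> borel_measurable (future n k)" if "j \<in> J" for j
      using increment_future_measurable[OF n(1,3), of "fst j" "snd j"] that by (auto simp: D_def J_def mem_Times_iff)
    have R_future: "R \<in> borel_measurable (future n k)"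
      using D_future unfolding R_def noise_weight_def[abs_def] D_def J_def
      by (intro borel_measurable_power borel_measurable_add borel_measurable_const borel_measurable_sum
          borel_measurable_divide borel_measurable_abs) auto
    have ind: "indep_var borel f borel \<phi>" if "f \<in> \<G>" "\<phi> \<in> borel_measurable (future n k)" for f and \<phi> :: "'w \<Rightarrow> real"
      using that by (intro indep_past_future[OF n(1,3)]) (auto simp: \<G>_def)
    have moments: "\<And>j. j \<in> J \<Longrightarrow> integrable M (D j)" "\<And>j. j \<in> J \<Longrightarrow> expectation (D j) = 0"
      "\<And>j j'. j \<in> J \<Longrightarrow> j' \<in> J \<Longrightarrow> integrable M (\<lambda>\<omega>. D j \<omega> * D j' \<omega>)"
      "\<And>j j'. j \<in> J \<Longrightarrow> j' \<in> J \<Longrightarrow> expectation (\<lambda>\<omega>. D j \<omega> * D j' \<omega>) = (if j = j' then h else 0)"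
      unfolding D_def J_def h_def by (rule increment_moments[OF n(1,3)]; assumption)+
    have R: "integrable M R" "expectation R \<le> K2"
      using weight[OF n(1,3)] by (auto simp: R_def)
    have quad: "integrable M H" "integrable M H'" "expectation H = expectation H'"
      unfolding H_def[abs_def] H'_def[abs_def]
      by (rule expectation_quadratic_form[OF J, where \<G> = \<G> and D = D and R = R];
          (rule \<G>_int ind D_future R_future borel_measurable_times moments R(1) g | assumption)+)+
    have A_eq: "A \<omega> = 1 + (\<Sum>i=1..N. (norm (X n k i \<omega>))\<^sup>2)" for \<omega>
      by (simp add: A_def energy_def)
    have cf: "h\<^sup>2 * (\<Sum>i=1..N. (norm (drift n k i \<omega>))\<^sup>2) \<le> c\<^sup>2 * (h powr (1 / 3)) ^ 4 * A \<omega>"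
      "h * (\<Sum>j\<in>{1..N} \<times> UNIV. (norm (s j \<omega>))\<^sup>2) \<le> c\<^sup>2 * (h powr (1 / 3))\<^sup>2 * A \<omega>"
      "2 * xB \<omega> + (2 * p - 1) * (\<Sum>j\<in>{1..N} \<times> UNIV. (norm (s j \<omega>))\<^sup>2) \<le> K * A \<omega>"
      if "\<omega> \<in> S" for \<omega>
    proof -
      have "A \<omega> \<le> h powr (- 2 / G)"
        using that by (simp add: S_def good_def A_def h_def)
      moreover have "real k * h \<in> {0..T}"
        unfolding h_def by (rule grid[OF n(1) k])
      ultimately show "h\<^sup>2 * (\<Sum>i=1..N. (norm (drift n k i \<omega>))\<^sup>2) \<le> c\<^sup>2 * (h powr (1 / 3)) ^ 4 * A \<omega>"
        "h * (\<Sum>j\<in>{1..N} \<times> UNIV. (norm (s j \<omega>))\<^sup>2) \<le> c\<^sup>2 * (h powr (1 / 3))\<^sup>2 * A \<omega>"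
        "2 * xB \<omega> + (2 * p - 1) * (\<Sum>j\<in>{1..N} \<times> UNIV. (norm (s j \<omega>))\<^sup>2) \<le> K * A \<omega>"
        using coeff[OF h _ A_eq, of "real k * h" \<omega> "\<lambda>i. drift n k i \<omega>" "\<lambda>j. s j \<omega>"]
        by (auto simp: drift_def s_def diffusion_def h_def fun_eq_iff xB_def)
    qed
    have step: "\<iota> \<omega> * energy n (Suc k) \<omega> powr p \<le> H \<omega>" for \<omega>
    proof (cases "\<omega> \<in> S")
      case False
      then show ?thesis
        by (simp add: H_def g0_def gl_def gq_def gr_def \<iota>_def)
    next
      case True
      define Q where "Q = (\<Sum>j\<in>J. q j \<omega> * D j \<omega>)"
      define Y where "Y = (\<Sum>j\<in>J. \<Sum>j'\<in>J. ss j j' \<omega> * (D j \<omega> * D j' \<omega>))"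
      have P: "h * xB \<omega> = (\<Sum>i=1..N. X n k i \<omega> \<bullet> (h *\<^sub>R drift n k i \<omega>))"
        by (simp add: xB_def sum_distrib_left)
      have Q: "Q = (\<Sum>i=1..N. X n k i \<omega> \<bullet> (\<Sum>r\<in>UNIV. D (i, r) \<omega> *\<^sub>R s (i, r) \<omega>))"
        unfolding Q_def q_def J_def
        by (rule sum_inner_eq_linear[symmetric, where x = "\<lambda>i. X n k i \<omega>" and D = "\<lambda>j. D j \<omega>"
              and s = "\<lambda>j. s j \<omega>"])
      have Y: "Y = (\<Sum>i=1..N. (norm (\<Sum>r\<in>UNIV. D (i, r) \<omega> *\<^sub>R s (i, r) \<omega>))\<^sup>2)"
        unfolding Y_def ss_def J_def
        by (rule norm_sum_squared_eq_quadratic[symmetric, where D = "\<lambda>j. D j \<omega>" and s = "\<lambda>j. s j \<omega>"]) simp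
      have QQ: "Q\<^sup>2 = (\<Sum>j\<in>J. \<Sum>j'\<in>J. (q j \<omega> * q j' \<omega>) * (D j \<omega> * D j' \<omega>))"
        unfolding Q_def power2_eq_square sum_product by (intro sum.cong refl) (simp only: mult_ac)
      have e: "energy n (Suc k) \<omega> = 1 + (\<Sum>i=1..N. (norm (X n k i \<omega> + h *\<^sub>R drift n k i \<omega>
          + (\<Sum>r\<in>UNIV. D (i, r) \<omega> *\<^sub>R s (i, r) \<omega>)))\<^sup>2)"
        unfolding energy_def X_Suc D_def s_def h_def ..
      have "energy n (Suc k) \<omega> powr p
        \<le> A \<omega> powr p * (1 + p * (2 * (h * xB \<omega>) + 2 * Q + Y) / A \<omega> + 2 * p * (p - 1) * Q\<^sup>2 / (A \<omega>)\<^sup>2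
            + C1 * h * (1 + (\<Sum>j\<in>{1..N} \<times> UNIV. \<bar>D j \<omega>\<bar> / sqrt h)) ^ m)"
        unfolding e by (rule taylor[OF _ h A_eq cf(1,2)[OF True] P Q Y]) simp
      also have "(1 + (\<Sum>j\<in>{1..N} \<times> UNIV. \<bar>D j \<omega>\<bar> / sqrt h)) ^ m = R \<omega>"
        unfolding R_def noise_weight_def D_def h_def ..
      also have "A \<omega> powr p * (1 + p * (2 * (h * xB \<omega>) + 2 * Q + Y) / A \<omega> + 2 * p * (p - 1) * Q\<^sup>2 / (A \<omega>)\<^sup>2
            + C1 * h * R \<omega>)
        = A \<omega> powr p + p * A \<omega> powr (p - 1) * (2 * (h * xB \<omega>) + 2 * Q + Y)
          + 2 * p * (p - 1) * A \<omega> powr (p - 2) * Q\<^sup>2 + C1 * h * A \<omega> powr p * R \<omega>"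
      proof -
        have "A \<omega> powr (p - 1) = A \<omega> powr p / A \<omega>" "A \<omega> powr (p - 2) = A \<omega> powr p / (A \<omega>)\<^sup>2"
          using A1[of \<omega>] by (simp_all add: powr_diff powr_numeral)
        then show ?thesis by (simp add: algebra_simps add_divide_distrib diff_divide_distrib)
      qed
      also have "\<dots> = H \<omega>"
      proof -
        have 1: "(\<Sum>j\<in>J. gl j \<omega> * D j \<omega>) = 2 * p * A \<omega> powr (p - 1) * Q"
          unfolding Q_def gl_def sum_distrib_left using True by (intro sum.cong) (auto simp: \<iota>_def mult_ac)
        have 2: "(\<Sum>j\<in>J. \<Sum>j'\<in>J. gq j j' \<omega> * (D j \<omega> * D j' \<omega>))
          = p * A \<omega> powr (p - 1) * Y + 2 * p * (p - 1) * A \<omega> powr (p - 2) * Q\<^sup>2"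
          unfolding Y_def QQ gq_def sum_distrib_left sum.distrib[symmetric] using True
          by (intro sum.cong refl) (simp add: \<iota>_def ring_distribs mult_ac)
        show ?thesis
          unfolding H_def 1 2 using True by (simp add: g0_def gr_def \<iota>_def algebra_simps)
      qed
      finally show ?thesis using True by (simp add: \<iota>_def)
    qed
    \<comment> \<open>By Cauchy-Schwarz \<open>(q j)\<^sup>2\<close> is at most \<open>A\<close>
      times the squared norm of \<open>s j\<close>, so the contribution of \<open>Q\<^sup>2\<close>
      merges with that of the noise energy. The factors add up to
      \<open>p + 2 * p * (p - 1) = p * (2 * p - 1)\<close>, which explains the constant
      \<open>2 * p - 1\<close> in coercivity.\<close>
    have mean: "H' \<omega> \<le> (1 + C * h) * (\<iota> \<omega> * A \<omega> powr p)" for \<omega>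
    proof (cases "\<omega> \<in> S")
      case False
      then show ?thesis
        by (simp add: H'_def g0_def gq_def gr_def \<iota>_def)
    next
      case True
      define Ap where "Ap = A \<omega> powr p"
      define Ap1 where "Ap1 = A \<omega> powr (p - 1)"
      define Ap2 where "Ap2 = A \<omega> powr (p - 2)"
      have pows: "Ap1 * A \<omega> = Ap" "Ap2 * A \<omega> = Ap1"
        using A1[of \<omega>] by (simp_all add: Ap_def Ap1_def Ap2_def powr_diff powr_numeral power2_eq_square)
      have pos: "Ap \<ge> 0" "Ap1 \<ge> 0" "Ap2 \<ge> 0" by (simp_all add: Ap_def Ap1_def Ap2_def)
      define ns where "ns = (\<Sum>j\<in>J. (norm (s j \<omega>))\<^sup>2)"
      have cf: "2 * xB \<omega> + (2 * p - 1) * ns \<le> K * A \<omega>"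
        using cf(3)[OF True] by (simp add: ns_def J_def)
      have "(\<Sum>j\<in>J. gq j j \<omega>) \<le> (\<Sum>j\<in>J. p * (Ap1 * (norm (s j \<omega>))\<^sup>2) + 2 * p * (p - 1) * (Ap1 * (norm (s j \<omega>))\<^sup>2))"
      proof (intro sum_mono)
        fix j assume j: "j \<in> J"
        have "(q j \<omega>)\<^sup>2 \<le> (norm (X n k (fst j) \<omega>) * norm (s j \<omega>))\<^sup>2"
          unfolding q_def by (rule abs_le_square_iff[THEN iffD1]) (simp add: Cauchy_Schwarz_ineq2)
        also have "\<dots> = (norm (X n k (fst j) \<omega>))\<^sup>2 * (norm (s j \<omega>))\<^sup>2"
          by (simp add: power_mult_distrib)
        also have "\<dots> \<le> A \<omega> * (norm (s j \<omega>))\<^sup>2"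
          unfolding A_def using j by (intro mult_right_mono norm_X_squared_le) (auto simp: J_def)
        finally have "Ap2 * (q j \<omega>)\<^sup>2 \<le> Ap2 * (A \<omega> * (norm (s j \<omega>))\<^sup>2)"
          using pos by (intro mult_left_mono)
        also have "\<dots> = Ap1 * (norm (s j \<omega>))\<^sup>2" by (simp only: mult.assoc[symmetric] pows)
        finally have "2 * p * (p - 1) * (Ap2 * (q j \<omega>)\<^sup>2) \<le> 2 * p * (p - 1) * (Ap1 * (norm (s j \<omega>))\<^sup>2)"
          using p by (intro mult_left_mono) auto
        moreover have "gq j j \<omega> = p * (Ap1 * (norm (s j \<omega>))\<^sup>2) + 2 * p * (p - 1) * (Ap2 * (q j \<omega>)\<^sup>2)"
          using True by (simp add: gq_def ss_def \<iota>_def Ap1_def Ap2_def power2_norm_eq_inner power2_eq_square[of "q j \<omega>"])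
        ultimately show "gq j j \<omega> \<le> p * (Ap1 * (norm (s j \<omega>))\<^sup>2) + 2 * p * (p - 1) * (Ap1 * (norm (s j \<omega>))\<^sup>2)"
          by simp
      qed
      also have "\<dots> = p * Ap1 * ((2 * p - 1) * ns)"
        by (simp add: ns_def sum_distrib_left algebra_simps sum.distrib sum_subtractf)
      finally have gq_le: "h * (\<Sum>j\<in>J. gq j j \<omega>) \<le> h * (p * Ap1 * ((2 * p - 1) * ns))"
        using h by (intro mult_left_mono) auto
      have "expectation R * gr \<omega> \<le> K2 * (C1 * h * Ap)"
        using True R(2) C1 h pos by (simp add: gr_def \<iota>_def Ap_def mult_right_mono)
      then have "H' \<omega> \<le> (Ap + 2 * p * h * (Ap1 * xB \<omega>)) + h * (p * Ap1 * ((2 * p - 1) * ns)) + K2 * (C1 * h * Ap)"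
        using gq_le True by (simp add: H'_def g0_def \<iota>_def Ap_def Ap1_def)
      also have "\<dots> = Ap + h * p * Ap1 * (2 * xB \<omega> + (2 * p - 1) * ns) + K2 * (C1 * h * Ap)"
        by (simp add: algebra_simps)
      also have "\<dots> \<le> Ap + h * p * Ap1 * (K * A \<omega>) + K2 * (C1 * h * Ap)"
        using h p pos by (intro add_mono order.refl mult_left_mono cf) auto
      also have "h * p * Ap1 * (K * A \<omega>) = h * p * K * (Ap1 * A \<omega>)" by (simp only: mult_ac)
      also have "Ap + h * p * K * (Ap1 * A \<omega>) + K2 * (C1 * h * Ap) = (1 + C * h) * Ap"
        unfolding pows C_def by (simp add: algebra_simps)
      finally show ?thesis using True by (simp add: Ap_def \<iota>_def)
    qed
    have base: "(\<lambda>\<omega>. \<iota> \<omega> * A \<omega> powr p) \<in> \<G>"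
      by (intro \<G>I powr_meas bounds)
    have \<iota>0: "0 \<le> \<iota> \<omega>" for \<omega> by (simp add: \<iota>_def)
    have H0: "0 \<le> H \<omega>" for \<omega>
      using order.trans[OF _ step[of \<omega>], of 0] \<iota>0[of \<omega>] by simp
    have "(\<integral>\<^sup>+\<omega>. ennreal (\<iota> \<omega> * energy n (Suc k) \<omega> powr p) \<partial>M) \<le> (\<integral>\<^sup>+\<omega>. ennreal (H \<omega>) \<partial>M)"
      by (intro nn_integral_mono ennreal_leI step)
    also have "\<dots> = ennreal (expectation H)"
      by (intro nn_integral_eq_integral quad) (simp add: H0)
    also have "expectation H \<le> expectation (\<lambda>\<omega>. (1 + C * h) * (\<iota> \<omega> * A \<omega> powr p))"
      unfolding quad(3) by (intro integral_mono quad integrable_mult_right \<G>_int base mean)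
    also have "\<dots> = (1 + C * h) * expectation (\<lambda>\<omega>. \<iota> \<omega> * A \<omega> powr p)"
      by simp
    also have "ennreal \<dots> = ennreal (1 + C * h) * ennreal (expectation (\<lambda>\<omega>. \<iota> \<omega> * A \<omega> powr p))"
      using \<open>C \<ge> 0\<close> h by (intro ennreal_mult) (auto intro!: Bochner_Integration.integral_nonneg simp: \<iota>0)
    also have "ennreal (expectation (\<lambda>\<omega>. \<iota> \<omega> * A \<omega> powr p)) = (\<integral>\<^sup>+\<omega>. ennreal (\<iota> \<omega> * A \<omega> powr p) \<partial>M)"
      using \<G>_int[OF base] by (intro nn_integral_eq_integral[symmetric]) (auto simp: \<iota>0)
    finally show "(\<integral>\<^sup>+\<omega>. ennreal (indicator (good n (Suc k)) \<omega> * energy n (Suc k) \<omega> powr pbar) \<partial>M)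
      \<le> ennreal (1 + C * step_size n) *
        (\<integral>\<^sup>+\<omega>. ennreal (indicator (good n (Suc k)) \<omega> * energy n k \<omega> powr pbar) \<partial>M)"
      by (simp add: ennreal_leI \<iota>_def S_def p_def h_def A_def)
  qed
qed

end

section \<open>Moments on the good set\<close>

text \<open>Jensen's inequality for the uniform average; an even power is convex on the whole real
  line.\<close>

lemma even_power_mean_le:
  fixes w :: "nat \<Rightarrow> real"
  assumes "n \<ge> 1" "even m"
  shows "((\<Sum>l<n. w l) / n) ^ m \<le> (\<Sum>l<n. w l ^ m) / n"
proof -
  have "(\<Sum>l<n. (1 / n) *\<^sub>R w l) ^ m \<le> (\<Sum>l<n. (1 / n) * w l ^ m)"
    by (rule convex_on_sum[OF _ _ convex_power_even[OF assms(2)]]) (use assms(1) in \<open>auto simp: lessThan_empty_iff\<close>)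
  then show ?thesis by (simp add: sum_divide_distrib)
qed

context tamed_particle_system
begin

text \<open>Projecting the joint laws to the second component shows that each initial value has the
  law of \<open>X0\<close>; lower orders are compared with order \<open>2 * p0\<close> by
  distinguishing norms below and above 1.\<close>

lemma initial_moment:
  assumes "i \<in> {1..N}" "0 \<le> q" "q \<le> 2 * p0"
  shows "(\<integral>\<^sup>+\<omega>. ennreal (norm (X0' i \<omega>) powr q) \<partial>M) \<le> ennreal (1 + expectation (\<lambda>\<omega>. norm (X0 \<omega>) powr (2 * p0)))"
    and "X0' i \<in> borel_measurable M"
proof -
  show X0': "X0' i \<in> borel_measurable M"
    using past_measurable_imp[of 1 0, OF _ _ initial_past_measurable] assms(1) by simp
  have joint: "(\<lambda>\<omega>. (path T V \<omega>, Y \<omega>)) \<in> measurable M (path_space T \<Otimes>\<^sub>M borel)"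
    if "brownian_motion M T V" "Y \<in> borel_measurable M"
    for V :: "real \<Rightarrow> 'w \<Rightarrow> real ^ 'm" and Y :: "'w \<Rightarrow> real ^ 'd"
    using that unfolding brownian_motion_def by (intro measurable_Pair measurable_restrict) auto
  have bm: "brownian_motion M T (W' i)"
    and law: "distr M (path_space T \<Otimes>\<^sub>M borel) (\<lambda>\<omega>. (path T (W' i) \<omega>, X0' i \<omega>)) =
        distr M (path_space T \<Otimes>\<^sub>M borel) (\<lambda>\<omega>. (path T W \<omega>, X0 \<omega>))"
    using copies assms(1) unfolding indep_copies_def by auto
  have "distr (distr M (path_space T \<Otimes>\<^sub>M borel) (\<lambda>\<omega>. (path T (W' i) \<omega>, X0' i \<omega>))) borel snd = distr M borel (X0' i)"
    by (subst distr_distr[OF _ joint[OF bm X0']]) (auto simp: comp_def)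
  moreover have "distr (distr M (path_space T \<Otimes>\<^sub>M borel) (\<lambda>\<omega>. (path T W \<omega>, X0 \<omega>))) borel snd = distr M borel X0"
    by (subst distr_distr[OF _ joint[OF BM X0]]) (auto simp: comp_def)
  ultimately have law': "distr M borel (X0' i) = distr M borel X0"
    using law by simp
  have "(\<integral>\<^sup>+\<omega>. ennreal (norm (X0' i \<omega>) powr q) \<partial>M) = (\<integral>\<^sup>+x. ennreal (norm x powr q) \<partial>distr M borel (X0' i))"
    using X0' by (subst nn_integral_distr) auto
  also have "\<dots> = (\<integral>\<^sup>+\<omega>. ennreal (norm (X0 \<omega>) powr q) \<partial>M)"
    unfolding law' using X0 by (subst nn_integral_distr) auto
  also have "\<dots> \<le> (\<integral>\<^sup>+\<omega>. ennreal (1 + norm (X0 \<omega>) powr (2 * p0)) \<partial>M)"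
  proof (intro nn_integral_mono ennreal_leI)
    fix \<omega>
    show "norm (X0 \<omega>) powr q \<le> 1 + norm (X0 \<omega>) powr (2 * p0)"
    proof (cases "norm (X0 \<omega>) \<le> 1")
      case True
      then have "norm (X0 \<omega>) powr q \<le> 1 powr q" using assms(2) by (intro powr_mono2) auto
      then show ?thesis by (simp add: add_increasing2)
    next
      case False
      then have "norm (X0 \<omega>) powr q \<le> norm (X0 \<omega>) powr (2 * p0)" using assms(3) by (intro powr_mono) auto
      then show ?thesis by simp
    qed
  qed
  also have "\<dots> = ennreal (expectation (\<lambda>\<omega>. 1 + norm (X0 \<omega>) powr (2 * p0)))"
    using A1 by (intro nn_integral_eq_integral) (auto intro: add_nonneg_nonneg)
  also have "expectation (\<lambda>\<omega>. 1 + norm (X0 \<omega>) powr (2 * p0)) = 1 + expectation (\<lambda>\<omega>. norm (X0 \<omega>) powr (2 * p0))"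
    using A1 by (simp add: prob_space)
  finally show "(\<integral>\<^sup>+\<omega>. ennreal (norm (X0' i \<omega>) powr q) \<partial>M) \<le> ennreal (1 + expectation (\<lambda>\<omega>. norm (X0 \<omega>) powr (2 * p0)))" .
qed

lemma energy_measurable:
  assumes "n \<ge> 1" "step_size n < 1" "k \<le> n"
  shows "energy n k \<in> borel_measurable M"
  by (rule past_measurable_imp[OF assms(1,3) energy_past_measurable[OF assms order.refl]])

lemma good_measurable:
  assumes "n \<ge> 1" "step_size n < 1" "k \<le> n"
  shows "good n k \<in> sets M"
proof (cases k)
  case 0
  then have "good n k = space M" by (auto simp: good_def)
  then show ?thesis by simp
next
  case (Suc l)
  then show ?thesis
    using good_past_measurable[OF assms(1,2), of l] past_sets_subset[OF assms(1), of l] assms(3) by auto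
qed

lemma good_Suc_subset: "good n (Suc k) \<subseteq> good n k"
  by (auto simp: good_def)

text \<open>A discrete Gronwall argument. The good sets decrease in \<open>k\<close>, so
  \<open>good n (Suc k)\<close> on the right of \<open>one_step\<close> may be replaced by
  \<open>good n k\<close>, and the factors multiply to at most \<open>exp (C * T)\<close>. The
  initial moment is finite because \<open>pbar \<le> p0\<close>.\<close>

lemma good_moment:
  obtains C where "C < \<infinity>"
    "\<And>n k. n \<ge> 1 \<Longrightarrow> step_size n < 1 \<Longrightarrow> k \<le> n \<Longrightarrow>
      (\<integral>\<^sup>+\<omega>. ennreal (indicator (good n k) \<omega> * energy n k \<omega> powr pbar) \<partial>M) \<le> C"
proof -
  obtain C where C: "C \<ge> 0" and step: "\<And>n k. n \<ge> 1 \<Longrightarrow> step_size n < 1 \<Longrightarrow> k < n \<Longrightarrow>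
      (\<integral>\<^sup>+\<omega>. ennreal (indicator (good n (Suc k)) \<omega> * energy n (Suc k) \<omega> powr pbar) \<partial>M)
      \<le> ennreal (1 + C * step_size n) *
        (\<integral>\<^sup>+\<omega>. ennreal (indicator (good n (Suc k)) \<omega> * energy n k \<omega> powr pbar) \<partial>M)"
    by (rule one_step) blast
  define U where "U = (\<integral>\<^sup>+\<omega>. ennreal ((1 + (\<Sum>i=1..N. (norm (X0' i \<omega>))\<^sup>2)) powr pbar) \<partial>M)"
  have X0'_meas: "X0' i \<in> borel_measurable M" if "i \<in> {1..N}" for i
    using initial_moment(2)[OF that, of 0] p0 by simp
  have U: "U < \<infinity>"
  proof -
    define e where "e = ennreal (1 + expectation (\<lambda>\<omega>. norm (X0 \<omega>) powr (2 * p0)))"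
    have "U \<le> (\<integral>\<^sup>+\<omega>. ennreal (real (1 + card {1..N}) powr pbar) * (1 + (\<Sum>i=1..N. ennreal (norm (X0' i \<omega>) powr (2 * pbar)))) \<partial>M)"
      unfolding U_def
    proof (intro nn_integral_mono)
      fix \<omega>
      have "(1 + (\<Sum>i=1..N. (norm (X0' i \<omega>))\<^sup>2)) powr pbar
        \<le> real (1 + card {1..N}) powr pbar * (1 + (\<Sum>i=1..N. ((norm (X0' i \<omega>))\<^sup>2) powr pbar))"
        using pbar_ge_1 by (intro one_plus_sum_powr_le) auto
      also have "(\<Sum>i=1..N. ((norm (X0' i \<omega>))\<^sup>2) powr pbar) = (\<Sum>i=1..N. norm (X0' i \<omega>) powr (2 * pbar))"
        by (intro sum.cong refl) (simp add: powr_powr flip: powr_numeral)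
      finally show "ennreal ((1 + (\<Sum>i=1..N. (norm (X0' i \<omega>))\<^sup>2)) powr pbar)
        \<le> ennreal (real (1 + card {1..N}) powr pbar) * (1 + (\<Sum>i=1..N. ennreal (norm (X0' i \<omega>) powr (2 * pbar))))"
        by (subst sum_ennreal) (auto simp: sum_nonneg ennreal_leI simp flip: ennreal_1 ennreal_plus ennreal_mult)
    qed
    also have "\<dots> = ennreal (real (1 + card {1..N}) powr pbar) *
        (1 + (\<Sum>i=1..N. \<integral>\<^sup>+\<omega>. ennreal (norm (X0' i \<omega>) powr (2 * pbar)) \<partial>M))"
    proof -
      have meas: "(\<lambda>\<omega>. ennreal (norm (X0' i \<omega>) powr (2 * pbar))) \<in> borel_measurable M" if "i \<in> {1..N}" for i
        using X0'_meas[OF that] by measurable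
      then have sum_meas: "(\<lambda>\<omega>. \<Sum>i=1..N. ennreal (norm (X0' i \<omega>) powr (2 * pbar))) \<in> borel_measurable M"
        by (rule borel_measurable_sum)
      have "(\<integral>\<^sup>+\<omega>. 1 + (\<Sum>i=1..N. ennreal (norm (X0' i \<omega>) powr (2 * pbar))) \<partial>M)
        = (\<integral>\<^sup>+\<omega>. 1 \<partial>M) + (\<integral>\<^sup>+\<omega>. (\<Sum>i=1..N. ennreal (norm (X0' i \<omega>) powr (2 * pbar))) \<partial>M)"
        by (intro nn_integral_add sum_meas borel_measurable_const)
      also have "(\<integral>\<^sup>+\<omega>. (\<Sum>i=1..N. ennreal (norm (X0' i \<omega>) powr (2 * pbar))) \<partial>M)
        = (\<Sum>i=1..N. \<integral>\<^sup>+\<omega>. ennreal (norm (X0' i \<omega>) powr (2 * pbar)) \<partial>M)"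
        by (rule nn_integral_sum[OF meas])
      finally have "(\<integral>\<^sup>+\<omega>. 1 + (\<Sum>i=1..N. ennreal (norm (X0' i \<omega>) powr (2 * pbar))) \<partial>M)
        = 1 + (\<Sum>i=1..N. \<integral>\<^sup>+\<omega>. ennreal (norm (X0' i \<omega>) powr (2 * pbar)) \<partial>M)"
        by (simp add: emeasure_space_1)
      then show ?thesis
        using sum_meas by (subst nn_integral_cmult) (auto intro: borel_measurable_add)
    qed
    also have "\<dots> \<le> ennreal (real (1 + card {1..N}) powr pbar) * (1 + (\<Sum>i=1..N. e))"
      unfolding e_def using pbar pbar_ge_1
      by (intro mult_left_mono add_left_mono sum_mono initial_moment(1)) auto
    also have "\<dots> < \<infinity>"
      unfolding e_def by (simp add: ennreal_mult_less_top of_nat_less_top)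
    finally show ?thesis .
  qed
  show ?thesis
  proof (rule that[of "ennreal (exp (C * T)) * U"])
    show "ennreal (exp (C * T)) * U < \<infinity>" using U by (simp add: ennreal_mult_less_top)
    fix n k :: nat assume n: "n \<ge> 1" "step_size n < 1" and "k \<le> n"
    define h where "h = step_size n"
    have h: "0 < h" using n T by (simp add: h_def)
    have "(\<integral>\<^sup>+\<omega>. ennreal (indicator (good n k) \<omega> * energy n k \<omega> powr pbar) \<partial>M)
        \<le> ennreal ((1 + C * h) ^ k) * U"
      using \<open>k \<le> n\<close>
    proof (induction k)
      case 0
      have "(\<integral>\<^sup>+\<omega>. ennreal (indicator (good n 0) \<omega> * energy n 0 \<omega> powr pbar) \<partial>M) \<le> U"
        unfolding U_def by (intro nn_integral_mono ennreal_leI) (auto simp: energy_def X_0 indicator_def)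
      then show ?case by simp
    next
      case (Suc k)
      have "(\<integral>\<^sup>+\<omega>. ennreal (indicator (good n (Suc k)) \<omega> * energy n (Suc k) \<omega> powr pbar) \<partial>M)
        \<le> ennreal (1 + C * h) * (\<integral>\<^sup>+\<omega>. ennreal (indicator (good n (Suc k)) \<omega> * energy n k \<omega> powr pbar) \<partial>M)"
        unfolding h_def using step[OF n] Suc.prems by simp
      also have "\<dots> \<le> ennreal (1 + C * h) * (\<integral>\<^sup>+\<omega>. ennreal (indicator (good n k) \<omega> * energy n k \<omega> powr pbar) \<partial>M)"
        using good_Suc_subset[of n k]
        by (intro mult_left_mono nn_integral_mono ennreal_leI) (auto simp: indicator_def)
      also have "\<dots> \<le> ennreal (1 + C * h) * (ennreal ((1 + C * h) ^ k) * U)"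
        using Suc by (intro mult_left_mono) auto
      also have "\<dots> = ennreal ((1 + C * h) ^ Suc k) * U"
        using C h by (simp add: ennreal_mult mult.assoc)
      finally show ?case .
    qed
    also have "\<dots> \<le> ennreal (exp (C * T)) * U"
    proof (intro mult_right_mono ennreal_leI)
      have "(1 + C * h) ^ k \<le> exp (C * h) ^ k"
        using C h by (intro power_mono) auto
      also have "\<dots> = exp (C * (real k * h))" by (simp add: exp_of_nat_mult[symmetric] mult_ac)
      also have "\<dots> \<le> exp (C * T)"
      proof -
        have "real k * h \<le> T"
          using grid[OF n(1) \<open>k \<le> n\<close>] by (simp only: h_def atLeastAtMost_iff)
        then show ?thesis using C by (simp add: mult_left_mono)
      qed
      finally show "(1 + C * h) ^ k \<le> exp (C * T)" .
    qed simp
    finally show "(\<integral>\<^sup>+\<omega>. ennreal (indicator (good n k) \<omega> * energy n k \<omega> powr pbar) \<partial>M)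
        \<le> ennreal (exp (C * T)) * U" .
  qed
qed

end

section \<open>Moments off the good set\<close>

context tamed_particle_system
begin

text \<open>The noise is averaged over the steps, since the average has moments bounded uniformly in
  \<open>n\<close>. It occupies index 0 of the sum over the initial norms, so that
  \<open>one_plus_sum_powr_le\<close> handles both at once.\<close>

definition crude_bound :: "real \<Rightarrow> nat \<Rightarrow> 'w \<Rightarrow> real" where
  "crude_bound L n \<omega> = (1 + real N * L * T + L * T) *
     (1 + (\<Sum>i=0..N. if i = 0 then (\<Sum>l<n. noise_weight 1 n l \<omega>) / real n else norm (X0' i \<omega>)))"

lemma crude_bound_ge:
  fixes L :: real
  assumes "L \<ge> 0"
  shows "(1 + N * L * T + L * T) * (1 + (\<Sum>i=1..N. norm (X0' i \<omega>)) + (\<Sum>l<n. noise_weight 1 n l \<omega>) / n)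
    \<le> crude_bound L n \<omega>"
  unfolding crude_bound_def using assms T
  by (simp add: sum.atLeast_Suc_atMost[of 0] algebra_simps)

lemma crude_bound_nonneg:
  assumes "L \<ge> 0"
  shows "0 \<le> crude_bound L n \<omega>"
proof -
  have "0 \<le> noise_weight m n l \<omega>" for m l
    unfolding noise_weight_def using T
    by (intro zero_le_power add_nonneg_nonneg sum_nonneg divide_nonneg_nonneg real_sqrt_ge_zero) auto
  then have "0 \<le> (\<Sum>l<n. noise_weight 1 n l \<omega>) / real n"
    by (intro divide_nonneg_nonneg sum_nonneg) auto
  then show ?thesis
    unfolding crude_bound_def using assms T
    by (intro mult_nonneg_nonneg add_nonneg_nonneg sum_nonneg) auto
qed

lemma norm_X_le:
  fixes L :: real
  assumes L: "\<And>x h. 0 < h \<Longrightarrow> h < 1 \<Longrightarrow> norm (T1 x h) \<le> L * h powr (- 2)"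
      "\<And>x h. 0 < h \<Longrightarrow> h < 1 \<Longrightarrow> norm (T2 x h) \<le> L * h powr (- 3 / 2)"
    and h: "h = step_size n" "0 < h" "h < 1"
  shows "norm (X n k i \<omega>) \<le> norm (X0' i \<omega>) + k * (L * h powr (- 1))
    + L * h powr (- 3 / 2) * (\<Sum>l<k. \<Sum>r\<in>UNIV. \<bar>increment n l (i, r) \<omega>\<bar>)"
proof (induction k)
  case 0
  then show ?case by (simp add: X_0)
next
  case (Suc k)
  have "norm (drift n k i \<omega>) \<le> L * h powr (- 2)"
    unfolding drift_def h(1)[symmetric] by (rule L(1)[OF h(2,3)])
  then have "norm (h *\<^sub>R drift n k i \<omega>) \<le> h * (L * h powr (- 2))"
    using h(2) by (simp add: mult_left_mono)
  also have "\<dots> = L * h powr (- 1)"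
  proof -
    have "h * h powr (- 2) = h powr (1 + (- 2))" unfolding powr_add using h(2) by simp
    then show ?thesis by (simp add: mult.left_commute)
  qed
  finally have 1: "norm (h *\<^sub>R drift n k i \<omega>) \<le> L * h powr (- 1)" .
  have "norm (\<Sum>r\<in>UNIV. increment n k (i, r) \<omega> *\<^sub>R diffusion n k (i, r) \<omega>)
    \<le> (\<Sum>r\<in>UNIV. \<bar>increment n k (i, r) \<omega>\<bar> * (L * h powr (- 3 / 2)))"
    using L(2) h(2,3) unfolding diffusion_def h(1)[symmetric]
    by (intro order.trans[OF norm_sum] sum_mono) (auto intro!: mult_left_mono)
  also have "\<dots> = L * h powr (- 3 / 2) * (\<Sum>r\<in>UNIV. \<bar>increment n k (i, r) \<omega>\<bar>)"
    by (simp add: sum_distrib_left mult_ac)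
  finally have 2: "norm (\<Sum>r\<in>UNIV. increment n k (i, r) \<omega> *\<^sub>R diffusion n k (i, r) \<omega>)
    \<le> L * h powr (- 3 / 2) * (\<Sum>r\<in>UNIV. \<bar>increment n k (i, r) \<omega>\<bar>)" .
  have "norm (X n (Suc k) i \<omega>) \<le> norm (X n k i \<omega>) + norm (h *\<^sub>R drift n k i \<omega>)
    + norm (\<Sum>r\<in>UNIV. increment n k (i, r) \<omega> *\<^sub>R diffusion n k (i, r) \<omega>)"
    unfolding X_Suc h(1)[symmetric] by (intro norm_triangle_le add_right_mono norm_triangle_ineq)
  also have "\<dots> \<le> (norm (X0' i \<omega>) + k * (L * h powr (- 1))
    + L * h powr (- 3 / 2) * (\<Sum>l<k. \<Sum>r\<in>UNIV. \<bar>increment n l (i, r) \<omega>\<bar>)) + L * h powr (- 1)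
    + L * h powr (- 3 / 2) * (\<Sum>r\<in>UNIV. \<bar>increment n k (i, r) \<omega>\<bar>)"
    using Suc 1 2 by (intro add_mono)
  also have "\<dots> = norm (X0' i \<omega>) + Suc k * (L * h powr (- 1))
    + L * h powr (- 3 / 2) * (\<Sum>l<Suc k. \<Sum>r\<in>UNIV. \<bar>increment n l (i, r) \<omega>\<bar>)"
    by (simp add: algebra_simps add_divide_distrib)
  finally show ?case .
qed

text \<open>There are at most \<open>T / h\<close> drift steps of size
  \<open>L * h powr (- 1)\<close>, and as many noise steps of size
  \<open>L * h powr (- 3 / 2) * sqrt h\<close> times normalized increments. Both add up to order
  \<open>h powr (- 2)\<close>, and the energy is quadratic in the state.\<close>

lemma energy_crude_bound:
  fixes L :: real
  assumes L: "L \<ge> 0" "\<And>x h. 0 < h \<Longrightarrow> h < 1 \<Longrightarrow> norm (T1 x h) \<le> L * h powr (- 2)"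
      "\<And>x h. 0 < h \<Longrightarrow> h < 1 \<Longrightarrow> norm (T2 x h) \<le> L * h powr (- 3 / 2)"
    and n: "n \<ge> 1" "step_size n < 1" and "k \<le> n"
  shows "energy n k \<omega> \<le> step_size n powr (- 4) * (crude_bound L n \<omega>)\<^sup>2"
proof -
  define h where "h = step_size n"
  have h: "0 < h" "h < 1" "n * h = T" using n T by (auto simp: h_def)
  define S where "S = (\<Sum>l<n. \<Sum>j\<in>{1..N} \<times> UNIV. \<bar>increment n l j \<omega>\<bar> / sqrt h)"
  define Y where "Y = (\<Sum>i=1..N. norm (X0' i \<omega>))"
  have S0: "0 \<le> S" unfolding S_def using h by (intro sum_nonneg) auto
  have Y0: "0 \<le> Y" unfolding Y_def by (intro sum_nonneg) auto
  have hp: "1 \<le> h powr (- 2)" "h powr (- 1) * n = T * h powr (- 2)" "h powr (- 3 / 2) * sqrt h = h powr (- 1)"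
    "h powr (- 1) = h powr (- 2) * h"
  proof -
    show "1 \<le> h powr (- 2)" using h powr_mono'[of "- 2" 0 h] by simp
    show e: "h powr (- 1) = h powr (- 2) * h"
      using h powr_add[of h "- 2" 1] by simp
    show "h powr (- 1) * n = T * h powr (- 2)"
      unfolding e using h(3) by (simp add: mult_ac)
    have "h powr (- 3 / 2) * sqrt h = h powr (- 3 / 2 + 1 / 2)"
      using h by (simp only: powr_add powr_half_sqrt)
    then show "h powr (- 3 / 2) * sqrt h = h powr (- 1)" by simp
  qed
  have sq: "sqrt (energy n k \<omega>) \<le> 1 + (\<Sum>i=1..N. norm (X n k i \<omega>))"
  proof (rule real_le_lsqrt)
    have "(\<Sum>i=1..N. (norm (X n k i \<omega>))\<^sup>2) \<le> (\<Sum>i=1..N. norm (X n k i \<omega>))\<^sup>2"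
      using L2_set_le_sum[of "{1..N}" "\<lambda>i. norm (X n k i \<omega>)"]
      by (simp add: L2_set_def real_sqrt_le_iff sqrt_le_D sum_nonneg)
    moreover have "0 \<le> (\<Sum>i=1..N. norm (X n k i \<omega>))"
      by (intro sum_nonneg) simp
    ultimately show "energy n k \<omega> \<le> (1 + (\<Sum>i=1..N. norm (X n k i \<omega>)))\<^sup>2"
      unfolding energy_def power2_sum by simp
  qed (intro add_nonneg_nonneg sum_nonneg, auto)
  also have "(\<Sum>i=1..N. norm (X n k i \<omega>)) \<le> (\<Sum>i=1..N. norm (X0' i \<omega>) + n * (L * h powr (- 1))
    + L * h powr (- 3 / 2) * (\<Sum>l<n. \<Sum>r\<in>UNIV. \<bar>increment n l (i, r) \<omega>\<bar>))"
  proof (intro sum_mono)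
    fix i
    have "(\<Sum>l<k. \<Sum>r\<in>UNIV. \<bar>increment n l (i, r) \<omega>\<bar>) \<le> (\<Sum>l<n. \<Sum>r\<in>UNIV. \<bar>increment n l (i, r) \<omega>\<bar>)"
      using \<open>k \<le> n\<close> by (intro sum_mono2) (auto intro: sum_nonneg)
    then have "k * (L * h powr (- 1)) + L * h powr (- 3 / 2) * (\<Sum>l<k. \<Sum>r\<in>UNIV. \<bar>increment n l (i, r) \<omega>\<bar>)
      \<le> n * (L * h powr (- 1)) + L * h powr (- 3 / 2) * (\<Sum>l<n. \<Sum>r\<in>UNIV. \<bar>increment n l (i, r) \<omega>\<bar>)"
      using \<open>k \<le> n\<close> L(1) by (intro add_mono mult_right_mono mult_left_mono) auto
    then show "norm (X n k i \<omega>) \<le> norm (X0' i \<omega>) + n * (L * h powr (- 1))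
      + L * h powr (- 3 / 2) * (\<Sum>l<n. \<Sum>r\<in>UNIV. \<bar>increment n l (i, r) \<omega>\<bar>)"
      using norm_X_le[OF L(2,3) h_def h(1,2), of k i \<omega>] by linarith
  qed
  also have "\<dots> = Y + N * (L * (h powr (- 1) * n)) + L * (h powr (- 3 / 2) * sqrt h) * S"
  proof -
    have "S = (\<Sum>i=1..N. \<Sum>l<n. \<Sum>r\<in>UNIV. \<bar>increment n l (i, r) \<omega>\<bar>) / sqrt h"
      unfolding S_def by (subst sum.swap) (simp add: sum.cartesian_product' sum_divide_distrib)
    then have "(\<Sum>i=1..N. \<Sum>l<n. \<Sum>r\<in>UNIV. \<bar>increment n l (i, r) \<omega>\<bar>) = sqrt h * S"
      using h by simp
    then show ?thesis
      by (simp add: Y_def sum.distrib sum_distrib_left[symmetric] mult_ac)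
  qed
  also have "\<dots> = Y + N * (L * (T * h powr (- 2))) + L * (h powr (- 2) * h) * S"
    unfolding hp(2) hp(3) unfolding hp(4) ..
  also have "1 + (Y + N * (L * (T * h powr (- 2))) + L * (h powr (- 2) * h) * S)
    \<le> h powr (- 2) * (1 + Y + N * L * T + L * h * S)"
    using mult_right_mono[OF hp(1), of "1 + Y"] Y0 by (simp add: algebra_simps)
  also have "1 + Y + N * L * T + L * h * S \<le> (1 + N * L * T + L * T) * (1 + Y + (\<Sum>l<n. noise_weight 1 n l \<omega>) / n)"
  proof -
    define V where "V = (\<Sum>l<n. noise_weight 1 n l \<omega>) / n"
    have weights: "(\<Sum>l<n. noise_weight 1 n l \<omega>) = n + S"
      by (simp add: noise_weight_def S_def h_def sum.distrib)
    then have V: "n * V = n + S" using n by (simp add: V_def)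
    have V0: "0 \<le> V" unfolding V_def weights using S0 by (intro divide_nonneg_nonneg) auto
    have "h * S \<le> h * (n * V)" unfolding V using h by (intro mult_left_mono) auto
    also have "\<dots> = T * V" using h(3) by (simp add: mult_ac)
    finally have "L * (h * S) \<le> L * (T * V)" using L(1) by (intro mult_left_mono)
    moreover have "0 \<le> N * L * T" "0 \<le> L * T" "0 \<le> N * L * T * Y" "0 \<le> N * L * T * V" "0 \<le> L * T * Y"
      using L(1) T Y0 V0 by auto
    ultimately show ?thesis using V0 unfolding V_def[symmetric] by (simp add: algebra_simps)
  qed
  also have "h powr (- 2) * ((1 + N * L * T + L * T) * (1 + Y + (\<Sum>l<n. noise_weight 1 n l \<omega>) / n))
    \<le> h powr (- 2) * crude_bound L n \<omega>"
    using crude_bound_ge[OF L(1), of \<omega> n] by (intro mult_left_mono) (auto simp: Y_def)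
  finally have "sqrt (energy n k \<omega>) \<le> h powr (- 2) * crude_bound L n \<omega>"
    by (simp add: mult_left_mono)
  then have "(sqrt (energy n k \<omega>))\<^sup>2 \<le> (h powr (- 2) * crude_bound L n \<omega>)\<^sup>2"
    using energy_ge_1[of n k \<omega>] by (intro power_mono) auto
  also have "\<dots> = h powr (- 4) * (crude_bound L n \<omega>)\<^sup>2"
    using h by (simp add: power_mult_distrib power2_eq_square[of "h powr (- 2)"] flip: powr_add)
  finally show ?thesis
    using energy_ge_1[of n k \<omega>] by (simp add: h_def)
qed

text \<open>The order \<open>2 * pbar\<close> need not be an integer. For the noise it is raised to
  the even integer \<open>m\<close>, since Gaussian moments of all orders are finite; for the
  initial values it is kept, since only moments up to \<open>2 * p0\<close> are at hand.\<close>

lemma crude_bound_moment: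
  assumes L: "L \<ge> 0"
  obtains C where "C < \<infinity>"
    "\<And>n. n \<ge> 1 \<Longrightarrow> step_size n < 1 \<Longrightarrow> (\<integral>\<^sup>+\<omega>. ennreal (crude_bound L n \<omega> powr (2 * pbar)) \<partial>M) \<le> C"
    "\<And>n. n \<ge> 1 \<Longrightarrow> step_size n < 1 \<Longrightarrow> crude_bound L n \<in> borel_measurable M"
proof -
  define q where "q = 2 * pbar"
  define m where "m = 2 * nat \<lceil>pbar\<rceil>"
  have q: "0 \<le> q" "q \<le> real m" "q \<le> 2 * p0"
    using pbar_ge_1 pbar(1) by (auto simp: q_def m_def)
  have m: "even m" by (simp add: m_def)
  obtain K where K: "K \<ge> 0" and weight: "\<And>n k. n \<ge> 1 \<Longrightarrow> k < n \<Longrightarrow>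
      integrable M (noise_weight m n k) \<and> expectation (noise_weight m n k) \<le> K"
    by (rule noise_weight_moment[of m]) blast
  obtain K1 where weight1: "\<And>n k. n \<ge> 1 \<Longrightarrow> k < n \<Longrightarrow>
      integrable M (noise_weight 1 n k) \<and> expectation (noise_weight 1 n k) \<le> K1"
    by (rule noise_weight_moment[of 1]) blast
  define c where "c = 1 + real N * L * T + L * T"
  define c' where "c' = c powr q * real (1 + card {0..N}) powr q"
  define e where "e = ennreal (1 + expectation (\<lambda>\<omega>. norm (X0 \<omega>) powr (2 * p0)))"
  have c: "0 \<le> c" using L T by (simp add: c_def)
  have X0'_meas: "X0' i \<in> borel_measurable M" if "i \<in> {1..N}" for i
    using initial_moment(2)[OF that, of 0] p0 by simp
  show ?thesis
  proof (rule that[of "ennreal c' * (1 + (ennreal K + (\<Sum>i=1..N. e)))"])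
    show "ennreal c' * (1 + (ennreal K + (\<Sum>i=1..N. e))) < \<infinity>"
      unfolding e_def by (simp add: ennreal_mult_less_top of_nat_less_top)
    fix n :: nat assume n: "n \<ge> 1" "step_size n < 1"
    define Y where "Y \<omega> i = (if i = 0 then (\<Sum>l<n. noise_weight 1 n l \<omega>) / real n else norm (X0' i \<omega>))" for \<omega> i
    define V where "V \<omega> = (\<Sum>l<n. noise_weight m n l \<omega>) / real n" for \<omega>
    have h: "0 < step_size n" using n T by simp
    have nw_ge: "1 \<le> noise_weight 1 n l \<omega>" for l \<omega>
      unfolding noise_weight_def power_one_right using h by (simp add: sum_nonneg)
    have Y0: "1 \<le> Y \<omega> 0" for \<omega>
    proof -
      have "(\<Sum>l<n. 1) \<le> (\<Sum>l<n. noise_weight 1 n l \<omega>)"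
        by (intro sum_mono nw_ge)
      then show ?thesis using n by (simp add: Y_def)
    qed
    have Y_nonneg: "0 \<le> Y \<omega> i" for \<omega> i
      using Y0[of \<omega>] by (cases "i = 0") (auto simp: Y_def)
    have YV: "Y \<omega> 0 powr q \<le> V \<omega>" for \<omega>
    proof -
      have "Y \<omega> 0 powr q \<le> Y \<omega> 0 powr real m"
        using Y0 q by (intro powr_mono) auto
      also have "\<dots> = Y \<omega> 0 ^ m" using Y0[of \<omega>] by (intro powr_realpow) simp
      also have "\<dots> \<le> (\<Sum>l<n. noise_weight 1 n l \<omega> ^ m) / real n"
        unfolding Y_def using even_power_mean_le[OF n(1) m] by simp
      also have "\<dots> = V \<omega>"
        unfolding V_def noise_weight_def power_one_right ..
      finally show ?thesis .
    qed
    have V_nonneg: "0 \<le> V \<omega>" for \<omega>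
      using order.trans[OF powr_ge_zero YV] .
    have pointwise: "ennreal (crude_bound L n \<omega> powr q)
      \<le> ennreal c' * (1 + (ennreal (V \<omega>) + (\<Sum>i=1..N. ennreal (norm (X0' i \<omega>) powr q))))" for \<omega>
    proof -
      have "crude_bound L n \<omega> powr q = c powr q * (1 + (\<Sum>i=0..N. Y \<omega> i)) powr q"
        unfolding crude_bound_def Y_def[symmetric] c_def[symmetric] using c Y_nonneg
        by (intro powr_mult)
      also have "\<dots> \<le> c powr q * (real (1 + card {0..N}) powr q * (1 + (\<Sum>i=0..N. Y \<omega> i powr q)))"
        by (intro mult_left_mono one_plus_sum_powr_le Y_nonneg q) auto
      also have "\<dots> = c' * (1 + (Y \<omega> 0 powr q + (\<Sum>i=1..N. norm (X0' i \<omega>) powr q)))"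
        by (simp add: c'_def sum.atLeast_Suc_atMost[of 0] Y_def)
      also have "\<dots> \<le> c' * (1 + (V \<omega> + (\<Sum>i=1..N. norm (X0' i \<omega>) powr q)))"
        using YV by (intro mult_left_mono) (auto simp: c'_def)
      finally have "ennreal (crude_bound L n \<omega> powr q) \<le> ennreal (c' * (1 + (V \<omega> + (\<Sum>i=1..N. norm (X0' i \<omega>) powr q))))"
        by (rule ennreal_leI)
      also have "\<dots> = ennreal c' * (1 + (ennreal (V \<omega>) + (\<Sum>i=1..N. ennreal (norm (X0' i \<omega>) powr q))))"
        using V_nonneg by (simp add: ennreal_mult c'_def ennreal_plus sum_nonneg sum_ennreal)
      finally show ?thesis .
    qed
    have V_int: "integrable M V" "expectation V \<le> K"
    proof -
      have int: "integrable M (noise_weight m n l)" if "l \<in> {..<n}" for l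
        using weight[OF n(1)] that by simp
      show "integrable M V"
        unfolding V_def by (intro integrable_divide Bochner_Integration.integrable_sum int)
      have "expectation V = (\<Sum>l<n. expectation (noise_weight m n l)) / n"
        unfolding V_def integral_divide_zero by (simp only: Bochner_Integration.integral_sum[OF int])
      also have "\<dots> \<le> (\<Sum>l<n. K) / n"
        using weight[OF n(1)] by (intro divide_right_mono sum_mono) auto
      finally show "expectation V \<le> K" using n by simp
    qed
    have V_meas: "(\<lambda>\<omega>. ennreal (V \<omega>)) \<in> borel_measurable M"
      using V_int(1) by (intro measurable_compose[OF _ measurable_ennreal]) auto
    have X_meas: "(\<lambda>\<omega>. ennreal (norm (X0' i \<omega>) powr q)) \<in> borel_measurable M" if "i \<in> {1..N}" for i
      using X0'_meas[OF that] by measurable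
    have sum_meas: "(\<lambda>\<omega>. \<Sum>i=1..N. ennreal (norm (X0' i \<omega>) powr q)) \<in> borel_measurable M"
      by (intro borel_measurable_sum X_meas)
    have "(\<integral>\<^sup>+\<omega>. ennreal (crude_bound L n \<omega> powr q) \<partial>M)
      \<le> (\<integral>\<^sup>+\<omega>. ennreal c' * (1 + (ennreal (V \<omega>) + (\<Sum>i=1..N. ennreal (norm (X0' i \<omega>) powr q)))) \<partial>M)"
      by (intro nn_integral_mono pointwise)
    also have "\<dots> = ennreal c' * (\<integral>\<^sup>+\<omega>. 1 + (ennreal (V \<omega>) + (\<Sum>i=1..N. ennreal (norm (X0' i \<omega>) powr q))) \<partial>M)"
      by (intro nn_integral_cmult borel_measurable_add V_meas sum_meas borel_measurable_const)
    also have "(\<integral>\<^sup>+\<omega>. 1 + (ennreal (V \<omega>) + (\<Sum>i=1..N. ennreal (norm (X0' i \<omega>) powr q))) \<partial>M)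
      = (\<integral>\<^sup>+\<omega>. 1 \<partial>M) + (\<integral>\<^sup>+\<omega>. ennreal (V \<omega>) + (\<Sum>i=1..N. ennreal (norm (X0' i \<omega>) powr q)) \<partial>M)"
      by (intro nn_integral_add borel_measurable_add V_meas sum_meas borel_measurable_const)
    also have "(\<integral>\<^sup>+\<omega>. ennreal (V \<omega>) + (\<Sum>i=1..N. ennreal (norm (X0' i \<omega>) powr q)) \<partial>M)
      = (\<integral>\<^sup>+\<omega>. ennreal (V \<omega>) \<partial>M) + (\<integral>\<^sup>+\<omega>. (\<Sum>i=1..N. ennreal (norm (X0' i \<omega>) powr q)) \<partial>M)"
      by (intro nn_integral_add V_meas sum_meas)
    also have "(\<integral>\<^sup>+\<omega>. ennreal (V \<omega>) \<partial>M) = ennreal (expectation V)"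
      using V_int(1) V_nonneg by (intro nn_integral_eq_integral) auto
    also have "(\<integral>\<^sup>+\<omega>. (\<Sum>i=1..N. ennreal (norm (X0' i \<omega>) powr q)) \<partial>M)
      = (\<Sum>i=1..N. \<integral>\<^sup>+\<omega>. ennreal (norm (X0' i \<omega>) powr q) \<partial>M)"
      by (rule nn_integral_sum[OF X_meas])
    also have "ennreal c' * ((\<integral>\<^sup>+\<omega>. 1 \<partial>M) + (ennreal (expectation V)
        + (\<Sum>i=1..N. \<integral>\<^sup>+\<omega>. ennreal (norm (X0' i \<omega>) powr q) \<partial>M)))
      \<le> ennreal c' * (1 + (ennreal K + (\<Sum>i=1..N. e)))"
      unfolding e_def using q
      by (intro mult_left_mono add_mono sum_mono initial_moment(1) ennreal_leI V_int)
        (auto simp: emeasure_space_1)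
    finally show "(\<integral>\<^sup>+\<omega>. ennreal (crude_bound L n \<omega> powr (2 * pbar)) \<partial>M)
      \<le> ennreal c' * (1 + (ennreal K + (\<Sum>i=1..N. e)))"
      unfolding q_def .
    have Y_meas: "(\<lambda>\<omega>. Y \<omega> i) \<in> borel_measurable M" if "i \<in> {0..N}" for i
    proof (cases "i = 0")
      case True
      have "noise_weight 1 n l \<in> borel_measurable M" if "l \<in> {..<n}" for l
        using weight1[OF n(1)] that by auto
      then show ?thesis
        unfolding Y_def using True by (auto intro!: borel_measurable_divide borel_measurable_sum)
    next
      case False
      then show ?thesis
        unfolding Y_def using X0'_meas[of i] that by auto
    qed
    show "crude_bound L n \<in> borel_measurable M"
      unfolding crude_bound_def[abs_def] Y_def[symmetric]
      by (intro borel_measurable_times borel_measurable_add borel_measurable_const borel_measurable_sum Y_meas)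
  qed
qed

text \<open>The solution \<open>P\<close> of \<open>P + G * (1 + 4 * P) / 2 = pbar\<close>: of the
  available exponent, \<open>P\<close> goes to the crude bound and the rest to the energy at the
  exit time. The hypothesis \<open>1 + 5 / 2 * G \<le> pbar\<close> says exactly that
  \<open>P\<close> is at least 1.\<close>

definition "moment_order = (2 * pbar - G) / (2 + 4 * G)"

lemma moment_order:
  "1 \<le> moment_order" "moment_order \<le> pbar" "moment_order + G * (1 + 4 * moment_order) / 2 = pbar"
proof -
  show eq: "moment_order + G * (1 + 4 * moment_order) / 2 = pbar"
  proof -
    have "moment_order * (2 + 4 * G) = 2 * pbar - G"
      using G_pos by (simp add: moment_order_def)
    then show ?thesis by (simp add: field_simps)
  qed
  show 1: "1 \<le> moment_order"
    using G_pos pbar(2) by (simp add: moment_order_def field_simps)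
  show "moment_order \<le> pbar"
  proof -
    have "0 \<le> G * (1 + 4 * moment_order)" using G_pos 1 by (intro mult_nonneg_nonneg) auto
    then show ?thesis using eq by linarith
  qed
qed

text \<open>
  If the path leaves the good set, let \<open>l\<close> be its first exit time. There
  \<open>energy n l powr (G * (1 + 4 * moment_order) / 2)\<close> exceeds \<open>h powr (- (1 + 4 * moment_order))\<close>,
  which pays for the factor \<open>h powr (- 4)\<close> of the crude bound and leaves one factor \<open>h\<close> for the
  sum over the at most \<open>T / h\<close> possible exit times.
\<close>

lemma energy_split_at_exit:
  assumes L: "L \<ge> 0" "\<And>x h. 0 < h \<Longrightarrow> h < 1 \<Longrightarrow> norm (T1 x h) \<le> L * h powr (- 2)"
      "\<And>x h. 0 < h \<Longrightarrow> h < 1 \<Longrightarrow> norm (T2 x h) \<le> L * h powr (- 3 / 2)"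
    and n: "n \<ge> 1" "step_size n < 1" and "k \<le> n" and \<omega>: "\<omega> \<in> space M"
  shows "energy n k \<omega> powr moment_order \<le> indicator (good n k) \<omega> * energy n k \<omega> powr pbar
    + (\<Sum>l<k. step_size n * (indicator (good n l) \<omega> * energy n l \<omega> powr pbar + crude_bound L n \<omega> powr (2 * pbar)))"
proof -
  define h where "h = step_size n"
  define Z where "Z = crude_bound L n \<omega>"
  define P where "P = moment_order"
  have h: "0 < h" "h < 1" using n T by (auto simp: h_def)
  have terms: "0 \<le> h * (indicator (good n l) \<omega> * energy n l \<omega> powr pbar + Z powr (2 * pbar))" for l
    using h by simp
  show ?thesis
  proof (cases "\<omega> \<in> good n k")
    case True
    have "energy n k \<omega> powr P \<le> energy n k \<omega> powr pbar"
      using energy_ge_1 moment_order(2) unfolding P_def by (intro powr_mono) auto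
    moreover have "0 \<le> (\<Sum>l<k. h * (indicator (good n l) \<omega> * energy n l \<omega> powr pbar + Z powr (2 * pbar)))"
      by (intro sum_nonneg terms)
    ultimately show ?thesis using True by (simp add: P_def h_def Z_def)
  next
    case False
    define exits where "exits l \<longleftrightarrow> l < k \<and> h powr (- 2 / G) < energy n l \<omega>" for l
    have "\<exists>l. exits l" using False \<omega> by (auto simp: good_def exits_def h_def not_le)
    then obtain l where l: "exits l" "\<And>l'. l' < l \<Longrightarrow> \<not> exits l'"
      using exists_least_iff[of exits] by blast
    have lk: "l < k" and exit: "h powr (- 2 / G) < energy n l \<omega>" using l(1) by (auto simp: exits_def)
    \<comment> \<open>\<open>good n l\<close> restricts only the times before \<open>l\<close>, so
      it still holds at the exit time although \<open>energy n l\<close> is already too large. Hence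
      \<open>good_moment\<close> controls this large energy.\<close>
    have good: "\<omega> \<in> good n l"
      using l(2) lk \<omega> by (auto simp: good_def exits_def h_def not_less)
    define E where "E = energy n l \<omega>"
    define g where "g = G * (1 + 4 * P) / 2"
    have E1: "1 \<le> E" unfolding E_def by (rule energy_ge_1)
    have P: "1 \<le> P" "P + g = pbar" using moment_order by (auto simp: P_def g_def)
    have g0: "0 \<le> g" using G_pos P by (simp add: g_def)
    have exitg: "1 \<le> h powr (1 + 4 * P) * E powr g"
    proof -
      have "(- 2 / G) * g = - (1 + 4 * P)"
        using G_pos by (simp add: g_def field_simps)
      then have "h powr (- (1 + 4 * P)) = (h powr (- 2 / G)) powr g"
        unfolding powr_powr by simp
      also have "\<dots> \<le> E powr g" using exit g0 by (intro powr_mono2) (auto simp: E_def)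
      finally have "h powr (1 + 4 * P) * h powr (- (1 + 4 * P)) \<le> h powr (1 + 4 * P) * E powr g"
        by (intro mult_left_mono) auto
      then show ?thesis using h by (simp flip: powr_add)
    qed
    have "energy n k \<omega> powr P \<le> (h powr (- 4) * Z\<^sup>2) powr P"
      using energy_crude_bound[OF L n \<open>k \<le> n\<close>, of \<omega>] energy_ge_1[of n k \<omega>] P
      unfolding h_def Z_def by (intro powr_mono2) auto
    also have "\<dots> = h powr (- 4 * P) * (Z\<^sup>2) powr P"
      by (simp add: powr_mult powr_powr)
    also have "\<dots> \<le> h powr (- 4 * P) * (Z\<^sup>2) powr P * (h powr (1 + 4 * P) * E powr g)"
      using mult_left_mono[OF exitg, of "h powr (- 4 * P) * (Z\<^sup>2) powr P"] by simp
    also have "\<dots> = (h powr (- 4 * P) * h powr (1 + 4 * P)) * ((Z\<^sup>2) powr P * E powr g)"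
      by (simp only: mult_ac)
    also have "h powr (- 4 * P) * h powr (1 + 4 * P) = h"
      using h by (simp flip: powr_add)
    also have "(Z\<^sup>2) powr P * E powr g \<le> E powr pbar + Z powr (2 * pbar)"
    proof -
      \<comment> \<open>A substitute for Young's inequality: the exponents \<open>P\<close> and
        \<open>g\<close> add up to \<open>pbar\<close>, and the maximum to the power
        \<open>pbar\<close> is one of the two terms on the right.\<close>
      define a where "a = max E (Z\<^sup>2)"
      have "(Z\<^sup>2) powr P * E powr g \<le> a powr P * a powr g"
        using P g0 E1 by (intro mult_mono powr_mono2) (auto simp: a_def)
      also have "\<dots> = a powr pbar" by (simp add: P(2) flip: powr_add)
      also have "\<dots> \<le> E powr pbar + (Z\<^sup>2) powr pbar" by (auto simp: a_def max_def)
      also have "(Z\<^sup>2) powr pbar = Z powr (2 * pbar)"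
        unfolding Z_def using crude_bound_nonneg[OF L(1), of n \<omega>]
        by (simp add: powr_powr flip: powr_numeral)
      finally show ?thesis .
    qed
    finally have "energy n k \<omega> powr P \<le> h * (indicator (good n l) \<omega> * energy n l \<omega> powr pbar + Z powr (2 * pbar))"
      using h good by (simp add: E_def mult_left_mono)
    also have "\<dots> \<le> (\<Sum>l<k. h * (indicator (good n l) \<omega> * energy n l \<omega> powr pbar + Z powr (2 * pbar)))"
      using lk terms by (intro member_le_sum) auto
    finally show ?thesis using False by (simp add: P_def h_def Z_def)
  qed
qed


text \<open>Chebyshev's inequality is already contained in the pointwise splitting, so it remains to
  integrate term by term: at most \<open>n\<close> exit terms, each costing
  \<open>h * (C + C')\<close>, give \<open>T * (C + C')\<close>.\<close>

lemma uniform_moment_bound: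
  obtains K where "K < \<infinity>"
    "\<And>n k. n \<ge> 1 \<Longrightarrow> step_size n < 1 \<Longrightarrow> k \<le> n \<Longrightarrow>
      (\<integral>\<^sup>+\<omega>. ennreal (energy n k \<omega> powr moment_order) \<partial>M) \<le> K"
proof -
  obtain L where L: "L > 0" "\<forall>x. \<forall>h\<in>{0<..<1}. norm (T1 x h) \<le> min (L * h powr (- 2)) (norm x) \<and>
      norm (T2 x h) \<le> min (L * h powr (- 3 / 2)) (norm x)"
    using H1 unfolding taming_bounds_def by blast
  have L0: "L \<ge> 0" using L(1) by simp
  have LT: "norm (T1 x h) \<le> L * h powr (- 2)" "norm (T2 x h) \<le> L * h powr (- 3 / 2)"
    if "0 < h" "h < 1" for x h
    using L(2) that by (simp_all add: Ball_def)
  obtain C where C: "C < \<infinity>" and good: "\<And>n k. n \<ge> 1 \<Longrightarrow> step_size n < 1 \<Longrightarrow> k \<le> n \<Longrightarrow>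
      (\<integral>\<^sup>+\<omega>. ennreal (indicator (good n k) \<omega> * energy n k \<omega> powr pbar) \<partial>M) \<le> C"
    by (rule good_moment) blast
  obtain C' where C': "C' < \<infinity>" and crude: "\<And>n. n \<ge> 1 \<Longrightarrow> step_size n < 1 \<Longrightarrow>
      (\<integral>\<^sup>+\<omega>. ennreal (crude_bound L n \<omega> powr (2 * pbar)) \<partial>M) \<le> C'"
    and crude_meas: "\<And>n. n \<ge> 1 \<Longrightarrow> step_size n < 1 \<Longrightarrow> crude_bound L n \<in> borel_measurable M"
    by (rule crude_bound_moment[OF L0]) blast
  show ?thesis
  proof (rule that[of "C + ennreal T * (C + C')"])
    show "C + ennreal T * (C + C') < \<infinity>"
      using C C' by (simp add: ennreal_mult_less_top)
    fix n k :: nat assume n: "n \<ge> 1" "step_size n < 1" and k: "k \<le> n"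
    define h where "h = step_size n"
    have h: "0 \<le> h" "real n * h = T" using n T by (auto simp: h_def)
    define u where "u l \<omega> = ennreal (indicator (good n l) \<omega> * energy n l \<omega> powr pbar)" for l \<omega>
    define z where "z \<omega> = ennreal (crude_bound L n \<omega> powr (2 * pbar))" for \<omega>
    have u_meas: "u l \<in> borel_measurable M" if "l \<le> n" for l
      unfolding u_def[abs_def]
      by (intro measurable_compose[OF _ measurable_ennreal] borel_measurable_times borel_measurable_indicator
          good_measurable powr_real_measurable energy_measurable borel_measurable_const n that)
    have z_meas: "z \<in> borel_measurable M"
      unfolding z_def[abs_def]
      by (intro measurable_compose[OF _ measurable_ennreal] powr_real_measurable crude_meas borel_measurable_const n)
    have term_meas: "(\<lambda>\<omega>. ennreal h * (u l \<omega> + z \<omega>)) \<in> borel_measurable M" if "l \<in> {..<k}" for l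
      using that k by (intro borel_measurable_times_ennreal borel_measurable_add u_meas z_meas borel_measurable_const) auto
    have "(\<integral>\<^sup>+\<omega>. ennreal (energy n k \<omega> powr moment_order) \<partial>M)
      \<le> (\<integral>\<^sup>+\<omega>. u k \<omega> + (\<Sum>l<k. ennreal h * (u l \<omega> + z \<omega>)) \<partial>M)"
    proof (intro nn_integral_mono)
      fix \<omega> assume "\<omega> \<in> space M"
      from energy_split_at_exit[OF L0 LT n k this]
      have "ennreal (energy n k \<omega> powr moment_order) \<le> ennreal (indicator (good n k) \<omega> * energy n k \<omega> powr pbar
        + (\<Sum>l<k. h * (indicator (good n l) \<omega> * energy n l \<omega> powr pbar + crude_bound L n \<omega> powr (2 * pbar))))"
        unfolding h_def by (rule ennreal_leI)
      also have "\<dots> = u k \<omega> + (\<Sum>l<k. ennreal h * (u l \<omega> + z \<omega>))"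
        using h(1) unfolding u_def z_def
        by (simp add: ennreal_plus ennreal_mult sum_nonneg flip: sum_ennreal)
      finally show "ennreal (energy n k \<omega> powr moment_order) \<le> u k \<omega> + (\<Sum>l<k. ennreal h * (u l \<omega> + z \<omega>))" .
    qed
    also have "\<dots> = (\<integral>\<^sup>+\<omega>. u k \<omega> \<partial>M) + (\<integral>\<^sup>+\<omega>. (\<Sum>l<k. ennreal h * (u l \<omega> + z \<omega>)) \<partial>M)"
      by (intro nn_integral_add u_meas k borel_measurable_sum term_meas)
    also have "(\<integral>\<^sup>+\<omega>. (\<Sum>l<k. ennreal h * (u l \<omega> + z \<omega>)) \<partial>M) = (\<Sum>l<k. \<integral>\<^sup>+\<omega>. ennreal h * (u l \<omega> + z \<omega>) \<partial>M)"
      by (rule nn_integral_sum[OF term_meas])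
    also have "\<dots> \<le> (\<Sum>l<k. ennreal h * (C + C'))"
    proof (intro sum_mono)
      fix l assume "l \<in> {..<k}"
      then have l: "l \<le> n" using k by simp
      have "(\<integral>\<^sup>+\<omega>. ennreal h * (u l \<omega> + z \<omega>) \<partial>M) = ennreal h * (\<integral>\<^sup>+\<omega>. u l \<omega> + z \<omega> \<partial>M)"
        by (intro nn_integral_cmult borel_measurable_add u_meas z_meas l)
      also have "(\<integral>\<^sup>+\<omega>. u l \<omega> + z \<omega> \<partial>M) = (\<integral>\<^sup>+\<omega>. u l \<omega> \<partial>M) + (\<integral>\<^sup>+\<omega>. z \<omega> \<partial>M)"
        by (intro nn_integral_add u_meas z_meas l)
      also have "ennreal h * ((\<integral>\<^sup>+\<omega>. u l \<omega> \<partial>M) + (\<integral>\<^sup>+\<omega>. z \<omega> \<partial>M)) \<le> ennreal h * (C + C')"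
        unfolding u_def z_def by (intro mult_left_mono add_mono good crude n l) simp
      finally show "(\<integral>\<^sup>+\<omega>. ennreal h * (u l \<omega> + z \<omega>) \<partial>M) \<le> ennreal h * (C + C')" .
    qed
    also have "(\<Sum>l<k. ennreal h * (C + C')) = ennreal (real k * h) * (C + C')"
      using h(1) by (simp add: ennreal_mult ennreal_of_nat_eq_real_of_nat mult.assoc)
    also have "\<dots> \<le> ennreal T * (C + C')"
      using k h mult_right_mono[of "real k" "real n" h] by (intro mult_right_mono ennreal_leI) auto
    also have "(\<integral>\<^sup>+\<omega>. u k \<omega> \<partial>M) \<le> C"
      unfolding u_def by (rule good[OF n k])
    finally show "(\<integral>\<^sup>+\<omega>. ennreal (energy n k \<omega> powr moment_order) \<partial>M) \<le> C + ennreal T * (C + C')"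
      by (simp add: add_mono)
  qed
qed

section \<open>From the energy to the moments of one particle\<close>

lemma norm_X_powr_le:
  assumes "i \<in> {1..N}" "1 \<le> p" "p \<le> moment_order"
  shows "norm (X n k i \<omega>) powr (2 * p) \<le> energy n k \<omega> powr moment_order"
proof -
  have "norm (X n k i \<omega>) powr (2 * p) = ((norm (X n k i \<omega>))\<^sup>2) powr p"
    by (simp add: powr_powr flip: powr_numeral)
  also have "\<dots> \<le> energy n k \<omega> powr p"
    using norm_X_squared_le[OF assms(1)] assms(2) by (intro powr_mono2) auto
  also have "\<dots> \<le> energy n k \<omega> powr moment_order"
    using energy_ge_1 assms(3) by (intro powr_mono)
  finally show ?thesis .
qed

end

text \<open>Moments are nonnegative integrals, so the estimate asserts finiteness on the left
  whenever the right-hand side is finite; a Bochner integral, being 0 for non-integrable functions,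
  would not express this.\<close>

theorem lemma13:
  fixes M :: "'w measure"
    and T p0 pbar \<rho> r1 r2 G :: real
    and b :: "real \<Rightarrow> real ^ 'd::finite \<Rightarrow> (real ^ 'd) measure \<Rightarrow> real ^ 'd"
    and \<sigma> :: "real \<Rightarrow> real ^ 'd \<Rightarrow> (real ^ 'd) measure \<Rightarrow> real ^ 'm::finite ^ 'd"
    and T1 T2 :: "real ^ 'd \<Rightarrow> real \<Rightarrow> real ^ 'd"
    and W :: "real \<Rightarrow> 'w \<Rightarrow> real ^ 'm" and X0 :: "'w \<Rightarrow> real ^ 'd"
    and N :: nat
    and W' :: "nat \<Rightarrow> real \<Rightarrow> 'w \<Rightarrow> real ^ 'm" and X0' :: "nat \<Rightarrow> 'w \<Rightarrow> real ^ 'd"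
  assumes "prob_space M" and "T > 0" and "p0 > 1" and "\<rho> > 0" and "r1 > 0" and "r2 > 0"
    and "N \<ge> 1"
    and "brownian_motion M T W"
    and "X0 \<in> borel_measurable M"
    and "indep_of_process M T W X0"
    and "indep_copies M T N W X0 W' X0'"
    and "measurable_data T \<sigma> T1 T2"
    and A1: "integrable M (\<lambda>\<omega>. norm (X0 \<omega>) powr (2 * p0))"
    and A2: "coercivity T p0 b \<sigma>"
    and A6: "drift_poly_lipschitz T \<rho> b"
    and A7: "time_hoelder T b \<sigma>"
    and H1: "taming_bounds T1 T2"
    and H2: "taming_consistent r1 r2 T1"
    and G_eq: "G = max (6 * \<rho>) (((2 * \<rho> + 1) * r2 - 1) / r1)"
    and pbar: "p0 \<ge> pbar" "pbar \<ge> 1 + 5 / 2 * G"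
  shows "\<exists>\<beta>>1. \<exists>K>0. \<forall>n::nat. n \<ge> 1 \<and> T / real n < 1 \<longrightarrow>
    (\<forall>k\<in>{0..n}. \<forall>p\<in>{1..(2 * pbar - G) / (2 + 4 * G)}.
      (SUP i\<in>{1..N}. \<integral>\<^sup>+\<omega>. ennreal
         (norm (mod_euler N (T / real n) b \<sigma> T1 T2 W' X0' k i \<omega>) powr (2 * p)) \<partial>M)
      \<le> ennreal K * (1 + (\<integral>\<^sup>+\<omega>. ennreal (norm (X0 \<omega>) powr (2 * p * \<beta>)) \<partial>M)))"
proof -
  interpret prob_space M by fact
  interpret tamed_particle_system M T p0 pbar \<rho> r1 r2 G b \<sigma> T1 T2 W X0 N W' X0'
    using assms by unfold_locales auto
  obtain K where K: "K < \<infinity>" and bound: "\<And>n k. n \<ge> 1 \<Longrightarrow> step_size n < 1 \<Longrightarrow> k \<le> n \<Longrightarrow>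
      (\<integral>\<^sup>+\<omega>. ennreal (energy n k \<omega> powr moment_order) \<partial>M) \<le> K"
    by (rule uniform_moment_bound) blast
  \<comment> \<open>The added 1 makes the constant positive even if the bound is 0.\<close>
  define K' where "K' = 1 + enn2real K"
  have "K = ennreal (enn2real K)" using K by simp
  also have "\<dots> \<le> ennreal K'" unfolding K'_def by (intro ennreal_leI) simp
  finally have K': "K' > 0" "K \<le> ennreal K'"
    by (simp_all add: K'_def add_pos_nonneg)
  have "(SUP i\<in>{1..N}. \<integral>\<^sup>+\<omega>. ennreal
         (norm (mod_euler N (T / real n) b \<sigma> T1 T2 W' X0' k i \<omega>) powr (2 * p)) \<partial>M)
      \<le> ennreal K' * (1 + (\<integral>\<^sup>+\<omega>. ennreal (norm (X0 \<omega>) powr (2 * p * 2)) \<partial>M))"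
    if n: "n \<ge> 1" "T / real n < 1" and k: "k \<in> {0..n}" and p: "p \<in> {1..(2 * pbar - G) / (2 + 4 * G)}"
    for n k p
  proof (rule SUP_least)
    fix i assume i: "i \<in> {1..N}"
    have "(\<integral>\<^sup>+\<omega>. ennreal (norm (mod_euler N (T / real n) b \<sigma> T1 T2 W' X0' k i \<omega>) powr (2 * p)) \<partial>M)
      \<le> (\<integral>\<^sup>+\<omega>. ennreal (energy n k \<omega> powr moment_order) \<partial>M)"
      using norm_X_powr_le[OF i, of p n k] p
      by (intro nn_integral_mono ennreal_leI) (auto simp: X_def moment_order_def)
    also have "\<dots> \<le> ennreal K'"
      using bound[OF n, of k] k K'(2) by (auto intro: order.trans)
    \<comment> \<open>The second factor is at least 1, whether or not this moment of
      \<open>X0\<close> is finite; the dependence on the law of \<open>X0\<close> is already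
      contained in \<open>K'\<close>.\<close>
    also have "\<dots> \<le> ennreal K' * (1 + (\<integral>\<^sup>+\<omega>. ennreal (norm (X0 \<omega>) powr (2 * p * 2)) \<partial>M))"
      using mult_left_mono[of 1 "1 + (\<integral>\<^sup>+\<omega>. ennreal (norm (X0 \<omega>) powr (2 * p * 2)) \<partial>M)" "ennreal K'"] by simp
    finally show "(\<integral>\<^sup>+\<omega>. ennreal (norm (mod_euler N (T / real n) b \<sigma> T1 T2 W' X0' k i \<omega>) powr (2 * p)) \<partial>M)
      \<le> ennreal K' * (1 + (\<integral>\<^sup>+\<omega>. ennreal (norm (X0 \<omega>) powr (2 * p * 2)) \<partial>M))" .
  qed
  then show ?thesis
    using K'(1) by (intro exI[of _ "2 :: real"] exI[of _ K'] conjI allI impI ballI) auto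
qed

end
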